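(* Let $k$ be a fixed positive integer. For each $n$, let $P_n$ be a positive integer and $\mathcal{D}_n$ a probability distribution on $\{1,2,\dots,P_n\}$, and consider the general random intersection graph $G(n,P_n,\mathcal{D}_n)$. Let $X_n$ be a random variable with distribution $\mathcal{D}_n$, and define the sequence $\alpha_n$ by $$\frac{\{\mathbb{E}[X_n]\}^2}{P_n}=\frac{\ln n+(k-1)\ln\ln n+\alpha_n}{n}.$$ If $\mathbb{E}[X_n]=\Omega\big(\sqrt{\ln n}\big)$ and $\mathrm{Var}[X_n]=o\Big(\frac{\{\mathbb{E}[X_n]\}^2}{n(\ln n)^2}\Big)$, then $$\lim_{n\to\infty}\mathbb{P}[G(n,P_n,\mathcal{D}_n)\text{ is }k\text{-connected}]=\begin{cases}0,&\text{if }\lim_{n\to\infty}\alpha_n=-\infty,\\ 1,&\text{if }\lim_{n\to\infty}\alpha_n=\infty,\\ e^{-\frac{e^{-\alpha^*}}{(k-1)!}},&\text{if }\lim_{n\to\infty}\alpha_n=\alpha^*\in(-\infty,\infty),\end{cases}$$ and $$\lim_{n\to\infty}\mathbb{P}[G(n,P_n,\mathcal{D}_n)\text{ has minimum node degree at least }k]=\begin{cases}0,&\text{if }\lim_{n\to\infty}\alpha_n=-\infty,\\ 1,&\text{if }\lim_{n\to\infty}\alpha_n=\infty,\\ e^{-\frac{e^{-\alpha^*}}{(k-1)!}},&\text{if }\lim_{n\to\infty}\alpha_n=\alpha^*\in(-\infty,\infty).\end{cases}$$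
   Context: General random intersection graph $G(n,P_n,\mathcal{D}_n)$: node set $\{v_1,\dots,v_n\}$; there is a pool of $P_n$ distinct objects; independently for each node $v_i$, an object set $S_i$ is formed by first drawing its size $|S_i|$ from $\mathcal{D}_n$ and then, conditional on $|S_i|=s$, choosing $S_i$ uniformly at random among all $s$-element subsets of the pool. Two distinct nodes $v_i,v_j$ are joined by an undirected edge iff $S_i\cap S_j\neq\emptyset$. A graph is $k$-connected if every pair of nodes is joined by at least $k$ internally node-disjoint paths (equivalently, it cannot be disconnected by deleting at most $k-1$ nodes or edges). All parameters are sequences indexed by $n$, limits are as $n\to\infty$, $k$ does not depend on $n$, and $o,\omega,O,\Omega$ are standard Landau notation. *)

theory Defs
  imports
    "HOL-Probability.Probability"
    "HOL-Library.Landau_Symbols"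
    "Graph_Theory.Pair_Digraph"
    "Graph_Theory.Vertex_Walk"
begin

text \<open>
  Simple undirected graphs are symmetric loop-free digraphs without parallel arcs: the locale
  \<^locale>\<open>pair_graph\<close>. An undirected edge is a pair of opposite arcs, so the degree of a node
  is its out-degree.
\<close>

definition min_degree :: "'a pair_pre_digraph \<Rightarrow> nat" where
  "min_degree G = (MIN v\<in>pverts G. out_degree (with_proj G) v)"

definition paths_between :: "'a pair_pre_digraph \<Rightarrow> 'a \<Rightarrow> 'a \<Rightarrow> 'a list set" where
  "paths_between G u v = {p. vpath p (with_proj G) \<and> hd p = u \<and> last p = v}"

text \<open>
  For a path \<open>p\<close> (a list of distinct nodes) with distinct ends \<open>u\<close> and \<open>v\<close>, the
  internal nodes are \<open>set p - {u, v}\<close>. The paths form a set, so a direct edge between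
  \<open>u\<close> and \<open>v\<close> is counted as one path only.
\<close>

definition internally_disjoint :: "'a \<Rightarrow> 'a \<Rightarrow> 'a list set \<Rightarrow> bool" where
  "internally_disjoint u v Q \<longleftrightarrow>
     (\<forall>p\<in>Q. \<forall>q\<in>Q. p \<noteq> q \<longrightarrow> (set p - {u, v}) \<inter> (set q - {u, v}) = {})"

definition k_connected :: "nat \<Rightarrow> 'a pair_pre_digraph \<Rightarrow> bool" where
  "k_connected k G \<longleftrightarrow>
     (\<forall>u\<in>pverts G. \<forall>v\<in>pverts G. u \<noteq> v \<longrightarrow>
        (\<exists>Q. Q \<subseteq> paths_between G u v \<and> finite Q \<and> k \<le> card Q \<and> internally_disjoint u v Q))"

definition intersection_graph :: "nat \<Rightarrow> (nat \<Rightarrow> 'b set) \<Rightarrow> nat pair_pre_digraph" where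
  "intersection_graph n S =
     \<lparr> pverts = {1..n},
       parcs = {(i, j). i \<in> {1..n} \<and> j \<in> {1..n} \<and> i \<noteq> j \<and> S i \<inter> S j \<noteq> {}} \<rparr>"

lemma pair_graph_intersection_graph: "pair_graph (intersection_graph n S)"
proof
  show "finite (parcs (intersection_graph n S))"
    by (rule finite_subset[of _ "{1..n} \<times> {1..n}"]) (auto simp: intersection_graph_def)
qed (auto simp: intersection_graph_def symmetric_def sym_def)

text \<open>The object pool of size \<open>P\<close> is \<open>{1..P}\<close>.\<close>

definition object_set_pmf :: "nat \<Rightarrow> nat pmf \<Rightarrow> nat set pmf" where
  "object_set_pmf P D = bind_pmf D (\<lambda>s. pmf_of_set {A. A \<subseteq> {1..P} \<and> card A = s})"

text \<open>
  The object sets of the nodes are independent; the default value \<open>{}\<close> is only taken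
  outside the node set.
\<close>

definition random_intersection_graph :: "nat \<Rightarrow> nat \<Rightarrow> nat pmf \<Rightarrow> nat pair_pre_digraph pmf" where
  "random_intersection_graph n P D =
     map_pmf (intersection_graph n) (Pi_pmf {1..n} {} (\<lambda>_. object_set_pmf P D))"

end

theory Submission
  imports Defs "HOL-Real_Asymp.Real_Asymp"
begin

text \<open>
  By Chebyshev's inequality all \<open>n\<close> set sizes lie with high probability within a factor
  \<open>1 + o(1 / ln n)\<close> of their mean. Both properties are increasing in the object sets, so a monotone coupling
  sandwiches the graph between two graphs whose object sets have a fixed size \<open>K\<close>, and this changes
  \<open>\<alpha>\<close> only by a negligible amount. Replacing \<open>K\<close> by a multiple, or the pool by a larger one, one may
  further assume that \<open>y = n * K\<^sup>2 / P\<close> is of order \<open>ln n\<close>.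

  For sets of equal size, any \<open>r\<close> given nodes all have degree less than \<open>k\<close> with probability asymptotic to
  \<open>(y ^ (k - 1) / fact (k - 1) * exp (- y)) ^ r\<close>. This yields the factorial moments of the number of nodes of
  small degree, and Bonferroni's inequalities or the second moment method give the limits for the minimum degree.

  If the minimum degree is at least \<open>k\<close> but the graph is not \<open>k\<close>-connected, then by Menger's theorem some
  connected set \<open>T\<close> with \<open>2 \<le> card T \<le> n / 2\<close> has fewer than \<open>k\<close> outside neighbours. With high
  probability the object sets of any such \<open>T\<close> overlap so little that a union bound over \<open>T\<close>, a spanning
  tree of \<open>T\<close> and its outside neighbours excludes this event.
\<close>

subsection \<open>Menger's theorem\<close>

text \<open>The variance bound is what Chebyshev's inequality needs: a deviation of relative size
  \<open>\<delta> n\<close>, with \<open>\<delta> n * ln n\<close> tending to 0, fails at a single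
  node with probability o(1 / n), so all nodes can be treated at once. The obstacle for equal sizes
  is that edges are dependent. Given the object sets of some nodes, however, the other nodes act
  independently, and whether they are adjacent to none of these nodes depends only on the union of
  the given sets. So the size of that union has to be controlled. For boundedly many nodes, each
  object lost by overlaps costs a factor of at most \<open>exp (K * n / P)\<close>; sizes of order
  at least sqrt (ln n) keep this factor below every power of n. For larger groups a loss of one
  eighth of the union is harmless: choosing the group, its spanning tree and its few neighbours
  costs a factor n and powers of ln n, while being avoided by all other nodes already gains about
  n^(7 / 4) for two nodes. Only single nodes leave no such room, and these are what the minimum
  degree excludes.\<close>

definition separates :: "('a \<times> 'a) set \<Rightarrow> 'a set \<Rightarrow> 'a set \<Rightarrow> 'a set \<Rightarrow> bool" where
  "separates E A B W \<longleftrightarrow>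
     (\<forall>p. p \<noteq> [] \<longrightarrow> successively (\<lambda>a b. (a, b) \<in> E) p \<longrightarrow> hd p \<in> A \<longrightarrow> last p \<in> B \<longrightarrow> set p \<inter> W \<noteq> {})"

text \<open>Disjointness includes the ends, and a one-node list counts as a path, so a node of
  \<open>A \<inter> B\<close> links itself. \<open>separates\<close>, in contrast, tests all walks,
  so walks can be cut and spliced without removing repetitions.\<close>

definition linkage :: "('a \<times> 'a) set \<Rightarrow> 'a set \<Rightarrow> 'a set \<Rightarrow> 'a list set \<Rightarrow> bool" where
  "linkage E A B Q \<longleftrightarrow>
     (\<forall>p\<in>Q. p \<noteq> [] \<and> distinct p \<and> successively (\<lambda>a b. (a, b) \<in> E) p \<and> hd p \<in> A \<and> last p \<in> B) \<and>
     (\<forall>p\<in>Q. \<forall>q\<in>Q. p \<noteq> q \<longrightarrow> set p \<inter> set q = {})"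

text \<open>A walk uses the arc only when it leaves \<open>x\<close>, so just the nodes before the
  last one matter; the last node may be \<open>x\<close> itself.\<close>

lemma successively_insert_arc_tail:
  "successively (\<lambda>a b. (a, b) \<in> insert (x, y) E) (p @ [z]) \<Longrightarrow> x \<notin> set p \<Longrightarrow>
    successively (\<lambda>a b. (a, b) \<in> E) (p @ [z])"
proof (induction p)
  case (Cons a p)
  then show ?case by (cases p) auto
qed simp

lemma successively_insert_arc_head:
  "successively (\<lambda>a b. (a, b) \<in> insert (x, y) E) (z # p) \<Longrightarrow> y \<notin> set p \<Longrightarrow>
    successively (\<lambda>a b. (a, b) \<in> E) (z # p)"
proof (induction p arbitrary: z)
  case (Cons a p)
  then show ?case by auto
qed simp

lemma successively_insert_arc:
  "successively (\<lambda>a b. (a, b) \<in> E) p \<Longrightarrow> successively (\<lambda>a b. (a, b) \<in> insert e E) p"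
  by (erule successively_mono) auto

lemma separates_insert_tail:
  assumes "separates E A B S"
  shows "separates (insert (x, y) E) A B (insert x S)"
  unfolding separates_def
proof (intro allI impI notI)
  fix p
  assume p: "p \<noteq> []" "successively (\<lambda>a b. (a, b) \<in> insert (x, y) E) p" "hd p \<in> A" "last p \<in> B"
    "set p \<inter> insert x S = {}"
  have "x \<notin> set (butlast p)" using p(5) by (meson disjoint_iff in_set_butlastD insertI1)
  then have "successively (\<lambda>a b. (a, b) \<in> E) p"
    using successively_insert_arc_tail[of x y E "butlast p" "last p"] p(1,2)
    unfolding append_butlast_last_id[OF p(1)] by blast
  then have "set p \<inter> S \<noteq> {}" using p(1,3,4) assms unfolding separates_def by blast
  with p(5) show False by auto
qed

lemma separates_insert_head:
  assumes "separates E A B S"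
  shows "separates (insert (x, y) E) A B (insert y S)"
  unfolding separates_def
proof (intro allI impI notI)
  fix p
  assume p: "p \<noteq> []" "successively (\<lambda>a b. (a, b) \<in> insert (x, y) E) p" "hd p \<in> A" "last p \<in> B"
    "set p \<inter> insert y S = {}"
  obtain z q where zq: "p = z # q" using p(1) by (cases p) auto
  have "successively (\<lambda>a b. (a, b) \<in> E) p"
    unfolding zq by (rule successively_insert_arc_head[of x y]) (use p(2,5) zq in auto)
  then have "set p \<inter> S \<noteq> {}" using p(1,3,4) assms unfolding separates_def by blast
  with p(5) show False by auto
qed

text \<open>Up to its first node in \<open>insert x S\<close> a walk has not left \<open>x\<close>,
  so this piece avoids the new arc and already meets \<open>W\<close>. Hence a small separator of
  \<open>A\<close> from \<open>insert x S\<close> without the arc would be a small separator of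
  \<open>A\<close> from \<open>B\<close> with it.\<close>

lemma separates_initial_part:
  assumes S: "separates (insert (x, y) E) A B (insert x S)" and W: "separates E A (insert x S) W"
  shows "separates (insert (x, y) E) A B W"
  unfolding separates_def
proof (intro allI impI)
  fix p
  assume p: "p \<noteq> []" "successively (\<lambda>a b. (a, b) \<in> insert (x, y) E) p" "hd p \<in> A" "last p \<in> B"
  from p S have "\<exists>z\<in>set p. z \<in> insert x S" unfolding separates_def by blast
  then obtain q z r where q: "p = q @ z # r" "z \<in> insert x S" "\<forall>a\<in>set q. a \<notin> insert x S"
    by (auto dest!: split_list_first_prop)
  have "successively (\<lambda>a b. (a, b) \<in> insert (x, y) E) (q @ [z])"
    using p(2) unfolding q(1) by (auto simp: successively_append_iff)
  then have "successively (\<lambda>a b. (a, b) \<in> E) (q @ [z])"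
    by (rule successively_insert_arc_tail) (use q in auto)
  moreover have "hd (q @ [z]) \<in> A" using p(3) q(1) by (cases q) auto
  ultimately have "set (q @ [z]) \<inter> W \<noteq> {}"
    using W q(2) unfolding separates_def by (metis last_snoc snoc_eq_iff_butlast)
  then show "set p \<inter> W \<noteq> {}" unfolding q(1) by auto
qed

lemma separates_final_part:
  assumes S: "separates (insert (x, y) E) A B (insert y S)" and W: "separates E (insert y S) B W"
  shows "separates (insert (x, y) E) A B W"
  unfolding separates_def
proof (intro allI impI)
  fix p
  assume p: "p \<noteq> []" "successively (\<lambda>a b. (a, b) \<in> insert (x, y) E) p" "hd p \<in> A" "last p \<in> B"
  from p S have "\<exists>z\<in>set p. z \<in> insert y S" unfolding separates_def by blast
  then obtain q z r where q: "p = q @ z # r" "z \<in> insert y S" "\<forall>a\<in>set r. a \<notin> insert y S"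
    by (auto dest!: split_list_last_prop)
  have "successively (\<lambda>a b. (a, b) \<in> insert (x, y) E) (z # r)"
    using p(2) unfolding q(1) by (auto simp: successively_append_iff)
  then have "successively (\<lambda>a b. (a, b) \<in> E) (z # r)"
    by (rule successively_insert_arc_head) (use q in auto)
  moreover have "last (z # r) \<in> B" using p(4) q(1) by auto
  ultimately have "set (z # r) \<inter> W \<noteq> {}"
    using W q(2) unfolding separates_def by (metis list.sel(1) list.discI)
  then show "set p \<inter> W \<noteq> {}" unfolding q(1) by auto
qed

text \<open>
  Goering's proof: if deleting the arc \<open>(x, y)\<close> creates a separator \<open>S\<close> with fewer than \<open>k\<close> nodes,
  then a linkage from \<open>A\<close> to \<open>insert x S\<close> and one from \<open>insert y S\<close> to \<open>B\<close> can meet only in \<open>S\<close>,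
  so they are glued along \<open>S\<close> and the arc.
\<close>

theorem menger_sets:
  assumes "finite E" and "\<And>W. finite W \<Longrightarrow> separates E A B W \<Longrightarrow> k \<le> card W"
  shows "\<exists>Q. finite Q \<and> card Q = k \<and> linkage E A B Q"
  using assms
proof (induction E arbitrary: A B rule: finite_induct)
  case empty
  have sing: "\<exists>a. p = [a]" if "p \<noteq> []" "successively (\<lambda>a b. (a, b) \<in> ({} :: ('a \<times> 'a) set)) p" for p :: "'a list"
    using that by (cases p rule: remdups_adj.cases) auto
  have "separates {} A B (A \<inter> B)"
    unfolding separates_def by (auto dest!: sing)
  with empty have "finite (A \<inter> B) \<Longrightarrow> k \<le> card (A \<inter> B)" by blast
  \<comment> \<open>Only finite separators are tested, so \<open>A \<inter> B\<close> may be
    infinite; any \<open>k\<close> of its nodes then do.\<close>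
  then obtain C where C: "C \<subseteq> A \<inter> B" "card C = k" "finite C"
    by (metis infinite_arbitrarily_large obtain_subset_with_card_n)
  show ?case
    by (rule exI[of _ "(\<lambda>a. [a]) ` C"])
      (use C in \<open>auto simp: linkage_def card_image inj_on_def\<close>)
next
  case (insert e E)
  obtain x y where e: "e = (x, y)" by (cases e)
  show ?case
  proof (cases "\<forall>W. finite W \<longrightarrow> separates E A B W \<longrightarrow> k \<le> card W")
    case True
    then obtain Q where Q: "finite Q" "card Q = k" "linkage E A B Q" using insert.IH by blast
    then have "linkage (insert e E) A B Q"
      unfolding linkage_def using successively_insert_arc by metis
    with Q show ?thesis by blast
  next
    case False
    then obtain S where S: "finite S" "separates E A B S" "card S < k" by force
    note sepx = separates_insert_tail[OF S(2), of x y] and sepy = separates_insert_head[OF S(2), of x y]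
    have "k \<le> card (insert x S)" "k \<le> card (insert y S)"
      using insert.prems[of "insert x S"] insert.prems[of "insert y S"] sepx sepy S(1) e by auto
    \<comment> \<open>Fewer than \<open>k\<close> nodes, but at least \<open>k\<close> with one
      more: \<open>S\<close> has exactly \<open>k - 1\<close> nodes, so each of the two linkages
      uses every node of its enlarged separator as an end exactly once.\<close>
    then have xS: "x \<notin> S" "card (insert x S) = k" and yS: "y \<notin> S" "card (insert y S) = k"
      using S(1,3) by (auto simp: card_insert_if split: if_splits)
    have "\<exists>Q. finite Q \<and> card Q = k \<and> linkage E A (insert x S) Q"
      using insert.prems separates_initial_part[OF sepx] e by (intro insert.IH) auto
    then obtain Q1 where Q1: "finite Q1" "card Q1 = k" "linkage E A (insert x S) Q1" by blast
    have "\<exists>Q. finite Q \<and> card Q = k \<and> linkage E (insert y S) B Q"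
      using insert.prems separates_final_part[OF sepy] e by (intro insert.IH) auto
    then obtain Q2 where Q2: "finite Q2" "card Q2 = k" "linkage E (insert y S) B Q2" by blast
    have w1: "p \<noteq> []" "distinct p" "successively (\<lambda>a b. (a, b) \<in> E) p" "hd p \<in> A" "last p \<in> insert x S"
      if "p \<in> Q1" for p using Q1(3) that unfolding linkage_def by auto
    have w2: "p \<noteq> []" "distinct p" "successively (\<lambda>a b. (a, b) \<in> E) p" "hd p \<in> insert y S" "last p \<in> B"
      if "p \<in> Q2" for p using Q2(3) that unfolding linkage_def by auto
    have d1: "p = q" if "p \<in> Q1" "q \<in> Q1" "a \<in> set p" "a \<in> set q" for p q a
      using Q1(3) that unfolding linkage_def by blast
    have d2: "p = q" if "p \<in> Q2" "q \<in> Q2" "a \<in> set p" "a \<in> set q" for p q a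
      using Q2(3) that unfolding linkage_def by blast
    have "inj_on last Q1" by (rule inj_onI) (metis d1 w1(1) last_in_set)
    then have "last ` Q1 = insert x S"
      using w1(5) Q1(1,2) xS(2) S(1) by (intro card_subset_eq) (auto simp: card_image)
    then have "\<forall>s\<in>insert x S. \<exists>p\<in>Q1. last p = s" by (metis imageE)
    then obtain P1 where P1: "P1 s \<in> Q1" "last (P1 s) = s" if "s \<in> insert x S" for s by metis
    have "inj_on hd Q2" by (rule inj_onI) (metis d2 w2(1) hd_in_set)
    then have "hd ` Q2 = insert y S"
      using w2(4) Q2(1,2) yS(2) S(1) by (intro card_subset_eq) (auto simp: card_image)
    then have "\<forall>s\<in>insert y S. \<exists>p\<in>Q2. hd p = s" by (metis imageE)
    then obtain P2 where P2: "P2 s \<in> Q2" "hd (P2 s) = s" if "s \<in> insert y S" for s by metis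
    \<comment> \<open>A node of \<open>S\<close> is already the end of its own path, so by
      disjointness a path of \<open>Q1\<close> meets \<open>S\<close> only at its end.\<close>
    have l1: "w = last p" if "p \<in> Q1" "w \<in> set p" "w \<in> S" for p w
    proof -
      have "P1 w \<in> Q1" "last (P1 w) = w" using P1[of w] that by auto
      then have "P1 w = p" using that w1(1)[of "P1 w"] by (intro d1[of _ _ w]) (auto, metis last_in_set)
      then show ?thesis using \<open>last (P1 w) = w\<close> by simp
    qed
    have l2: "w = hd p" if "p \<in> Q2" "w \<in> set p" "w \<in> S" for p w
    proof -
      have "P2 w \<in> Q2" "hd (P2 w) = w" using P2[of w] that by auto
      then have "P2 w = p" using that w2(1)[of "P2 w"] by (intro d2[of _ _ w]) (auto, metis hd_in_set)
      then show ?thesis using \<open>hd (P2 w) = w\<close> by simp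
    qed
    \<comment> \<open>Following \<open>p\<close> up to the common node and \<open>q\<close> from
      there on gives a walk without the new arc, which \<open>S\<close> must hit; by
      \<open>l1\<close> and \<open>l2\<close> it can be hit only at the common node.\<close>
    have meet: "v \<in> S \<and> v = last p \<and> v = hd q" if pq: "p \<in> Q1" "q \<in> Q2" "v \<in> set p" "v \<in> set q" for p q v
    proof -
      obtain p1 p2 where p: "p = p1 @ v # p2" using pq(3) by (meson split_list)
      obtain q1 q2 where q: "q = q1 @ v # q2" using pq(4) by (meson split_list)
      have "successively (\<lambda>a b. (a, b) \<in> E) (p1 @ v # q2)"
        using w1(3)[OF pq(1)] w2(3)[OF pq(2)] unfolding p q by (auto simp: successively_append_iff)
      moreover have "hd (p1 @ v # q2) \<in> A" using w1(4)[OF pq(1)] p by (cases p1) auto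
      moreover have "last (p1 @ v # q2) \<in> B" using w2(5)[OF pq(2)] q by auto
      ultimately obtain w where w: "w \<in> set (p1 @ v # q2)" "w \<in> S"
        using S(2) unfolding separates_def by blast
      have "w \<notin> set p1"
      proof
        assume a: "w \<in> set p1"
        then have "w = last (v # p2)" using l1[OF pq(1) _ w(2)] p by auto
        then have "w \<in> set (v # p2)" by (metis last_in_set list.discI)
        then show False using a w1(2)[OF pq(1)] p by auto
      qed
      moreover have "w \<notin> set q2"
      proof
        assume a: "w \<in> set q2"
        then have "w = hd (q1 @ [v])" using l2[OF pq(2) _ w(2)] q by (cases q1) auto
        then have "w \<in> set (q1 @ [v])" by (metis hd_in_set snoc_eq_iff_butlast)
        then show False using a w2(2)[OF pq(2)] q by auto
      qed
      ultimately have "w = v" using w(1) by auto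
      then show ?thesis using w(2) l1[OF pq(1,3)] l2[OF pq(2,4)] by auto
    qed
    \<comment> \<open>The path ending in \<open>x\<close> continues through the new arc with the one
      starting in \<open>y\<close>; all other pairs are glued at a shared node, whose second copy is
      dropped by \<open>tl\<close>.\<close>
    define \<sigma> where "\<sigma> s = (if s = x then y else s)" for s
    define g where "g s = (if s = x then P1 x @ P2 y else P1 s @ tl (P2 s))" for s
    have \<sigma>: "\<sigma> s \<in> insert y S" if "s \<in> insert x S" for s using that by (auto simp: \<sigma>_def)
    have set_g: "set (g s) \<subseteq> set (P1 s) \<union> set (P2 (\<sigma> s))" if "s \<in> insert x S" for s
      using w2(1)[OF P2(1)[of s]] that by (auto simp: g_def \<sigma>_def dest: list.set_sel(2)[rotated])
    have path_g: "g s \<noteq> [] \<and> distinct (g s) \<and> successively (\<lambda>a b. (a, b) \<in> insert e E) (g s) \<and>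
        hd (g s) \<in> A \<and> last (g s) \<in> B" if s: "s \<in> insert x S" for s
    proof (cases "s = x")
      case True
      have a: "P1 x \<in> Q1" "last (P1 x) = x" "P2 y \<in> Q2" "hd (P2 y) = y" using P1[of x] P2[of y] by auto
      have "set (P1 x) \<inter> set (P2 y) = {}" using meet[OF a(1,3)] a(2) xS(1) by auto
      then show ?thesis
        using True w1[OF a(1)] w2[OF a(3)] a(2,4) e
          successively_insert_arc[of E "P1 x" e] successively_insert_arc[of E "P2 y" e]
        by (auto simp: g_def successively_append_iff)
    next
      case False
      then have sS: "s \<in> S" using s by auto
      have a: "P1 s \<in> Q1" "last (P1 s) = s" "P2 s \<in> Q2" "hd (P2 s) = s" using P1[of s] P2[of s] sS by auto
      obtain r where r: "P2 s = s # r" using a(4) w2(1)[OF a(3)] by (cases "P2 s") auto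
      have "set (P1 s) \<inter> set r = {}"
        using meet[OF a(1,3)] r w2(2)[OF a(3)] by fastforce
      then show ?thesis
        using False w1[OF a(1)] w2[OF a(3)] a(2) r
          successively_insert_arc[of E "P1 s" e] successively_insert_arc[of E "P2 s" e]
        by (cases r) (auto simp: g_def successively_append_iff)
    qed
    have disj_g: "set (g s) \<inter> set (g t) = {}" if "s \<in> insert x S" "t \<in> insert x S" "s \<noteq> t" for s t
    proof -
      have c1: "set (P1 s) \<inter> set (P1 t) = {}"
        using d1[of "P1 s" "P1 t"] P1[of s] P1[of t] that by fastforce
      have "\<sigma> s \<noteq> \<sigma> t" using that yS(1) by (auto simp: \<sigma>_def)
      then have c2: "set (P2 (\<sigma> s)) \<inter> set (P2 (\<sigma> t)) = {}"
        using d2[of "P2 (\<sigma> s)" "P2 (\<sigma> t)"] P2[OF \<sigma>, of s] P2[OF \<sigma>, of t] that by fastforce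
      have c3: "set (P1 a) \<inter> set (P2 (\<sigma> b)) = {}" if "a \<in> insert x S" "b \<in> insert x S" "a \<noteq> b" for a b
      proof (rule ccontr)
        assume "set (P1 a) \<inter> set (P2 (\<sigma> b)) \<noteq> {}"
        then obtain v where "v \<in> set (P1 a)" "v \<in> set (P2 (\<sigma> b))" by auto
        with meet[of "P1 a" "P2 (\<sigma> b)" v] P1[of a] P2[OF \<sigma>, of b] that
        have "a \<in> S" "a = \<sigma> b" by auto
        then show False using that yS(1) by (auto simp: \<sigma>_def split: if_splits)
      qed
      show ?thesis
        using set_g[OF that(1)] set_g[OF that(2)] c1 c2 c3[OF that] c3[OF that(2,1)] that(3) by blast
    qed
    have "inj_on g (insert x S)"
      by (rule inj_onI) (metis disj_g path_g inf.idem set_empty)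
    then have card_g: "card (g ` insert x S) = k" using xS(2) by (simp only: card_image)
    have link_g: "linkage (insert e E) A B (g ` insert x S)"
      unfolding linkage_def
    proof (rule conjI; intro ballI impI)
      fix p assume "p \<in> g ` insert x S"
      then obtain s where "s \<in> insert x S" "p = g s" by (rule imageE)
      then show "p \<noteq> [] \<and> distinct p \<and> successively (\<lambda>a b. (a, b) \<in> insert e E) p \<and> hd p \<in> A \<and> last p \<in> B"
        using path_g by simp
    next
      fix p q assume "p \<in> g ` insert x S" "q \<in> g ` insert x S" "p \<noteq> q"
      then obtain s t where "s \<in> insert x S" "t \<in> insert x S" "p = g s" "q = g t" "s \<noteq> t" by auto
      then show "set p \<inter> set q = {}" using disj_g by simp
    qed
    show ?thesis
      by (intro exI[of _ "g ` insert x S"] conjI card_g link_g finite_imageI finite.insertI S(1))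
  qed
qed

subsection \<open>Cuts and connected parts\<close>

lemma set_vwalk_arcs_subset_iff:
  "set (vwalk_arcs p) \<subseteq> E \<longleftrightarrow> successively (\<lambda>a b. (a, b) \<in> E) p"
  by (induction p rule: vwalk_arcs.induct) auto

lemma vpath_with_proj_iff:
  "vpath p (with_proj G) \<longleftrightarrow>
     p \<noteq> [] \<and> distinct p \<and> set p \<subseteq> pverts G \<and> successively (\<lambda>a b. (a, b) \<in> parcs G) p"
  by (auto simp: vpath_def vwalk_def set_vwalk_arcs_subset_iff arcs_ends_def arc_to_ends_def)

definition cut_pair :: "'a pair_pre_digraph \<Rightarrow> 'a set \<Rightarrow> 'a set \<Rightarrow> bool" where
  "cut_pair G X T \<longleftrightarrow> X \<subseteq> pverts G \<and> T \<subseteq> pverts G - X \<and> T \<noteq> {} \<and> pverts G - X - T \<noteq> {} \<and>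
     (\<forall>a\<in>T. \<forall>b\<in>pverts G - X - T. (a, b) \<notin> parcs G)"

text \<open>The set version is applied to the neighbours of \<open>u\<close> and of \<open>v\<close>
  in the graph without these two nodes. If \<open>u\<close> and \<open>v\<close> are adjacent, the
  edge is one of the paths and only \<open>k - 1\<close> others are wanted; a separator with at most
  \<open>k - 2\<close> nodes then has room for \<open>u\<close> or \<open>v\<close>, which removes
  the edge.\<close>

lemma disjoint_paths_or_cut:
  assumes G: "pair_graph G" and k: "k < card (pverts G)"
    and noCut: "\<And>X T. cut_pair G X T \<Longrightarrow> k \<le> card X"
    and u: "u \<in> pverts G" and v: "v \<in> pverts G" and uv: "u \<noteq> v"
  shows "\<exists>Q. Q \<subseteq> paths_between G u v \<and> finite Q \<and> k \<le> card Q \<and> internally_disjoint u v Q"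
proof -
  interpret pair_graph G by fact
  define V where "V = pverts G - {u, v}"
  define H where "H = parcs G \<inter> V \<times> V"
  define A where "A = {a \<in> V. (u, a) \<in> parcs G}"
  define B where "B = {b \<in> V. (b, v) \<in> parcs G}"
  define k' where "k' = (if (u, v) \<in> parcs G then k - 1 else k)"
  have finV: "finite (pverts G)" by simp
  have finH: "finite H" unfolding H_def by simp
  have sym: "(b, a) \<in> parcs G" if "(a, b) \<in> parcs G" for a b
    using that arcs_symmetric by blast
  have inV: "set p \<subseteq> V" if "p \<noteq> []" "successively (\<lambda>a b. (a, b) \<in> H) p" "hd p \<in> V" for p
    using that by (induction p rule: induct_list012) (auto simp: H_def)
  have sep: "k' \<le> card W" if W: "finite W" "separates H A B W" for W
  proof (rule ccontr)
    assume less: "\<not> k' \<le> card W"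
    define W' where "W' = W \<inter> V"
    have W': "finite W'" "card W' < k'" "W' \<subseteq> V"
      using less W(1) card_mono[of W W'] by (auto simp: W'_def)
    define R where "R = {a. \<exists>p. p \<noteq> [] \<and> successively (\<lambda>a b. (a, b) \<in> H) p \<and> hd p \<in> A \<and> last p = a \<and> set p \<inter> W' = {}}"
    have A_R: "a \<in> R" if "a \<in> A" "a \<notin> W'" for a
      using that unfolding R_def by (intro CollectI exI[of _ "[a]"]) auto
    have R_V: "R \<subseteq> V - W'"
    proof
      fix a assume "a \<in> R"
      then obtain p where p: "p \<noteq> []" "successively (\<lambda>a b. (a, b) \<in> H) p" "hd p \<in> A" "last p = a" "set p \<inter> W' = {}"
        unfolding R_def by auto
      have "set p \<subseteq> V" by (rule inV[OF p(1,2)]) (use p(3) in \<open>auto simp: A_def\<close>)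
      moreover have "a \<in> set p" using p(1,4) by auto
      ultimately show "a \<in> V - W'" using p(5) by auto
    qed
    have R_B: "R \<inter> B = {}"
    proof (rule ccontr)
      assume "R \<inter> B \<noteq> {}"
      then obtain p where p: "p \<noteq> []" "successively (\<lambda>a b. (a, b) \<in> H) p" "hd p \<in> A" "last p \<in> B" "set p \<inter> W' = {}"
        unfolding R_def by auto
      have "set p \<subseteq> V" by (rule inV[OF p(1,2)]) (use p(3) in \<open>auto simp: A_def\<close>)
      then have "set p \<inter> W = {}" using p(5) unfolding W'_def by auto
      then show False using W(2) p unfolding separates_def by blast
    qed
    have R_step: "b \<in> R" if aR: "a \<in> R" and "(a, b) \<in> parcs G" "b \<in> V - W'" for a b
    proof -
      obtain p where p: "p \<noteq> []" "successively (\<lambda>a b. (a, b) \<in> H) p" "hd p \<in> A" "last p = a" "set p \<inter> W' = {}"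
        using aR unfolding R_def by blast
      have "(a, b) \<in> H" using that R_V unfolding H_def by auto
      then have "successively (\<lambda>a b. (a, b) \<in> H) (p @ [b])"
        using p by (auto simp: successively_append_iff)
      then show ?thesis using p that(3) unfolding R_def by (intro CollectI exI[of _ "p @ [b]"]) auto
    qed
    show False
    proof (cases "(u, v) \<in> parcs G")
      case False
      have "cut_pair G W' (insert u R)"
        unfolding cut_pair_def
      proof (intro conjI ballI notI)
        show "W' \<subseteq> pverts G" "insert u R \<subseteq> pverts G - W'" using W'(3) R_V u by (auto simp: V_def)
        show False if "pverts G - W' - insert u R = {}"
          using that v uv R_V W'(3) by (auto simp: V_def)
      next
        fix a b assume a: "a \<in> insert u R" and b: "b \<in> pverts G - W' - insert u R" and ab: "(a, b) \<in> parcs G"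
        show False
        proof (cases "b = v")
          case True
          then have "a \<in> R" using ab a False by auto
          then show False using ab True R_B R_V by (auto simp: B_def)
        next
          case bv: False
          then have bV: "b \<in> V - W'" using b by (auto simp: V_def)
          show False
          proof (cases "a = u")
            case True
            then show False using A_R[of b] bV ab b by (auto simp: A_def)
          next
            case False
            then show False using R_step[of a b] a ab bV b by auto
          qed
        qed
      qed auto
      then show False using noCut W'(2) False by (fastforce simp: k'_def)
    next
      case True
      then have k2: "card W' + 2 \<le> k" using W'(2) by (auto simp: k'_def)
      have "card (insert u (insert v W')) \<le> card W' + 2"
        using W'(1) by (simp add: card_insert_if)
      then have "\<exists>w. w \<in> pverts G - insert u (insert v W')"
        using k k2 W'(1) by (metis card_mono finite_insert le_less_trans not_less order_trans subsetI DiffI)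
      then obtain w where w: "w \<in> V - W'" by (auto simp: V_def)
      \<comment> \<open>The spare node \<open>w\<close> keeps both sides of the cut nonempty: if
        \<open>w\<close> is not reachable from \<open>u\<close>, then \<open>v\<close> is deleted
        and \<open>u\<close> is separated from \<open>w\<close>; otherwise \<open>u\<close> is
        deleted and \<open>v\<close> is separated from \<open>w\<close>.\<close>
      have ex: "\<exists>X T. cut_pair G X T \<and> card X \<le> card W' + 1"
      proof (cases "w \<in> R")
        case False
        have "cut_pair G (insert v W') (insert u R)"
          unfolding cut_pair_def
        proof (intro conjI ballI notI)
          show "insert v W' \<subseteq> pverts G" "insert u R \<subseteq> pverts G - insert v W'"
            using W'(3) R_V u v uv by (auto simp: V_def)
          show False if "pverts G - insert v W' - insert u R = {}"
            using that w False by (auto simp: V_def)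
        next
          fix a b assume a: "a \<in> insert u R" and b: "b \<in> pverts G - insert v W' - insert u R" and ab: "(a, b) \<in> parcs G"
          have bV: "b \<in> V - W'" using b by (auto simp: V_def)
          show False
          proof (cases "a = u")
            case True
            then show False using A_R[of b] bV ab b by (auto simp: A_def)
          next
            case False
            then show False using R_step[of a b] a ab bV b by auto
          qed
        qed auto
        moreover have "card (insert v W') \<le> card W' + 1" using W'(1) by (simp add: card_insert_if)
        ultimately show ?thesis by blast
      next
        case True
        define T where "T = pverts G - insert u W' - R"
        have "cut_pair G (insert u W') T"
          unfolding cut_pair_def
        proof (intro conjI ballI notI)
          show "insert u W' \<subseteq> pverts G" "T \<subseteq> pverts G - insert u W'"
            using W'(3) u by (auto simp: V_def T_def)
          show False if "T = {}"
            using that v uv R_V W'(3) by (auto simp: V_def T_def)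
          show False if "pverts G - insert u W' - T = {}"
            using that w True by (auto simp: V_def T_def)
        next
          fix a b assume a: "a \<in> T" and b: "b \<in> pverts G - insert u W' - T" and ab: "(a, b) \<in> parcs G"
          have bR: "b \<in> R" and ba: "(b, a) \<in> parcs G" using b sym[OF ab] by (auto simp: T_def)
          show False
          proof (cases "a = v")
            case True
            then show False using bR ba R_B R_V by (auto simp: B_def)
          next
            case False
            then show False using R_step[OF bR ba] a by (auto simp: T_def V_def)
          qed
        qed
        moreover have "card (insert u W') \<le> card W' + 1" using W'(1) by (simp add: card_insert_if)
        ultimately show ?thesis by blast
      qed
      then show False using noCut k2 by fastforce
    qed
  qed
  obtain Q where Q: "finite Q" "card Q = k'" "linkage H A B Q"
    using menger_sets[OF finH sep] by blast
  have QV: "set p \<subseteq> V" "p \<noteq> []" "distinct p" "successively (\<lambda>a b. (a, b) \<in> H) p" "hd p \<in> A" "last p \<in> B" if "p \<in> Q" for p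
    using Q(3) that inV[of p] unfolding linkage_def by (auto simp: A_def)
  have Qd: "set p \<inter> set q = {}" if "p \<in> Q" "q \<in> Q" "p \<noteq> q" for p q
    using Q(3) that unfolding linkage_def by auto
  have Qd': "p = q" if "p \<in> Q" "q \<in> Q" "a \<in> set p" "a \<in> set q" for p q a
    using Qd that by blast
  define Q0 where "Q0 = (\<lambda>p. u # p @ [v]) ` Q"
  define D where "D = (if (u, v) \<in> parcs G then {[u, v]} else {})"
  have "Q0 \<subseteq> paths_between G u v"
  proof
    fix q assume "q \<in> Q0"
    then obtain p where p: "p \<in> Q" "q = u # p @ [v]" unfolding Q0_def by auto
    have "successively (\<lambda>a b. (a, b) \<in> parcs G) p"
      using QV(4)[OF p(1)] by (rule successively_mono) (auto simp: H_def)
    then have "successively (\<lambda>a b. (a, b) \<in> parcs G) q"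
      using QV[OF p(1)] by (auto simp: p(2) successively_append_iff successively_Cons A_def B_def)
    then show "q \<in> paths_between G u v"
      using QV[OF p(1)] u v uv p(2) by (auto simp: paths_between_def vpath_with_proj_iff V_def)
  qed
  moreover have "D \<subseteq> paths_between G u v"
    using u v uv by (auto simp: D_def paths_between_def vpath_with_proj_iff)
  moreover have "finite (Q0 \<union> D)" using Q(1) by (auto simp: Q0_def D_def)
  moreover have "k \<le> card (Q0 \<union> D)"
  proof -
    have "Q0 \<inter> D = {}" using QV(2) by (auto simp: Q0_def D_def)
    moreover have "card Q0 = k'" using Q(2) by (simp add: Q0_def card_image inj_on_def)
    ultimately have "card (Q0 \<union> D) = k' + card D"
      using Q(1) by (subst card_Un_disjoint) (auto simp: Q0_def D_def)
    then show ?thesis by (auto simp: k'_def D_def)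
  qed
  moreover have "internally_disjoint u v (Q0 \<union> D)"
    unfolding internally_disjoint_def
  proof (intro ballI impI)
    fix p q assume "p \<in> Q0 \<union> D" "q \<in> Q0 \<union> D" "p \<noteq> q"
    then show "(set p - {u, v}) \<inter> (set q - {u, v}) = {}"
      by (auto simp: Q0_def D_def split: if_splits dest: Qd')
  qed
  ultimately show ?thesis by (intro exI[of _ "Q0 \<union> D"]) simp
qed

corollary cut_if_not_k_connected:
  assumes "pair_graph G" "k < card (pverts G)" "\<not> k_connected k G"
  shows "\<exists>X T. cut_pair G X T \<and> card X < k"
  using disjoint_paths_or_cut[OF assms(1,2)] assms(3) unfolding k_connected_def by (meson not_le)

text \<open>
  Spanning trees are counted through their parent functions, at most \<open>card T ^ card T\<close> for each root;
  up to a factor polynomial in \<open>card T\<close> this is as good as Cayley's formula.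
\<close>

inductive rooted_tree :: "('a \<Rightarrow> 'a) \<Rightarrow> 'a \<Rightarrow> 'a set \<Rightarrow> bool" for f v where
  root: "rooted_tree f v {v}"
| grow: "rooted_tree f v T \<Longrightarrow> w \<notin> T \<Longrightarrow> f w \<in> T \<Longrightarrow> rooted_tree f v (insert w T)"

lemma rooted_tree_root: "rooted_tree f v T \<Longrightarrow> v \<in> T"
  by (induction rule: rooted_tree.induct) auto

lemma rooted_tree_finite: "rooted_tree f v T \<Longrightarrow> finite T"
  by (induction rule: rooted_tree.induct) auto

lemma rooted_tree_closed: "rooted_tree f v T \<Longrightarrow> w \<in> T - {v} \<Longrightarrow> f w \<in> T"
  by (induction rule: rooted_tree.induct) auto

lemma rooted_tree_cong:
  "rooted_tree f v T \<Longrightarrow> (\<And>w. w \<in> T - {v} \<Longrightarrow> g w = f w) \<Longrightarrow> rooted_tree g v T"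
proof (induction rule: rooted_tree.induct)
  case (grow T w)
  have "g w = f w" using grow rooted_tree_root[OF grow(1)] by auto
  with grow show ?case by (intro rooted_tree.grow) auto
qed (rule rooted_tree.root)

text \<open>A maximal part of \<open>T\<close> that carries such a tree is all of \<open>T\<close>,
  since any smaller part containing the root has an outgoing connection along which the tree
  grows.\<close>

lemma spanning_rooted_tree:
  assumes fin: "finite T" and v: "v \<in> T"
    and conn: "\<And>C. v \<in> C \<Longrightarrow> C \<subset> T \<Longrightarrow> \<exists>a\<in>C. \<exists>b\<in>T - C. R b a"
  shows "\<exists>f. rooted_tree f v T \<and> (\<forall>w\<in>T - {v}. R w (f w))"
proof -
  define \<C> where "\<C> = {C. C \<subseteq> T \<and> (\<exists>f. rooted_tree f v C \<and> (\<forall>w\<in>C - {v}. R w (f w)))}"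
  have "finite \<C>" using fin by (auto simp: \<C>_def)
  moreover have "{v} \<in> \<C>" using v by (auto simp: \<C>_def intro: rooted_tree.root)
  ultimately obtain C where C: "C \<in> \<C>" and max: "\<And>C'. C' \<in> \<C> \<Longrightarrow> C \<subseteq> C' \<Longrightarrow> C = C'"
    by (metis finite_has_maximal empty_iff)
  then obtain f where f: "C \<subseteq> T" "rooted_tree f v C" "\<forall>w\<in>C - {v}. R w (f w)" by (auto simp: \<C>_def)
  have "C = T"
  proof (rule ccontr)
    assume "C \<noteq> T"
    then obtain a b where ab: "a \<in> C" "b \<in> T - C" "R b a"
      using conn[of C] f rooted_tree_root[OF f(2)] by blast
    let ?f = "f(b := a)"
    have "rooted_tree ?f v C" by (rule rooted_tree_cong[OF f(2)]) (use ab in auto)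
    then have "rooted_tree ?f v (insert b C)" by (rule rooted_tree.grow) (use ab in auto)
    moreover have "\<forall>w\<in>insert b C - {v}. R w (?f w)" using f(3) ab by auto
    ultimately have "insert b C \<in> \<C>" using f(1) ab unfolding \<C>_def by blast
    then show False using max[of "insert b C"] ab by auto
  qed
  with f show ?thesis by auto
qed

text \<open>A side of the cut with the fewest nodes is connected and contains at most half of the nodes.\<close>

lemma small_connected_part_if_cut:
  assumes G: "pair_graph G" and cut: "cut_pair G X T" "card X < k"
  shows "\<exists>T X. T \<subseteq> pverts G \<and> T \<noteq> {} \<and> 2 * card T \<le> card (pverts G) \<and> X \<subseteq> pverts G - T \<and> card X < k \<and>
     (\<forall>b\<in>X. \<exists>a\<in>T. (a, b) \<in> parcs G) \<and> (\<forall>b\<in>pverts G - T - X. \<forall>a\<in>T. (a, b) \<notin> parcs G) \<and>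
     (\<exists>f. \<exists>v\<in>T. rooted_tree f v T \<and> (\<forall>w\<in>T - {v}. (w, f w) \<in> parcs G))"
proof -
  interpret pair_graph G by fact
  have sym: "(b, a) \<in> parcs G" if "(a, b) \<in> parcs G" for a b
    using that arcs_symmetric by blast
  obtain T0 where T0: "cut_pair G X T0" and min: "\<And>T'. cut_pair G X T' \<Longrightarrow> card T0 \<le> card T'"
    using ex_has_least_nat[of "cut_pair G X" T card] cut(1) by blast
  have sub: "X \<subseteq> pverts G" "T0 \<subseteq> pverts G - X" "T0 \<noteq> {}" "pverts G - X - T0 \<noteq> {}"
    and noarc: "\<And>a b. a \<in> T0 \<Longrightarrow> b \<in> pverts G - X - T0 \<Longrightarrow> (a, b) \<notin> parcs G"
    using T0 unfolding cut_pair_def by auto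
  have fin: "finite T0" using sub finite_verts by (meson Diff_subset finite_subset)
  have "cut_pair G X (pverts G - X - T0)"
    using sub noarc sym unfolding cut_pair_def by blast
  then have "card T0 \<le> card (pverts G - X - T0)" by (rule min)
  also have "\<dots> \<le> card (pverts G - T0)" by (intro card_mono) auto
  also have "\<dots> = card (pverts G) - card T0" using sub fin by (intro card_Diff_subset) auto
  finally have half: "2 * card T0 \<le> card (pverts G)"
    using card_mono[of "pverts G" T0] sub by auto
  obtain v where v: "v \<in> T0" using sub(3) by auto
  have "\<exists>f. rooted_tree f v T0 \<and> (\<forall>w\<in>T0 - {v}. (w, f w) \<in> parcs G)"
  proof (rule spanning_rooted_tree[OF fin v])
    fix C assume C: "v \<in> C" "C \<subset> T0"
    show "\<exists>a\<in>C. \<exists>b\<in>T0 - C. (b, a) \<in> parcs G"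
    proof (rule ccontr)
      assume no: "\<not> ?thesis"
      \<comment> \<open>A part of \<open>T0\<close> without arcs to the rest of \<open>T0\<close>
        would be a smaller side of the same cut.\<close>
      have "cut_pair G X C"
        unfolding cut_pair_def
      proof (intro conjI ballI notI)
        fix a b assume "a \<in> C" "b \<in> pverts G - X - C" "(a, b) \<in> parcs G"
        then show False using no noarc[of a b] sym C by (cases "b \<in> T0") auto
      qed (use sub C in auto)
      then show False using min[of C] C(2) psubset_card_mono[OF fin, of C] by auto
    qed
  qed
  \<comment> \<open>Only the nodes of the cut that are adjacent to \<open>T0\<close> are kept, so
    that in the union bound each of them pays for hitting the object sets of
    \<open>T0\<close>.\<close>
  moreover define X0 where "X0 = {b \<in> pverts G - T0. \<exists>a\<in>T0. (a, b) \<in> parcs G}"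
  have "X0 \<subseteq> X" using noarc by (auto simp: X0_def)
  then have "card X0 \<le> card X" using sub(1) finite_verts by (meson card_mono finite_subset)
  then have "card X0 < k" using cut(2) by simp
  ultimately show ?thesis
    using sub half v by (intro exI[of _ T0] exI[of _ X0]) (auto simp: X0_def)
qed

text \<open>Disjoint paths leave \<open>u\<close> through distinct second nodes. The only candidate
  for a coincidence is \<open>v\<close>, but a path with second node \<open>v\<close> is the edge
  itself, which a set of paths contains at most once.\<close>

lemma degree_ge_if_k_connected:
  assumes "pair_graph G" "k_connected k G" "u \<in> pverts G" "v \<in> pverts G" "u \<noteq> v"
  shows "k \<le> card {w. (u, w) \<in> parcs G}"
proof -
  interpret pair_graph G by fact
  obtain Q where Q: "Q \<subseteq> paths_between G u v" "finite Q" "k \<le> card Q" "internally_disjoint u v Q"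
    using assms unfolding k_connected_def by meson
  have path: "\<exists>w q. p = u # w # q \<and> (u, w) \<in> parcs G \<and> (w = v \<longrightarrow> q = []) \<and> w \<noteq> u" if "p \<in> Q" for p
  proof -
    from that Q(1) have p: "p \<noteq> []" "distinct p" "successively (\<lambda>a b. (a, b) \<in> parcs G) p" "hd p = u" "last p = v"
      by (auto simp: paths_between_def vpath_with_proj_iff)
    then obtain w q where wq: "p = u # w # q"
      using assms(5) by (cases p rule: remdups_adj.cases) auto
    have "q = []" if "w = v"
    proof (rule ccontr)
      assume "q \<noteq> []"
      then have "last q = v" "last q \<in> set q" using p(5) wq by auto
      then show False using p(2) wq that by auto
    qed
    then show ?thesis using p wq by auto
  qed
  have "inj_on (\<lambda>p. p ! 1) Q"
  proof (rule inj_onI)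
    fix p q assume pq: "p \<in> Q" "q \<in> Q" "p ! 1 = q ! 1"
    obtain w p' q' where w: "p = u # w # p'" "q = u # w # q'" "w = v \<longrightarrow> p' = []" "w = v \<longrightarrow> q' = []" "w \<noteq> u"
      using path[OF pq(1)] path[OF pq(2)] pq(3) by auto
    show "p = q"
    proof (cases "w = v")
      case False
      then have "w \<in> (set p - {u, v}) \<inter> (set q - {u, v})" using w by auto
      then show ?thesis
        using Q(4) pq(1,2) unfolding internally_disjoint_def by blast
    qed (use w in auto)
  qed
  then have "card Q = card ((\<lambda>p. p ! 1) ` Q)" by (simp add: card_image)
  also have "\<dots> \<le> card {w. (u, w) \<in> parcs G}"
  proof (rule card_mono)
    have "{w. (u, w) \<in> parcs G} \<subseteq> snd ` parcs G" by force
    then show "finite {w. (u, w) \<in> parcs G}" by (rule finite_subset) simp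
    show "(\<lambda>p. p ! 1) ` Q \<subseteq> {w. (u, w) \<in> parcs G}" using path by fastforce
  qed
  finally show ?thesis using Q(3) by simp
qed

subsection \<open>A uniformly random set of fixed size\<close>

definition unif_sets :: "nat \<Rightarrow> nat \<Rightarrow> nat set pmf" where
  "unif_sets P K = pmf_of_set {A. A \<subseteq> {1..P} \<and> card A = K}"

lemma finite_subsets_card [simp]: "finite {A. A \<subseteq> {1..P::nat} \<and> card A = K}"
  by (rule finite_subset[of _ "Pow {1..P}"]) auto

lemma subsets_card_nonempty: "K \<le> P \<Longrightarrow> {A. A \<subseteq> {1..P::nat} \<and> card A = K} \<noteq> {}"
  using obtain_subset_with_card_n[of K "{1..P}"] by auto

lemma set_unif_sets: "K \<le> P \<Longrightarrow> set_pmf (unif_sets P K) = {A. A \<subseteq> {1..P} \<and> card A = K}"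
  unfolding unif_sets_def using subsets_card_nonempty by (intro set_pmf_of_set) auto

lemma measure_unif_sets:
  assumes "K \<le> P"
  shows "measure_pmf.prob (unif_sets P K) B = real (card {A \<in> B. A \<subseteq> {1..P} \<and> card A = K}) / real (P choose K)"
proof -
  have "{A. A \<subseteq> {1..P} \<and> card A = K} \<inter> B = {A \<in> B. A \<subseteq> {1..P} \<and> card A = K}" by auto
  then show ?thesis
    using assms subsets_card_nonempty[OF assms] by (simp add: unif_sets_def measure_pmf_of_set n_subsets)
qed

text \<open>The quotient of the two binomial coefficients is the product of (K - i) / (P - i) over i
  < w, and each of these factors is at most K / P.\<close>

lemma binomial_shift_le:
  assumes "w \<le> K" "K \<le> P"
  shows "((P - w) choose (K - w)) * P ^ w \<le> (P choose K) * K ^ w"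
  using assms(1)
proof (induction w)
  case (Suc w)
  define a b where "a = P - Suc w" and "b = K - Suc w"
  have ab: "P - w = Suc a" "K - w = Suc b" using Suc.prems assms(2) by (auto simp: a_def b_def)
  have "Suc a * (a choose b) = (Suc a choose Suc b) * Suc b" by (rule Suc_times_binomial_eq)
  then have eq: "(P - w) * ((P - Suc w) choose (K - Suc w)) = ((P - w) choose (K - w)) * (K - w)"
    using ab by (simp add: a_def b_def)
  have "(K - w) * P \<le> K * (P - w)" 
    using diff_le_mono2[OF mult_le_mono2[OF assms(2)], of "K * P" w]
    by (simp add: diff_mult_distrib diff_mult_distrib2 mult.commute)
  have "(P - w) * (((P - Suc w) choose (K - Suc w)) * P ^ Suc w) =
      ((K - w) * P) * (((P - w) choose (K - w)) * P ^ w)"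
    using arg_cong[OF eq, of "\<lambda>c. c * P ^ Suc w"] by (simp add: ac_simps)
  also have "\<dots> \<le> (K * (P - w)) * ((P choose K) * K ^ w)"
    using Suc.prems by (intro mult_le_mono[OF \<open>(K - w) * P \<le> K * (P - w)\<close> Suc.IH]) simp
  also have "\<dots> = (P - w) * ((P choose K) * K ^ Suc w)" by simp
  finally show ?case using ab by (subst (asm) mult_le_cancel1) auto
qed simp

text \<open>The bound is the value for independent objects of density K / P; fixing the size of the
  set makes the objects negatively correlated.\<close>

lemma prob_unif_sets_superset_le:
  assumes "K \<le> P" "1 \<le> P" "finite W"
  shows "measure_pmf.prob (unif_sets P K) {A. W \<subseteq> A} \<le> (real K / real P) ^ card W"
proof (cases "W \<subseteq> {1..P} \<and> card W \<le> K")
  case False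
  then have "{A. W \<subseteq> A \<and> A \<subseteq> {1..P} \<and> card A = K} = {}"
    using card_mono[OF finite_subset[of _ "{1..P}"]] by blast
  then have "measure_pmf.prob (unif_sets P K) {A. W \<subseteq> A} = 0"
    unfolding measure_unif_sets[OF assms(1)] mem_Collect_eq by (simp only: card.empty of_nat_0 div_0)
  then show ?thesis by simp
next
  case True
  define w where "w = card W"
  have "bij_betw (\<lambda>A. A - W) {A. W \<subseteq> A \<and> A \<subseteq> {1..P} \<and> card A = K}
     {B. B \<subseteq> {1..P} - W \<and> card B = K - w}"
  proof (rule bij_betwI[where g = "\<lambda>B. B \<union> W"])
    show "(\<lambda>A. A - W) \<in> {A. W \<subseteq> A \<and> A \<subseteq> {1..P} \<and> card A = K} \<rightarrow> {B. B \<subseteq> {1..P} - W \<and> card B = K - w}"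
      using assms(3) by (auto simp: w_def card_Diff_subset)
    show "(\<lambda>B. B \<union> W) \<in> {B. B \<subseteq> {1..P} - W \<and> card B = K - w} \<rightarrow> {A. W \<subseteq> A \<and> A \<subseteq> {1..P} \<and> card A = K}"
    proof
      fix B assume B: "B \<in> {B. B \<subseteq> {1..P} - W \<and> card B = K - w}"
      then have "finite B" "B \<inter> W = {}" using finite_subset[of B "{1..P} - W"] by auto
      then have "card (B \<union> W) = K" using B True assms(3) by (simp add: card_Un_disjoint w_def)
      then show "B \<union> W \<in> {A. W \<subseteq> A \<and> A \<subseteq> {1..P} \<and> card A = K}" using B True by auto
    qed
  qed auto
  then have "card {A. W \<subseteq> A \<and> A \<subseteq> {1..P} \<and> card A = K} = card ({1..P} - W) choose (K - w)"
    by (simp add: bij_betw_same_card n_subsets)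
  also have "card ({1..P} - W) = P - w" using True assms(3) by (simp add: w_def card_Diff_subset)
  finally have card: "card {A. W \<subseteq> A \<and> A \<subseteq> {1..P} \<and> card A = K} = (P - w) choose (K - w)" .
  have "real ((P - w) choose (K - w)) * real P ^ w \<le> real (P choose K) * real K ^ w"
    using binomial_shift_le[of w K P] True assms(1) unfolding w_def
    by (metis of_nat_le_iff of_nat_mult of_nat_power)
  then show ?thesis
    using assms unfolding measure_unif_sets[OF assms(1)] mem_Collect_eq card w_def[symmetric]
    by (simp add: power_divide field_simps)
qed

lemma binomial_ratio_prod:
  assumes "v \<le> P" "K \<le> P"
  shows "real (v choose K) / real (P choose K) = (\<Prod>i<K. (real v - real i) / (real P - real i))"
  by (simp add: binomial_gbinomial gbinomial_prod_rev prod_dividef atLeast0LessThan)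

lemma binomial_ratio_le:
  assumes "v \<le> P" "K \<le> P"
  shows "real (v choose K) / real (P choose K) \<le> (real v / real P) ^ K"
proof (cases "K \<le> v")
  case True
  have "(\<Prod>i<K. (real v - real i) / (real P - real i)) \<le> (\<Prod>i<K. real v / real P)"
  proof (rule prod_mono)
    fix i assume "i \<in> {..<K}"
    then have i: "real i < real v" "real i < real P" using True assms by auto
    have "(real v - real i) * real P \<le> real v * (real P - real i)"
      using assms mult_right_mono[of "real v" "real P" "real i"] by (simp add: algebra_simps)
    then show "0 \<le> (real v - real i) / (real P - real i) \<and> (real v - real i) / (real P - real i) \<le> real v / real P"
      using i by (auto simp: divide_simps)
  qed
  then show ?thesis using binomial_ratio_prod[OF assms] by simp
qed (simp add: binomial_eq_0)

lemma binomial_ratio_ge: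
  assumes "v + K \<le> P" "K < P"
  shows "(1 - real v / (real P - real K)) ^ K \<le> real ((P - v) choose K) / real (P choose K)"
proof -
  have "(\<Prod>i<K. 1 - real v / (real P - real K)) \<le> (\<Prod>i<K. (real (P - v) - real i) / (real P - real i))"
  proof (rule prod_mono)
    fix i assume "i \<in> {..<K}"
    then have i: "real i < real K" by auto
    have P: "real K < real P" "real v + real K \<le> real P" using assms by linarith+
    have "(real (P - v) - real i) / (real P - real i) = 1 - real v / (real P - real i)"
      using i P assms by (simp add: field_simps of_nat_diff)
    moreover have "real v / (real P - real i) \<le> real v / (real P - real K)"
      using i P by (intro divide_left_mono) auto
    ultimately show "0 \<le> 1 - real v / (real P - real K) \<and>
        1 - real v / (real P - real K) \<le> (real (P - v) - real i) / (real P - real i)"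
      using P by auto
  qed
  then show ?thesis using binomial_ratio_prod[of "P - v" P K] assms by simp
qed

lemma prob_unif_sets_subset:
  assumes "K \<le> P" "V \<subseteq> {1..P}"
  shows "measure_pmf.prob (unif_sets P K) {A. A \<subseteq> V} = real (card V choose K) / real (P choose K)"
proof -
  have "{A. A \<subseteq> V \<and> A \<subseteq> {1..P} \<and> card A = K} = {A. A \<subseteq> V \<and> card A = K}" using assms by auto
  moreover have "card {A. A \<subseteq> V \<and> card A = K} = card V choose K"
    using assms finite_subset by (intro n_subsets) auto
  ultimately show ?thesis using assms by (simp add: measure_unif_sets)
qed

lemma prob_unif_sets_subset_le:
  assumes "K \<le> P" "V \<subseteq> {1..P}"
  shows "measure_pmf.prob (unif_sets P K) {A. A \<subseteq> V} \<le> (real (card V) / real P) ^ K"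
  using prob_unif_sets_subset[OF assms] binomial_ratio_le[of "card V" P K] assms
    card_mono[of "{1..P}" V] by auto

lemma prob_unif_sets_disjoint:
  assumes "K \<le> P" "V \<subseteq> {1..P}"
  shows "measure_pmf.prob (unif_sets P K) {A. A \<inter> V = {}} = real ((P - card V) choose K) / real (P choose K)"
proof -
  have "measure_pmf.prob (unif_sets P K) {A. A \<inter> V = {}} = measure_pmf.prob (unif_sets P K) {A. A \<subseteq> {1..P} - V}"
    using assms by (intro measure_pmf.finite_measure_eq_AE) (auto simp: AE_measure_pmf_iff set_unif_sets)
  also have "\<dots> = real (card ({1..P} - V) choose K) / real (P choose K)"
    using assms by (intro prob_unif_sets_subset) auto
  also have "card ({1..P} - V) = P - card V"
    using assms finite_subset by (subst card_Diff_subset) auto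
  finally show ?thesis .
qed

lemma prob_unif_sets_disjoint_le:
  assumes "K \<le> P" "1 \<le> P" "V \<subseteq> {1..P}"
  shows "measure_pmf.prob (unif_sets P K) {A. A \<inter> V = {}} \<le> exp (- (real (card V) * real K / real P))"
proof -
  have v: "card V \<le> P" using card_mono[of "{1..P}" V] assms by auto
  have "measure_pmf.prob (unif_sets P K) {A. A \<inter> V = {}} \<le> (real (P - card V) / real P) ^ K"
    using prob_unif_sets_disjoint[OF assms(1,3)] binomial_ratio_le[of "P - card V" P K] assms by auto
  also have "\<dots> \<le> exp (- (real (card V) / real P)) ^ K"
  proof (rule power_mono)
    have "real (P - card V) / real P = 1 + (- (real (card V) / real P))"
      using v assms by (simp add: of_nat_diff field_simps)
    also have "\<dots> \<le> exp (- (real (card V) / real P))" by (rule exp_ge_add_one_self)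
    finally show "real (P - card V) / real P \<le> exp (- (real (card V) / real P))" .
  qed simp
  also have "\<dots> = exp (- (real (card V) * real K / real P))"
    by (simp add: exp_of_nat_mult[symmetric] algebra_simps)
  finally show ?thesis .
qed

lemma prob_unif_sets_disjoint_ge:
  assumes "card V + K \<le> P" "K < P" "V \<subseteq> {1..P}"
  shows "(1 - real (card V) / (real P - real K)) ^ K \<le> measure_pmf.prob (unif_sets P K) {A. A \<inter> V = {}}"
  using prob_unif_sets_disjoint[of K P V] binomial_ratio_ge[of "card V" K P] assms by auto

lemma prob_unif_sets_hit_le:
  assumes "K \<le> P" "1 \<le> P" "finite V"
  shows "measure_pmf.prob (unif_sets P K) {A. A \<inter> V \<noteq> {}} \<le> real (card V) * real K / real P"
proof -
  have "measure_pmf.prob (unif_sets P K) {A. A \<inter> V \<noteq> {}} \<le> measure_pmf.prob (unif_sets P K) (\<Union>a\<in>V. {A. {a} \<subseteq> A})"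
    by (intro measure_pmf.finite_measure_mono) auto
  also have "\<dots> \<le> (\<Sum>a\<in>V. measure_pmf.prob (unif_sets P K) {A. {a} \<subseteq> A})"
    using assms by (intro measure_pmf.finite_measure_subadditive_finite) auto
  also have "\<dots> \<le> (\<Sum>a\<in>V. real K / real P)"
    using prob_unif_sets_superset_le[OF assms(1,2), of "{_}"] by (intro sum_mono) auto
  finally show ?thesis by simp
qed

text \<open>Disjointness of \<open>V\<close> and \<open>V'\<close> provides two distinct objects of
  the random set, hence the square of the density.\<close>

lemma prob_unif_sets_hit_both_le:
  assumes "K \<le> P" "1 \<le> P" "finite V" "finite V'" "V \<inter> V' = {}"
  shows "measure_pmf.prob (unif_sets P K) {A. A \<inter> V \<noteq> {} \<and> A \<inter> V' \<noteq> {}} \<le>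
    real (card V) * real (card V') * (real K / real P)\<^sup>2"
proof -
  have "measure_pmf.prob (unif_sets P K) {A. A \<inter> V \<noteq> {} \<and> A \<inter> V' \<noteq> {}} \<le>
      measure_pmf.prob (unif_sets P K) (\<Union>z\<in>V \<times> V'. {A. {fst z, snd z} \<subseteq> A})"
    by (intro measure_pmf.finite_measure_mono) auto
  also have "\<dots> \<le> (\<Sum>z\<in>V \<times> V'. measure_pmf.prob (unif_sets P K) {A. {fst z, snd z} \<subseteq> A})"
    using assms by (intro measure_pmf.finite_measure_subadditive_finite) auto
  also have "\<dots> \<le> (\<Sum>z\<in>V \<times> V'. (real K / real P)\<^sup>2)"
  proof (rule sum_mono)
    fix z assume "z \<in> V \<times> V'"
    then have "card {fst z, snd z} = 2" using assms(5) by (auto simp: card_insert_if)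
    then show "measure_pmf.prob (unif_sets P K) {A. {fst z, snd z} \<subseteq> A} \<le> (real K / real P)\<^sup>2"
      using prob_unif_sets_superset_le[OF assms(1,2), of "{fst z, snd z}"] by auto
  qed
  finally show ?thesis by (simp add: card_cartesian_product)
qed

text \<open>Writing exp \<theta> = 1 + c turns the exponential into the sum of c^|W| over all W
  contained in both \<open>A\<close> and \<open>V\<close>. As c is nonnegative, the containment
  bounds apply term by term, and the result is dominated by the moment generating function of
  independent objects.\<close>

lemma expectation_exp_card_Int_le:
  assumes "K \<le> P" "1 \<le> P" "finite V" "0 \<le> \<theta>"
  shows "measure_pmf.expectation (unif_sets P K) (\<lambda>A. exp (\<theta> * real (card (A \<inter> V)))) \<le>
    exp (real (card V) * exp \<theta> * real K / real P)"
proof -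
  define c where "c = exp \<theta> - 1"
  have c: "0 \<le> c" using assms(4) by (simp add: c_def)
  have fin: "finite (set_pmf (unif_sets P K))" using set_unif_sets[OF assms(1)] by simp
  have expand: "exp (\<theta> * real (card (A \<inter> V))) = (\<Sum>W\<in>Pow V. c ^ card W * indicator {A. W \<subseteq> A} A)" for A
  proof -
    have "exp (\<theta> * real (card (A \<inter> V))) = (\<Prod>a\<in>A \<inter> V. c + 1)"
      by (simp add: c_def exp_of_nat_mult[symmetric] algebra_simps)
    also have "\<dots> = (\<Sum>W\<in>Pow (A \<inter> V). (\<Prod>a\<in>W. c) * (\<Prod>a\<in>A \<inter> V - W. 1))"
      using assms(3) by (intro prod_add) auto
    also have "\<dots> = (\<Sum>W\<in>Pow (A \<inter> V). c ^ card W)" by simp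
    also have "\<dots> = (\<Sum>W\<in>Pow V. c ^ card W * indicator {A. W \<subseteq> A} A)"
      using assms(3) by (intro sum.mono_neutral_cong_left) (auto simp: indicator_def)
    finally show ?thesis .
  qed
  have "measure_pmf.expectation (unif_sets P K) (\<lambda>A. exp (\<theta> * real (card (A \<inter> V)))) =
      (\<Sum>W\<in>Pow V. c ^ card W * measure_pmf.prob (unif_sets P K) {A. W \<subseteq> A})"
    unfolding expand using fin by (subst Bochner_Integration.integral_sum) (auto intro!: integrable_measure_pmf_finite)
  also have "\<dots> \<le> (\<Sum>W\<in>Pow V. c ^ card W * (real K / real P) ^ card W)"
    using prob_unif_sets_superset_le[OF assms(1,2)] assms(3) c
    by (intro sum_mono mult_left_mono) (auto intro: finite_subset)
  also have "\<dots> = (\<Sum>W\<in>Pow V. (\<Prod>a\<in>W. c * (real K / real P)) * (\<Prod>a\<in>V - W. 1))"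
    by (simp only: power_mult_distrib prod_constant power_one mult_1_right)
  also have "\<dots> = (\<Prod>a\<in>V. c * (real K / real P) + 1)"
    using assms(3) by (intro prod_add[symmetric]) auto
  also have "\<dots> = (c * (real K / real P) + 1) ^ card V" by simp
  also have "\<dots> \<le> exp (exp \<theta> * (real K / real P)) ^ card V"
  proof (rule power_mono)
    have "c * (real K / real P) + 1 \<le> 1 + exp \<theta> * (real K / real P)"
      using mult_right_mono[of c "exp \<theta>" "real K / real P"] by (simp add: c_def)
    also have "\<dots> \<le> exp (exp \<theta> * (real K / real P))" by (rule exp_ge_add_one_self)
    finally show "c * (real K / real P) + 1 \<le> exp (exp \<theta> * (real K / real P))" .
  qed (use c in auto)
  also have "\<dots> = exp (real (card V) * exp \<theta> * real K / real P)"
    by (simp add: exp_of_nat_mult[symmetric] algebra_simps)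
  finally show ?thesis .
qed

subsection \<open>Product distributions and couplings\<close>

lemma measure_bind_pmf_eq:
  "measure_pmf.prob (bind_pmf M N) X = measure_pmf.expectation M (\<lambda>x. measure_pmf.prob (N x) X)"
proof -
  have int: "integrable (measure_pmf M) (\<lambda>x. measure_pmf.prob (N x) X)"
    by (rule measure_pmf.integrable_const_bound[where B = 1]) auto
  have "ennreal (measure_pmf.prob (bind_pmf M N) X) = (\<integral>\<^sup>+x. ennreal (measure_pmf.prob (N x) X) \<partial>M)"
    by (simp add: measure_pmf.emeasure_eq_measure[symmetric])
  also have "\<dots> = ennreal (measure_pmf.expectation M (\<lambda>x. measure_pmf.prob (N x) X))"
    using int by (intro nn_integral_eq_integral) auto
  finally show ?thesis by (simp add: integral_nonneg)
qed

text \<open>Conditioning on the coordinates in \<open>A\<close>: since \<open>E\<close> and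
  \<open>F j\<close> depend on them alone, the coordinates in \<open>B\<close> remain independent
  and their probabilities multiply. All dependent edges are handled in this way.\<close>

lemma prob_Pi_pmf_split:
  assumes "finite A" "finite B" "A \<inter> B = {}"
    and E: "\<And>S S'. (\<And>i. i \<in> A \<Longrightarrow> S i = S' i) \<Longrightarrow> E S = E S'"
    and F: "\<And>S S' j. (\<And>i. i \<in> A \<Longrightarrow> S i = S' i) \<Longrightarrow> F j S = F j S'"
  shows "measure_pmf.prob (Pi_pmf (A \<union> B) d p) {S. E S \<and> (\<forall>j\<in>B. S j \<in> F j S)} =
    measure_pmf.expectation (Pi_pmf A d p) (\<lambda>S. indicator {S. E S} S * (\<Prod>j\<in>B. measure_pmf.prob (p j) (F j S)))"
proof -
  have "Pi_pmf (A \<union> B) d p = bind_pmf (Pi_pmf A d p)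
      (\<lambda>f. map_pmf (\<lambda>g x. if x \<in> A then f x else g x) (Pi_pmf B d p))"
    using assms(1-3) by (simp add: Pi_pmf_union pair_pmf_def map_bind_pmf map_pmf_def[symmetric] pmf.map_comp o_def)
  then have "measure_pmf.prob (Pi_pmf (A \<union> B) d p) {S. E S \<and> (\<forall>j\<in>B. S j \<in> F j S)} =
     measure_pmf.expectation (Pi_pmf A d p) (\<lambda>f. measure_pmf.prob (Pi_pmf B d p)
        ((\<lambda>g x. if x \<in> A then f x else g x) -` {S. E S \<and> (\<forall>j\<in>B. S j \<in> F j S)}))"
    by (simp add: measure_bind_pmf_eq)
  also have "\<dots> = measure_pmf.expectation (Pi_pmf A d p)
      (\<lambda>S. indicator {S. E S} S * (\<Prod>j\<in>B. measure_pmf.prob (p j) (F j S)))"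
  proof (intro arg_cong[where f = "measure_pmf.expectation _"] ext)
    fix f
    have vi: "(\<lambda>g x. if x \<in> A then f x else g x) -` {S. E S \<and> (\<forall>j\<in>B. S j \<in> F j S)} =
        {g. E f \<and> g \<in> Pi B (\<lambda>j. F j f)}"
    proof (rule set_eqI)
      fix g
      let ?h = "\<lambda>x. if x \<in> A then f x else g x"
      have "E ?h = E f" "\<And>j. F j ?h = F j f" by (rule E, simp) (rule F, simp)
      moreover have "?h j = g j" if "j \<in> B" for j using that assms(3) by auto
      ultimately show "g \<in> (\<lambda>g x. if x \<in> A then f x else g x) -` {S. E S \<and> (\<forall>j\<in>B. S j \<in> F j S)} \<longleftrightarrow>
        g \<in> {g. E f \<and> g \<in> Pi B (\<lambda>j. F j f)}" by auto
    qed
    show "measure_pmf.prob (Pi_pmf B d p)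
        ((\<lambda>g x. if x \<in> A then f x else g x) -` {S. E S \<and> (\<forall>j\<in>B. S j \<in> F j S)}) =
      indicator {S. E S} f * (\<Prod>j\<in>B. measure_pmf.prob (p j) (F j f))"
      unfolding vi using assms(2) by (cases "E f") (simp_all add: measure_Pi_pmf_Pi)
  qed
  finally show ?thesis .
qed

lemma prob_Pi_pmf_marginal:
  assumes "finite C" "A \<subseteq> C"
    and E: "\<And>S S'. (\<And>i. i \<in> A \<Longrightarrow> S i = S' i) \<Longrightarrow> E S = E S'"
  shows "measure_pmf.prob (Pi_pmf C d p) {S. E S} = measure_pmf.prob (Pi_pmf A d p) {S. E S}"
proof -
  have C: "C = A \<union> (C - A)" using assms(2) by auto
  have fin: "finite A" "finite (C - A)" using assms finite_subset by auto
  have "measure_pmf.prob (Pi_pmf (A \<union> (C - A)) d p) {S. E S \<and> (\<forall>j\<in>C - A. S j \<in> UNIV)} =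
    measure_pmf.expectation (Pi_pmf A d p) (\<lambda>S. indicator {S. E S} S * (\<Prod>j\<in>C - A. measure_pmf.prob (p j) UNIV))"
    by (rule prob_Pi_pmf_split[OF fin _ E, where F = "\<lambda>_ _. UNIV"]) auto
  then show ?thesis using C by simp
qed

lemma prob_Pi_pmf_split_le:
  assumes "finite A" "finite B" "A \<inter> B = {}"
    and E: "\<And>S S'. (\<And>i. i \<in> A \<Longrightarrow> S i = S' i) \<Longrightarrow> E S = E S'"
    and F: "\<And>S S' j. (\<And>i. i \<in> A \<Longrightarrow> S i = S' i) \<Longrightarrow> F j S = F j S'"
    and bound: "\<And>S. S \<in> set_pmf (Pi_pmf A d p) \<Longrightarrow> E S \<Longrightarrow> (\<Prod>j\<in>B. measure_pmf.prob (p j) (F j S)) \<le> c"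
  shows "measure_pmf.prob (Pi_pmf (A \<union> B) d p) {S. E S \<and> (\<forall>j\<in>B. S j \<in> F j S)} \<le>
    c * measure_pmf.prob (Pi_pmf A d p) {S. E S}"
proof -
  have "measure_pmf.expectation (Pi_pmf A d p) (\<lambda>S. indicator {S. E S} S * (\<Prod>j\<in>B. measure_pmf.prob (p j) (F j S)))
    \<le> measure_pmf.expectation (Pi_pmf A d p) (\<lambda>S. indicator {S. E S} S * c)"
  proof (rule integral_mono_AE)
    show "integrable (measure_pmf (Pi_pmf A d p)) (\<lambda>S. indicator {S. E S} S * (\<Prod>j\<in>B. measure_pmf.prob (p j) (F j S)))"
      by (rule measure_pmf.integrable_const_bound[where B = 1])
        (auto simp: indicator_def abs_prod intro!: prod_le_1)
    show "integrable (measure_pmf (Pi_pmf A d p)) (\<lambda>S. indicator {S. E S} S * c)"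
      by (rule measure_pmf.integrable_const_bound[where B = "\<bar>c\<bar>"]) (auto simp: indicator_def)
    show "AE S in measure_pmf (Pi_pmf A d p). indicator {S. E S} S * (\<Prod>j\<in>B. measure_pmf.prob (p j) (F j S)) \<le> indicator {S. E S} S * c"
      using bound by (auto simp: AE_measure_pmf_iff indicator_def)
  qed
  moreover have "measure_pmf.prob (Pi_pmf (A \<union> B) d p) {S. E S \<and> (\<forall>j\<in>B. S j \<in> F j S)} =
    measure_pmf.expectation (Pi_pmf A d p) (\<lambda>S. indicator {S. E S} S * (\<Prod>j\<in>B. measure_pmf.prob (p j) (F j S)))"
    by (rule prob_Pi_pmf_split[OF assms(1-3) E F])
  ultimately show ?thesis by (simp add: mult.commute)
qed

section \<open>Couplings of independent families\<close>

lemma rel_pmf_Pi_pmf: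
  assumes "finite A" "\<And>i. i \<in> A \<Longrightarrow> rel_pmf R (p i) (q i)"
  shows "rel_pmf (\<lambda>f g. \<forall>i\<in>A. R (f i) (g i)) (Pi_pmf A d p) (Pi_pmf A d' q)"
  using assms
proof (induction A rule: finite_induct)
  case (insert x A)
  have "rel_pmf (rel_prod R (\<lambda>f g. \<forall>i\<in>A. R (f i) (g i)))
      (pair_pmf (p x) (Pi_pmf A d p)) (pair_pmf (q x) (Pi_pmf A d' q))"
    unfolding rel_pmf_rel_prod using insert by auto
  then have "rel_pmf (\<lambda>u v. \<forall>i\<in>insert x A. R ((case u of (y, f) \<Rightarrow> f(x := y)) i) ((case v of (y, f) \<Rightarrow> f(x := y)) i))
      (pair_pmf (p x) (Pi_pmf A d p)) (pair_pmf (q x) (Pi_pmf A d' q))"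
    using insert.hyps(2) by (elim pmf.rel_mono_strong) (auto elim!: rel_prod.cases)
  then show ?case
    using insert.hyps by (simp add: Pi_pmf_insert pmf.rel_map)
qed simp

lemma prob_Pi_pmf_coupling_le:
  assumes "finite A" "rel_pmf R Q Q'"
    and "\<And>S S'. (\<And>i. i \<in> A \<Longrightarrow> R (S i) (S' i)) \<Longrightarrow> \<Phi> S \<Longrightarrow> \<Psi> S'"
  shows "measure_pmf.prob (Pi_pmf A d (\<lambda>_. Q)) {S. \<Phi> S} \<le> measure_pmf.prob (Pi_pmf A d' (\<lambda>_. Q')) {S. \<Psi> S}"
proof -
  have "rel_pmf (\<lambda>f g. \<forall>i\<in>A. R (f i) (g i)) (Pi_pmf A d (\<lambda>_. Q)) (Pi_pmf A d' (\<lambda>_. Q'))"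
    using assms by (intro rel_pmf_Pi_pmf) auto
  then have "measure_pmf.prob (Pi_pmf A d (\<lambda>_. Q)) {S. \<Phi> S} \<le>
      measure_pmf.prob (Pi_pmf A d' (\<lambda>_. Q')) {y. \<exists>x\<in>{S. \<Phi> S}. \<forall>i\<in>A. R (x i) (y i)}"
    by (rule rel_pmf_measureD)
  also have "\<dots> \<le> measure_pmf.prob (Pi_pmf A d' (\<lambda>_. Q')) {S. \<Psi> S}"
    using assms(3) by (intro measure_pmf.finite_measure_mono) auto
  finally show ?thesis .
qed

section \<open>Uniformity from symmetry\<close>

lemma permutation_mapping_subset:
  assumes "finite X" "B \<subseteq> X" "B' \<subseteq> X" "card B = card B'"
  obtains \<sigma> where "\<sigma> permutes X" "\<sigma> ` B = B'"
proof -
  have fin: "finite B" "finite B'" using assms finite_subset by auto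
  obtain g where g: "bij_betw g B B'" using fin assms(4) by (metis finite_same_card_bij)
  have "card (X - B) = card (X - B')" using assms fin by (simp add: card_Diff_subset)
  then obtain h where h: "bij_betw h (X - B) (X - B')"
    using assms(1) by (metis finite_same_card_bij finite_Diff)
  define \<sigma> where "\<sigma> x = (if x \<in> B then g x else if x \<in> X then h x else x)" for x
  have 1: "bij_betw \<sigma> B B'" using g by (rule bij_betw_cong[THEN iffD1, rotated]) (auto simp: \<sigma>_def)
  have 2: "bij_betw \<sigma> (X - B) (X - B')" using h by (rule bij_betw_cong[THEN iffD1, rotated]) (auto simp: \<sigma>_def)
  have "bij_betw \<sigma> (B \<union> (X - B)) (B' \<union> (X - B'))" by (rule bij_betw_combine[OF 1 2]) auto
  then have "bij_betw \<sigma> X X" using assms by (simp add: Un_absorb1 Un_Diff_cancel Un_commute)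
  then have "\<sigma> permutes X" using assms(2) by (intro bij_imp_permutes) (auto simp: \<sigma>_def)
  moreover have "\<sigma> ` B = B'" using 1 by (simp add: bij_betw_def)
  ultimately show ?thesis by (rule that)
qed

text \<open>Permutations of the pool act transitively on the sets of one size, so all of these have
  the same weight. This identifies the law of a coupled set without computing it.\<close>

lemma permutation_invariant_eq_unif_sets:
  assumes sP: "s \<le> P" and supp: "set_pmf W \<subseteq> {B. B \<subseteq> {1..P} \<and> card B = s}"
    and inv: "\<And>\<sigma>. \<sigma> permutes {1..P} \<Longrightarrow> map_pmf (\<lambda>A. \<sigma> ` A) W = W"
  shows "W = unif_sets P s"
proof -
  let ?X = "{B. B \<subseteq> {1..P} \<and> card B = s}"
  have eq: "pmf W B = pmf W B'" if BB: "B \<in> ?X" "B' \<in> ?X" for B B'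
  proof -
    obtain \<sigma> where \<sigma>: "\<sigma> permutes {1..P}" "\<sigma> ` B = B'"
      by (rule permutation_mapping_subset[of "{1..P}" B B']) (use BB in auto)
    have "inj (\<lambda>A. \<sigma> ` A)" using permutes_inj[OF \<sigma>(1)] by (auto simp: inj_on_def inj_image_eq_iff)
    then have "pmf (map_pmf (\<lambda>A. \<sigma> ` A) W) (\<sigma> ` B) = pmf W B" by (rule pmf_map_inj')
    then show ?thesis using inv[OF \<sigma>(1)] \<sigma>(2) by simp
  qed
  obtain B0 where B0: "B0 \<in> ?X" using subsets_card_nonempty[OF sP] by auto
  have "1 = measure_pmf.prob W ?X"
    using supp by (subst measure_pmf.prob_eq_1[THEN iffD2]) (auto simp: AE_measure_pmf_iff)
  also have "\<dots> = (\<Sum>B\<in>?X. pmf W B)" by (intro measure_measure_pmf_finite) simp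
  also have "\<dots> = (\<Sum>B\<in>?X. pmf W B0)" by (intro sum.cong refl eq B0)
  also have "\<dots> = real (card ?X) * pmf W B0" by (simp only: sum_constant)
  finally have val: "pmf W B0 = 1 / real (card ?X)"
    by (metis mult_zero_left nonzero_mult_div_cancel_left zero_neq_one)
  show ?thesis
  proof (rule pmf_eqI)
    fix B
    show "pmf W B = pmf (unif_sets P s) B"
    proof (cases "B \<in> ?X")
      case True
      then show ?thesis
        unfolding unif_sets_def using eq[OF True B0] val subsets_card_nonempty[OF sP]
        by (subst pmf_of_set) (auto simp: indicator_def)
    next
      case False
      then have "B \<notin> set_pmf W" using supp by auto
      then show ?thesis
        unfolding unif_sets_def using False subsets_card_nonempty[OF sP]
        by (subst pmf_of_set) (auto simp: pmf_eq_0_set_pmf)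
    qed
  qed
qed

lemma map_pmf_permutation_unif_sets:
  assumes "\<tau> permutes {1..P}" "s \<le> P"
  shows "map_pmf (\<lambda>A. \<tau> ` A) (unif_sets P s) = unif_sets P s"
  unfolding unif_sets_def
proof (rule map_pmf_of_set_bij_betw)
  have inj: "inj_on \<tau> A" for A using permutes_inj[OF assms(1)] by (auto simp: inj_on_def)
  have inj': "inj_on (inv \<tau>) A" for A
    using permutes_inj[OF permutes_inv[OF assms(1)]] by (auto simp: inj_on_def)
  show "bij_betw (\<lambda>A. \<tau> ` A) {A. A \<subseteq> {1..P} \<and> card A = s} {A. A \<subseteq> {1..P} \<and> card A = s}"
  proof (rule bij_betwI[where g = "\<lambda>A. inv \<tau> ` A"])
    show "(\<lambda>A. \<tau> ` A) \<in> {A. A \<subseteq> {1..P} \<and> card A = s} \<rightarrow> {A. A \<subseteq> {1..P} \<and> card A = s}"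
      using inj permutes_image[OF assms(1)] by (auto simp: card_image)
    show "(\<lambda>A. inv \<tau> ` A) \<in> {A. A \<subseteq> {1..P} \<and> card A = s} \<rightarrow> {A. A \<subseteq> {1..P} \<and> card A = s}"
      using inj' permutes_image[OF permutes_inv[OF assms(1)]] by (auto simp: card_image)
  qed (use permutes_inverses[OF assms(1)] in \<open>auto simp: image_image\<close>)
qed (use subsets_card_nonempty[OF assms(2)] in auto)

text \<open>
  Identifying the objects of \<open>{1..m * P}\<close> that are congruent modulo \<open>P\<close> can only create edges. It allows
  to enlarge the pool without changing the set sizes, whose lower bound must be preserved.
\<close>

definition merge :: "nat \<Rightarrow> nat \<Rightarrow> nat" where
  "merge P x = (x - 1) mod P + 1"

lemma merge_in: "1 \<le> P \<Longrightarrow> merge P x \<in> {1..P}"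
  by (auto simp: merge_def Suc_le_eq)

text \<open>The lifted permutation applies \<open>\<sigma>\<close> inside each block of
  \<open>P\<close> consecutive objects, so it commutes with merging and transfers symmetries of the
  small pool to the large one.\<close>

lemma merge_lift_permutation:
  assumes \<sigma>: "\<sigma> permutes {1..P}" and P: "1 \<le> P"
  obtains \<tau> where "\<tau> permutes {1..m * P}" "\<And>x. x \<in> {1..m * P} \<Longrightarrow> merge P (\<tau> x) = \<sigma> (merge P x)"
proof -
  define \<tau> where "\<tau> x = (if x \<in> {1..m * P} then (x - 1) div P * P + \<sigma> (merge P x) else x)" for x
  have \<sigma>in: "\<sigma> (merge P x) \<in> {1..P}" for x
    using permutes_in_image[OF \<sigma>] merge_in[OF P] by blast
  have val: "(\<tau> x - 1) div P = (x - 1) div P" "(\<tau> x - 1) mod P = \<sigma> (merge P x) - 1" if "x \<in> {1..m * P}" for x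
  proof -
    obtain t where t: "\<sigma> (merge P x) = Suc t" "t < P"
      using \<sigma>in[of x] by (cases "\<sigma> (merge P x)") auto
    have "\<tau> x - 1 = t + (x - 1) div P * P" using that t by (simp add: \<tau>_def)
    then show "(\<tau> x - 1) div P = (x - 1) div P" "(\<tau> x - 1) mod P = \<sigma> (merge P x) - 1"
      using t P by auto
  qed
  have m: "merge P (\<tau> x) = \<sigma> (merge P x)" if "x \<in> {1..m * P}" for x
    using val(2)[OF that] \<sigma>in[of x] by (simp add: merge_def)
  have into: "\<tau> x \<in> {1..m * P}" if "x \<in> {1..m * P}" for x
  proof -
    have "(x - 1) div P < m" using that P by (intro less_mult_imp_div_less) auto
    then have "(x - 1) div P * P + P \<le> m * P"
      by (metis add.commute mult_Suc mult_le_mono1 Suc_leI)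
    then show ?thesis using that \<sigma>in[of x] by (auto simp: \<tau>_def)
  qed
  have "inj_on \<tau> {1..m * P}"
  proof (rule inj_onI)
    fix x y assume xy: "x \<in> {1..m * P}" "y \<in> {1..m * P}" "\<tau> x = \<tau> y"
    have "\<sigma> (merge P x) = \<sigma> (merge P y)" using m xy by metis
    then have "merge P x = merge P y" using permutes_inj[OF \<sigma>] by (meson injD)
    then have "(x - 1) mod P = (y - 1) mod P" by (simp add: merge_def)
    moreover have "(x - 1) div P = (y - 1) div P" using val(1) xy by metis
    ultimately have "x - 1 = y - 1" by (metis div_mult_mod_eq)
    then show "x = y" using xy by auto
  qed
  moreover from this have "\<tau> ` {1..m * P} = {1..m * P}"
    using into by (intro endo_inj_surj) blast+
  ultimately have "bij_betw \<tau> {1..m * P} {1..m * P}" by (simp add: bij_betw_def)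
  then have "\<tau> permutes {1..m * P}" by (intro bij_imp_permutes) (auto simp: \<tau>_def)
  with m show ?thesis by (intro that) auto
qed

text \<open>A set \<open>A\<close> is drawn from the large pool and its image is completed by a
  uniformly random choice to a set of size \<open>s'\<close>. Merging may collapse objects, so the
  image has no fixed size; the completed set is nevertheless uniform, since the whole construction
  commutes with permutations of the small pool.\<close>

lemma rel_pmf_unif_sets_merge:
  assumes P: "1 \<le> P" and s: "s \<le> s'" "s' \<le> P" and m: "1 \<le> m"
  shows "rel_pmf (\<lambda>A B. merge P ` A \<subseteq> B) (unif_sets (m * P) s) (unif_sets P s')"
proof -
  define C where "C A = {B. B \<subseteq> {1..P} \<and> card B = s' \<and> merge P ` A \<subseteq> B}" for A
  define W where "W = bind_pmf (unif_sets (m * P) s) (\<lambda>A. pmf_of_set (C A))"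
  have "P \<le> m * P" using m by simp
  then have sm: "s \<le> m * P" using s by linarith
  have finC: "finite (C A)" for A
    unfolding C_def by (rule finite_subset[of _ "Pow {1..P}"]) auto
  have neC: "C A \<noteq> {}" if "A \<in> set_pmf (unif_sets (m * P) s)" for A
  proof -
    have A: "A \<subseteq> {1..m * P}" "card A = s" using that set_unif_sets[OF sm] by auto
    have fin: "finite A" using A(1) finite_subset by blast
    have "merge P ` A \<subseteq> {1..P}" using merge_in[OF P] by blast
    moreover have "card (merge P ` A) \<le> s'" using card_image_le[OF fin, of "merge P"] A s by simp
    ultimately obtain B where "merge P ` A \<subseteq> B" "B \<subseteq> {1..P}" "card B = s'"
      using exists_subset_between[of "merge P ` A" s' "{1..P}"] s by auto
    then show ?thesis by (auto simp: C_def)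
  qed
  have "W = unif_sets P s'"
  proof (rule permutation_invariant_eq_unif_sets[OF s(2)])
    show "set_pmf W \<subseteq> {B. B \<subseteq> {1..P} \<and> card B = s'}"
      using neC finC by (auto simp: W_def C_def set_pmf_of_set)
    fix \<sigma> assume \<sigma>: "\<sigma> permutes {1..P}"
    obtain \<tau> where \<tau>: "\<tau> permutes {1..m * P}" "\<And>x. x \<in> {1..m * P} \<Longrightarrow> merge P (\<tau> x) = \<sigma> (merge P x)"
      using merge_lift_permutation[OF \<sigma> P] by metis
    have inj: "inj_on \<sigma> A" for A using permutes_inj[OF \<sigma>] by (auto simp: inj_on_def)
    have inj': "inj_on (inv \<sigma>) A" for A
      using permutes_inj[OF permutes_inv[OF \<sigma>]] by (auto simp: inj_on_def)
    have step: "map_pmf (\<lambda>B. \<sigma> ` B) (pmf_of_set (C A)) = pmf_of_set (C (\<tau> ` A))"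
      if A: "A \<in> set_pmf (unif_sets (m * P) s)" for A
    proof (rule map_pmf_of_set_bij_betw[OF _ neC[OF A] finC])
      have "A \<subseteq> {1..m * P}" using A set_unif_sets[OF sm] by auto
      then have im: "merge P ` \<tau> ` A = \<sigma> ` merge P ` A"
        using \<tau>(2) by (force simp: image_image intro!: image_cong)
      show "bij_betw (\<lambda>B. \<sigma> ` B) (C A) (C (\<tau> ` A))"
      proof (rule bij_betwI[where g = "\<lambda>B. inv \<sigma> ` B"])
        show "(\<lambda>B. \<sigma> ` B) \<in> C A \<rightarrow> C (\<tau> ` A)"
        proof
          fix B assume B: "B \<in> C A"
          then have "\<sigma> ` B \<subseteq> \<sigma> ` {1..P}" by (auto simp: C_def)
          then show "\<sigma> ` B \<in> C (\<tau> ` A)"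
            using B permutes_image[OF \<sigma>] inj by (auto simp: C_def im card_image)
        qed
        show "(\<lambda>B. inv \<sigma> ` B) \<in> C (\<tau> ` A) \<rightarrow> C A"
        proof
          fix B assume B: "B \<in> C (\<tau> ` A)"
          then have "inv \<sigma> ` B \<subseteq> inv \<sigma> ` {1..P}" by (auto simp: C_def)
          moreover have "inv \<sigma> ` \<sigma> ` merge P ` A \<subseteq> inv \<sigma> ` B"
            using B by (intro image_mono) (auto simp: C_def im)
          moreover have "inv \<sigma> ` \<sigma> ` merge P ` A = merge P ` A"
            using permutes_inverses[OF \<sigma>] by (simp add: image_image)
          ultimately show "inv \<sigma> ` B \<in> C A"
            using B permutes_image[OF permutes_inv[OF \<sigma>]] inj' by (auto simp: C_def card_image)
        qed
      qed (use permutes_inverses[OF \<sigma>] in \<open>auto simp: image_image\<close>)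
    qed
    have "map_pmf (\<lambda>B. \<sigma> ` B) W = bind_pmf (unif_sets (m * P) s) (\<lambda>A. map_pmf (\<lambda>B. \<sigma> ` B) (pmf_of_set (C A)))"
      by (simp add: W_def map_bind_pmf)
    also have "\<dots> = bind_pmf (unif_sets (m * P) s) (\<lambda>A. pmf_of_set (C (\<tau> ` A)))"
      using step by (intro bind_pmf_cong) auto
    also have "\<dots> = bind_pmf (map_pmf (\<lambda>A. \<tau> ` A) (unif_sets (m * P) s)) (\<lambda>A. pmf_of_set (C A))"
      by (simp add: bind_map_pmf)
    also have "\<dots> = W" by (simp add: map_pmf_permutation_unif_sets[OF \<tau>(1) sm] W_def)
    finally show "map_pmf (\<lambda>B. \<sigma> ` B) W = W" .
  qed
  moreover have "rel_pmf (\<lambda>A B. merge P ` A \<subseteq> B) (bind_pmf (unif_sets (m * P) s) return_pmf) W"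
    unfolding W_def
  proof (rule rel_pmf_bindI[where R = "\<lambda>A B. A = B \<and> A \<in> set_pmf (unif_sets (m * P) s)"])
    show "rel_pmf (\<lambda>A B. A = B \<and> A \<in> set_pmf (unif_sets (m * P) s)) (unif_sets (m * P) s) (unif_sets (m * P) s)"
      by (rule rel_pmf_reflI) auto
  qed (use neC finC in \<open>auto simp: rel_pmf_return_pmf1 C_def set_pmf_of_set\<close>)
  ultimately show ?thesis by (simp add: bind_return_pmf')
qed

corollary rel_pmf_unif_sets_subset:
  assumes "s \<le> s'" "s' \<le> P" "1 \<le> P"
  shows "rel_pmf (\<subseteq>) (unif_sets P s) (unif_sets P s')"
proof -
  have "rel_pmf (\<lambda>A B. merge P ` A \<subseteq> B) (unif_sets (1 * P) s) (unif_sets P s')"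
    using assms by (intro rel_pmf_unif_sets_merge) auto
  then have "rel_pmf (\<lambda>A B. merge P ` A \<subseteq> B) (unif_sets P s) (unif_sets P s')" by simp
  then show ?thesis
  proof (rule pmf.rel_mono_strong)
    fix A B assume A: "A \<in> set_pmf (unif_sets P s)" and AB: "merge P ` A \<subseteq> B"
    have "A \<subseteq> {1..P}" using A assms set_unif_sets[of s P] by auto
    then have "merge P a = a" if "a \<in> A" for a using that by (auto simp: merge_def subset_iff)
    then show "A \<subseteq> B" using AB by force
  qed
qed

subsection \<open>Intersection graphs\<close>

definition nbrs :: "nat \<Rightarrow> (nat \<Rightarrow> 'b set) \<Rightarrow> nat \<Rightarrow> nat set" where
  "nbrs n S i = {j \<in> {1..n}. j \<noteq> i \<and> S i \<inter> S j \<noteq> {}}"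

definition low_degree :: "nat \<Rightarrow> nat \<Rightarrow> (nat \<Rightarrow> 'b set) \<Rightarrow> nat set" where
  "low_degree n k S = {i \<in> {1..n}. card (nbrs n S i) < k}"

lemma finite_nbrs [simp]: "finite (nbrs n S i)"
  by (simp add: nbrs_def)

lemma finite_low_degree [simp]: "finite (low_degree n k S)"
  by (simp add: low_degree_def)

lemma pverts_intersection_graph [simp]: "pverts (intersection_graph n S) = {1..n}"
  by (simp add: intersection_graph_def)

lemma parcs_intersection_graph:
  "(i, j) \<in> parcs (intersection_graph n S) \<longleftrightarrow> i \<in> {1..n} \<and> j \<in> nbrs n S i"
  by (auto simp: intersection_graph_def nbrs_def)

lemma out_degree_intersection_graph:
  assumes "i \<in> {1..n}"
  shows "out_degree (with_proj (intersection_graph n S)) i = card (nbrs n S i)"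
proof -
  have "out_arcs (with_proj (intersection_graph n S)) i = Pair i ` nbrs n S i"
    using assms by (auto simp: out_arcs_def parcs_intersection_graph)
  then show ?thesis by (simp add: out_degree_def card_image inj_on_def)
qed

lemma min_degree_intersection_graph_ge_iff:
  assumes "1 \<le> n"
  shows "k \<le> min_degree (intersection_graph n S) \<longleftrightarrow> low_degree n k S = {}"
proof -
  have "(\<lambda>v. out_degree (with_proj (intersection_graph n S)) v) ` {1..n} = (\<lambda>i. card (nbrs n S i)) ` {1..n}"
    by (intro image_cong refl out_degree_intersection_graph)
  then show ?thesis
    using assms by (auto simp: min_degree_def low_degree_def not_less)
qed

lemma k_connected_mono:
  assumes "pverts G = pverts G'" "parcs G \<subseteq> parcs G'" "k_connected k G"
  shows "k_connected k G'"
proof -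
  have "paths_between G u v \<subseteq> paths_between G' u v" for u v
    using assms(1,2) by (auto simp: paths_between_def vpath_with_proj_iff elim: successively_mono)
  note sub = this
  show ?thesis
    unfolding k_connected_def
  proof (intro ballI impI)
    fix u v assume "u \<in> pverts G'" "v \<in> pverts G'" "u \<noteq> v"
    then obtain Q where "Q \<subseteq> paths_between G u v" "finite Q" "k \<le> card Q" "internally_disjoint u v Q"
      using assms(1,3) unfolding k_connected_def by metis
    then show "\<exists>Q. Q \<subseteq> paths_between G' u v \<and> finite Q \<and> k \<le> card Q \<and> internally_disjoint u v Q"
      using sub by blast
  qed
qed

text \<open>One map \<open>h\<close> serves all nodes, so common objects stay common. Both enlarging
  the sets and identifying objects are of this form.\<close>

definition merges_into :: "nat \<Rightarrow> (nat \<Rightarrow> 'b set) \<Rightarrow> (nat \<Rightarrow> 'c set) \<Rightarrow> bool" where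
  "merges_into n S S' \<longleftrightarrow> (\<exists>h. \<forall>i\<in>{1..n}. h ` S i \<subseteq> S' i)"

lemma nbrs_mono:
  assumes "merges_into n S S'" "i \<in> {1..n}"
  shows "nbrs n S i \<subseteq> nbrs n S' i"
proof -
  obtain h where h: "\<And>i. i \<in> {1..n} \<Longrightarrow> h ` S i \<subseteq> S' i" using assms(1) unfolding merges_into_def by blast
  show ?thesis
  proof
    fix j assume j: "j \<in> nbrs n S i"
    then obtain a where "a \<in> S i" "a \<in> S j" "j \<in> {1..n}" by (auto simp: nbrs_def)
    then have "h a \<in> S' i" "h a \<in> S' j" using h[OF assms(2)] h[of j] by auto
    then show "j \<in> nbrs n S' i" using j by (auto simp: nbrs_def)
  qed
qed

lemma low_degree_antimono:
  assumes "merges_into n S S'"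
  shows "low_degree n k S' \<subseteq> low_degree n k S"
proof
  fix i assume i: "i \<in> low_degree n k S'"
  then have "card (nbrs n S i) \<le> card (nbrs n S' i)"
    by (intro card_mono nbrs_mono[OF assms]) (auto simp: low_degree_def)
  then show "i \<in> low_degree n k S" using i by (auto simp: low_degree_def)
qed

lemma k_connected_intersection_graph_mono:
  assumes "merges_into n S S'" "k_connected k (intersection_graph n S)"
  shows "k_connected k (intersection_graph n S')"
proof (rule k_connected_mono[OF _ _ assms(2)])
  show "parcs (intersection_graph n S) \<subseteq> parcs (intersection_graph n S')"
    using nbrs_mono[OF assms(1)] by (fastforce simp: parcs_intersection_graph)
qed simp

lemma low_degree_empty_if_k_connected:
  assumes "2 \<le> n" "k_connected k (intersection_graph n S)"
  shows "low_degree n k S = {}"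
proof (rule ccontr)
  assume "low_degree n k S \<noteq> {}"
  then obtain i where i: "i \<in> {1..n}" "card (nbrs n S i) < k" by (auto simp: low_degree_def)
  define j where "j = (if i = 1 then 2 else 1 :: nat)"
  have "k \<le> card {w. (i, w) \<in> parcs (intersection_graph n S)}"
    by (rule degree_ge_if_k_connected[OF pair_graph_intersection_graph assms(2), where v = j])
      (use i assms(1) in \<open>auto simp: j_def\<close>)
  moreover have "{w. (i, w) \<in> parcs (intersection_graph n S)} = nbrs n S i"
    using i by (auto simp: parcs_intersection_graph)
  ultimately show False using i by simp
qed

definition sparse_part :: "nat \<Rightarrow> (nat \<Rightarrow> 'b set) \<Rightarrow> nat set \<Rightarrow> nat set \<Rightarrow> (nat \<Rightarrow> nat) \<Rightarrow> nat \<Rightarrow> bool" where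
  "sparse_part n S T X f v \<longleftrightarrow>
     (\<forall>w\<in>T - {v}. S w \<inter> S (f w) \<noteq> {}) \<and>
     (\<forall>j\<in>X. S j \<inter> \<Union>(S ` T) \<noteq> {}) \<and> (\<forall>j\<in>{1..n} - T - X. S j \<inter> \<Union>(S ` T) = {})"

lemma sparse_part_if_not_k_connected:
  assumes n: "k < n" and nc: "\<not> k_connected k (intersection_graph n S)" and low: "low_degree n k S = {}"
  shows "\<exists>T X f v. T \<subseteq> {1..n} \<and> 2 \<le> card T \<and> 2 * card T \<le> n \<and> X \<subseteq> {1..n} - T \<and> card X < k \<and>
    v \<in> T \<and> f \<in> T \<rightarrow>\<^sub>E T \<and> rooted_tree f v T \<and> sparse_part n S T X f v"
proof -
  let ?G = "intersection_graph n S"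
  have "\<exists>X T. cut_pair ?G X T \<and> card X < k"
    by (rule cut_if_not_k_connected) (use n nc pair_graph_intersection_graph in auto)
  then obtain X0 T0 where "cut_pair ?G X0 T0" "card X0 < k" by blast
  from small_connected_part_if_cut[OF pair_graph_intersection_graph this]
  obtain T X f v where T: "T \<subseteq> {1..n}" "T \<noteq> {}" "2 * card T \<le> n" "X \<subseteq> {1..n} - T" "card X < k"
     "\<forall>b\<in>X. \<exists>a\<in>T. (a, b) \<in> parcs ?G" "\<forall>b\<in>{1..n} - T - X. \<forall>a\<in>T. (a, b) \<notin> parcs ?G"
     "v \<in> T" "rooted_tree f v T" "\<forall>w\<in>T - {v}. (w, f w) \<in> parcs ?G"
    unfolding pverts_intersection_graph by (elim exE conjE bexE) simp
  have fin: "finite T" "finite X" using T(1,4) finite_subset by blast+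
  \<comment> \<open>A single node whose neighbours all lie in \<open>X\<close> would have degree
    less than \<open>k\<close>.\<close>
  have "card T \<noteq> 1"
  proof
    assume "card T = 1"
    then obtain t where t: "T = {t}" by (auto simp: card_1_singleton_iff)
    have "nbrs n S t \<subseteq> X"
    proof
      fix j assume j: "j \<in> nbrs n S t"
      then have "(t, j) \<in> parcs ?G" "j \<in> {1..n}" "j \<noteq> t" using T(1) t by (auto simp: parcs_intersection_graph nbrs_def)
      then show "j \<in> X" using T(7) t by blast
    qed
    then have "card (nbrs n S t) < k" using card_mono[OF fin(2)] T(5) by (meson le_less_trans)
    then show False using low T(1) t by (auto simp: low_degree_def)
  qed
  \<comment> \<open>The parent function is normalized to fix the root and to be undefined outside
    \<open>T\<close>; thus only \<open>card T ^ card T\<close> functions occur in the union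
    bound.\<close>
  then have "2 \<le> card T" using T(2) fin by (metis One_nat_def Suc_1 Suc_leI card_gt_0_iff le_neq_implies_less)
  moreover define g where "g = restrict (f(v := v)) T"
  have "g \<in> T \<rightarrow>\<^sub>E T" using rooted_tree_closed[OF T(9)] T(8) by (auto simp: g_def)
  moreover have "rooted_tree g v T" by (rule rooted_tree_cong[OF T(9)]) (auto simp: g_def)
  moreover have "sparse_part n S T X g v"
    unfolding sparse_part_def
  proof (intro conjI ballI)
    fix w assume w: "w \<in> T - {v}"
    then have "(w, f w) \<in> parcs ?G" "g w = f w" using T(10) by (auto simp: g_def)
    then show "S w \<inter> S (g w) \<noteq> {}" by (auto simp: parcs_intersection_graph nbrs_def)
  next
    fix j assume "j \<in> X"
    then obtain a where "a \<in> T" "(a, j) \<in> parcs ?G" using T(6) by blast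
    then show "S j \<inter> \<Union>(S ` T) \<noteq> {}" by (auto simp: parcs_intersection_graph nbrs_def)
  next
    fix j assume j: "j \<in> {1..n} - T - X"
    then have "\<forall>a\<in>T. (a, j) \<notin> parcs ?G" using T(7) by blast
    then show "S j \<inter> \<Union>(S ` T) = {}" using j T(1) by (fastforce simp: parcs_intersection_graph nbrs_def)
  qed
  ultimately show ?thesis using T by blast
qed

section \<open>The model with equal set sizes\<close>

definition unif_model :: "nat \<Rightarrow> nat \<Rightarrow> nat \<Rightarrow> (nat \<Rightarrow> nat set) pmf" where
  "unif_model n P K = Pi_pmf {1..n} {} (\<lambda>_. unif_sets P K)"

definition increasing :: "nat \<Rightarrow> ((nat \<Rightarrow> nat set) \<Rightarrow> bool) \<Rightarrow> bool" where
  "increasing n \<Phi> \<longleftrightarrow> (\<forall>S S'. merges_into n S S' \<longrightarrow> \<Phi> S \<longrightarrow> \<Phi> S')"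

lemma increasing_k_connected: "increasing n (\<lambda>S. k_connected k (intersection_graph n S))"
  unfolding increasing_def using k_connected_intersection_graph_mono by blast

lemma increasing_low_degree_empty: "increasing n (\<lambda>S. low_degree n k S = {})"
  unfolding increasing_def using low_degree_antimono by blast

lemma prob_unif_model_mono_size:
  assumes "increasing n \<Phi>" "1 \<le> P" "s \<le> s'" "s' \<le> P"
  shows "measure_pmf.prob (unif_model n P s) {S. \<Phi> S} \<le> measure_pmf.prob (unif_model n P s') {S. \<Phi> S}"
  unfolding unif_model_def
proof (rule prob_Pi_pmf_coupling_le[where R = "(\<subseteq>)"])
  fix S S' :: "nat \<Rightarrow> nat set"
  assume "\<And>i. i \<in> {1..n} \<Longrightarrow> S i \<subseteq> S' i" and \<Phi>: "\<Phi> S"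
  then have "merges_into n S S'" unfolding merges_into_def by (intro exI[of _ id]) auto
  then show "\<Phi> S'" using assms(1) \<Phi> unfolding increasing_def by blast
qed (use assms rel_pmf_unif_sets_subset in auto)

lemma prob_unif_model_mono_pool:
  assumes "increasing n \<Phi>" "1 \<le> P" "s \<le> P" "1 \<le> m"
  shows "measure_pmf.prob (unif_model n (m * P) s) {S. \<Phi> S} \<le> measure_pmf.prob (unif_model n P s) {S. \<Phi> S}"
  unfolding unif_model_def
proof (rule prob_Pi_pmf_coupling_le[where R = "\<lambda>A B. merge P ` A \<subseteq> B"])
  fix S S' :: "nat \<Rightarrow> nat set"
  assume "\<And>i. i \<in> {1..n} \<Longrightarrow> merge P ` S i \<subseteq> S' i" and \<Phi>: "\<Phi> S"
  then have "merges_into n S S'" unfolding merges_into_def by blast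
  then show "\<Phi> S'" using assms(1) \<Phi> unfolding increasing_def by blast
qed (use assms rel_pmf_unif_sets_merge in auto)

section \<open>Comparison of random set sizes with equal ones\<close>

lemma object_set_pmf_eq: "object_set_pmf P D = bind_pmf D (unif_sets P)"
  unfolding object_set_pmf_def unif_sets_def ..

lemma prob_object_set_card:
  assumes "set_pmf D \<subseteq> {1..P}"
  shows "measure_pmf.prob (object_set_pmf P D) {A. card A \<notin> I} = measure_pmf.prob D (- I)"
proof -
  have "map_pmf card (unif_sets P s) = return_pmf s" if "s \<in> set_pmf D" for s
  proof -
    have "s \<le> P" using that assms by auto
    then have "map_pmf card (unif_sets P s) = map_pmf (\<lambda>_. s) (unif_sets P s)"
      by (intro pmf.map_cong) (auto simp: set_unif_sets)
    then show ?thesis by simp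
  qed
  then have "map_pmf card (object_set_pmf P D) = bind_pmf D return_pmf"
    unfolding object_set_pmf_eq map_bind_pmf by (intro bind_pmf_cong) auto
  then have "measure_pmf.prob (map_pmf card (object_set_pmf P D)) (- I) = measure_pmf.prob D (- I)"
    by (simp add: bind_return_pmf')
  moreover have "card -` (- I) = {A. card A \<notin> I}" by auto
  ultimately show ?thesis by (metis measure_map_pmf)
qed

lemma prob_some_size_bad_le:
  assumes "set_pmf D \<subseteq> {1..P}"
  shows "measure_pmf.prob (Pi_pmf {1..n} {} (\<lambda>_. object_set_pmf P D)) {S. \<exists>i\<in>{1..n}. card (S i) \<notin> I} \<le>
    real n * measure_pmf.prob D (- I)"
proof -
  let ?M = "Pi_pmf {1..n} {} (\<lambda>_. object_set_pmf P D)"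
  have "measure_pmf.prob ?M {S. card (S i) \<notin> I} = measure_pmf.prob D (- I)" if "i \<in> {1..n}" for i
  proof -
    have "measure_pmf.prob (map_pmf (\<lambda>S. S i) ?M) {A. card A \<notin> I} = measure_pmf.prob D (- I)"
      using that prob_object_set_card[OF assms] by (simp add: Pi_pmf_component)
    then show ?thesis by (simp add: vimage_def)
  qed
  then have "(\<Sum>i\<in>{1..n}. measure_pmf.prob ?M {S. card (S i) \<notin> I}) = real n * measure_pmf.prob D (- I)"
    by simp
  moreover have "measure_pmf.prob ?M (\<Union>i\<in>{1..n}. {S. card (S i) \<notin> I}) \<le> (\<Sum>i\<in>{1..n}. measure_pmf.prob ?M {S. card (S i) \<notin> I})"
    by (intro measure_pmf.finite_measure_subadditive_finite) auto
  moreover have "(\<Union>i\<in>{1..n}. {S. card (S i) \<notin> I}) = {S :: nat \<Rightarrow> nat set. \<exists>i\<in>{1..n}. card (S i) \<notin> I}" by auto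
  ultimately show ?thesis by (simp only:)
qed

lemma rel_pmf_bind_left:
  assumes "\<And>x. x \<in> set_pmf D \<Longrightarrow> rel_pmf R (f x) q"
  shows "rel_pmf R (bind_pmf D f) q"
proof -
  have "rel_pmf R (bind_pmf D f) (bind_pmf D (\<lambda>_. q))"
    by (rule rel_pmf_bindI[where R = "\<lambda>x y. x = y \<and> x \<in> set_pmf D"])
      (use assms in \<open>auto intro: rel_pmf_reflI\<close>)
  then show ?thesis by simp
qed

lemma rel_pmf_bind_right:
  assumes "\<And>x. x \<in> set_pmf D \<Longrightarrow> rel_pmf R q (f x)"
  shows "rel_pmf R q (bind_pmf D f)"
proof -
  have "rel_pmf R (bind_pmf D (\<lambda>_. q)) (bind_pmf D f)"
    by (rule rel_pmf_bindI[where R = "\<lambda>x y. x = y \<and> x \<in> set_pmf D"])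
      (use assms in \<open>auto intro: rel_pmf_reflI\<close>)
  then show ?thesis by simp
qed

lemma rel_pmf_independent:
  assumes "\<And>x y. x \<in> set_pmf p \<Longrightarrow> y \<in> set_pmf q \<Longrightarrow> R x y"
  shows "rel_pmf R p q"
  by (rule rel_pmf.intros[where pq = "pair_pmf p q"])
    (use assms in \<open>auto simp: map_fst_pair_pmf map_snd_pair_pmf\<close>)

text \<open>The coupling has to give inclusion only for sizes in \<open>I\<close>. Sets of
  exceptional size are coupled arbitrarily and are paid for by a union bound over the nodes.\<close>

lemma prob_general_le_unif:
  assumes inc: "increasing n \<Phi>" and supp: "set_pmf D \<subseteq> {1..P}" and P: "1 \<le> P" and s: "s \<le> P"
    and I: "\<And>t. t \<in> set_pmf D \<Longrightarrow> t \<in> I \<Longrightarrow> t \<le> s"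
  shows "measure_pmf.prob (Pi_pmf {1..n} {} (\<lambda>_. object_set_pmf P D)) {S. \<Phi> S} \<le>
    measure_pmf.prob (unif_model n P s) {S. \<Phi> S} + real n * measure_pmf.prob D (- I)"
proof -
  let ?M = "Pi_pmf {1..n} {} (\<lambda>_. object_set_pmf P D)"
  have rel: "rel_pmf (\<lambda>A B. card A \<in> I \<longrightarrow> A \<subseteq> B) (object_set_pmf P D) (unif_sets P s)"
    unfolding object_set_pmf_eq
  proof (rule rel_pmf_bind_left)
    fix t assume t: "t \<in> set_pmf D"
    then have tP: "t \<le> P" using supp by auto
    show "rel_pmf (\<lambda>A B. card A \<in> I \<longrightarrow> A \<subseteq> B) (unif_sets P t) (unif_sets P s)"
    proof (cases "t \<in> I")
      case True
      then show ?thesis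
        using I[OF t] by (intro pmf.rel_mono_strong[OF rel_pmf_unif_sets_subset[OF _ s P]]) auto
    next
      case False
      then show ?thesis by (intro rel_pmf_independent) (auto simp: set_unif_sets[OF tP])
    qed
  qed
  have "measure_pmf.prob ?M {S. \<Phi> S} \<le>
      measure_pmf.prob ?M ({S. \<Phi> S \<and> (\<forall>i\<in>{1..n}. card (S i) \<in> I)} \<union> {S. \<exists>i\<in>{1..n}. card (S i) \<notin> I})"
    by (intro measure_pmf.finite_measure_mono) auto
  also have "\<dots> \<le> measure_pmf.prob ?M {S. \<Phi> S \<and> (\<forall>i\<in>{1..n}. card (S i) \<in> I)} +
      measure_pmf.prob ?M {S. \<exists>i\<in>{1..n}. card (S i) \<notin> I}"
    by (intro measure_Un_le) auto
  also have "measure_pmf.prob ?M {S. \<Phi> S \<and> (\<forall>i\<in>{1..n}. card (S i) \<in> I)} \<le>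
      measure_pmf.prob (unif_model n P s) {S. \<Phi> S}"
    unfolding unif_model_def
  proof (rule prob_Pi_pmf_coupling_le[OF _ rel])
    fix S S' :: "nat \<Rightarrow> nat set"
    assume "\<And>i. i \<in> {1..n} \<Longrightarrow> card (S i) \<in> I \<longrightarrow> S i \<subseteq> S' i" and \<Phi>: "\<Phi> S \<and> (\<forall>i\<in>{1..n}. card (S i) \<in> I)"
    then have "merges_into n S S'" unfolding merges_into_def by (intro exI[of _ id]) auto
    then show "\<Phi> S'" using inc \<Phi> unfolding increasing_def by blast
  qed simp
  also have "measure_pmf.prob ?M {S. \<exists>i\<in>{1..n}. card (S i) \<notin> I} \<le> real n * measure_pmf.prob D (- I)"
    by (rule prob_some_size_bad_le[OF supp])
  finally show ?thesis by simp
qed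

lemma prob_unif_le_general:
  assumes inc: "increasing n \<Phi>" and supp: "set_pmf D \<subseteq> {1..P}" and P: "1 \<le> P" and s: "s \<le> P"
    and I: "\<And>t. t \<in> set_pmf D \<Longrightarrow> t \<in> I \<Longrightarrow> s \<le> t"
  shows "measure_pmf.prob (unif_model n P s) {S. \<Phi> S} \<le>
    measure_pmf.prob (Pi_pmf {1..n} {} (\<lambda>_. object_set_pmf P D)) {S. \<Phi> S} + real n * measure_pmf.prob D (- I)"
proof -
  let ?M = "Pi_pmf {1..n} {} (\<lambda>_. object_set_pmf P D)"
  have rel: "rel_pmf (\<lambda>A B. card B \<in> I \<longrightarrow> A \<subseteq> B) (unif_sets P s) (object_set_pmf P D)"
    unfolding object_set_pmf_eq
  proof (rule rel_pmf_bind_right)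
    fix t assume t: "t \<in> set_pmf D"
    then have tP: "t \<le> P" using supp by auto
    show "rel_pmf (\<lambda>A B. card B \<in> I \<longrightarrow> A \<subseteq> B) (unif_sets P s) (unif_sets P t)"
    proof (cases "t \<in> I")
      case True
      then show ?thesis
        using I[OF t] by (intro pmf.rel_mono_strong[OF rel_pmf_unif_sets_subset[OF _ tP P]]) auto
    next
      case False
      then show ?thesis by (intro rel_pmf_independent) (auto simp: set_unif_sets[OF tP])
    qed
  qed
  have "measure_pmf.prob (unif_model n P s) {S. \<Phi> S} \<le> measure_pmf.prob ?M {S. \<Phi> S \<or> (\<exists>i\<in>{1..n}. card (S i) \<notin> I)}"
    unfolding unif_model_def
  proof (rule prob_Pi_pmf_coupling_le[OF _ rel])
    fix S S' :: "nat \<Rightarrow> nat set"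
    assume R: "\<And>i. i \<in> {1..n} \<Longrightarrow> card (S' i) \<in> I \<longrightarrow> S i \<subseteq> S' i" and \<Phi>: "\<Phi> S"
    show "\<Phi> S' \<or> (\<exists>i\<in>{1..n}. card (S' i) \<notin> I)"
    proof (cases "\<exists>i\<in>{1..n}. card (S' i) \<notin> I")
      case False
      then have "merges_into n S S'" unfolding merges_into_def using R by (intro exI[of _ id]) auto
      then show ?thesis using inc \<Phi> unfolding increasing_def by blast
    qed simp
  qed simp
  also have "\<dots> \<le> measure_pmf.prob ?M ({S. \<Phi> S} \<union> {S. \<exists>i\<in>{1..n}. card (S i) \<notin> I})"
    by (intro measure_pmf.finite_measure_mono) auto
  also have "\<dots> \<le> measure_pmf.prob ?M {S. \<Phi> S} + measure_pmf.prob ?M {S. \<exists>i\<in>{1..n}. card (S i) \<notin> I}"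
    by (intro measure_Un_le) auto
  also have "measure_pmf.prob ?M {S. \<exists>i\<in>{1..n}. card (S i) \<notin> I} \<le> real n * measure_pmf.prob D (- I)"
    by (rule prob_some_size_bad_le[OF supp])
  finally show ?thesis by simp
qed

subsection \<open>Probability that given nodes have small degree\<close>

lemma expectation_bind_pmf_finite:
  fixes h :: "'b \<Rightarrow> real"
  assumes "finite (set_pmf p)" "\<And>x. finite (set_pmf (f x))"
  shows "measure_pmf.expectation (bind_pmf p f) h = measure_pmf.expectation p (\<lambda>x. measure_pmf.expectation (f x) h)"
  using assms by (subst pmf_expectation_bind[where A = "set_pmf p"])
    (auto simp: integral_measure_pmf[of "set_pmf p"])

lemma finite_set_unif_sets [simp]: "K \<le> P \<Longrightarrow> finite (set_pmf (unif_sets P K))"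
  by (simp add: set_unif_sets)

lemma set_Pi_unif_sets:
  assumes "S \<in> set_pmf (Pi_pmf C {} (\<lambda>_. unif_sets P K))" "finite C" "K \<le> P" "i \<in> C"
  shows "S i \<subseteq> {1..P}" "card (S i) = K" "finite (S i)"
proof -
  have "S i \<in> set_pmf (unif_sets P K)"
    using assms by (auto simp: set_Pi_pmf PiE_dflt_def)
  then show "S i \<subseteq> {1..P}" "card (S i) = K" using set_unif_sets[OF assms(3)] by auto
  then show "finite (S i)" using finite_subset by blast
qed

lemma finite_set_Pi_unif_sets:
  assumes "finite C" "K \<le> P"
  shows "finite (set_pmf (Pi_pmf C {} (\<lambda>_. unif_sets P K)))"
  using assms by (auto simp: set_Pi_pmf intro!: finite_PiE_dflt)

lemma Union_Pi_unif_sets: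
  assumes "S \<in> set_pmf (Pi_pmf C {} (\<lambda>_. unif_sets P K))" "finite C" "K \<le> P"
  shows "\<Union>(S ` C) \<subseteq> {1..P}" "card (\<Union>(S ` C)) \<le> card C * K"
proof -
  show "\<Union>(S ` C) \<subseteq> {1..P}" using set_Pi_unif_sets(1)[OF assms] by blast
  have "card (\<Union>(S ` C)) \<le> (\<Sum>i\<in>C. card (S i))" by (rule card_UN_le[OF assms(2)])
  also have "\<dots> = card C * K" using set_Pi_unif_sets(2)[OF assms] by simp
  finally show "card (\<Union>(S ` C)) \<le> card C * K" .
qed

text \<open>The sets are added one by one. Each contributes \<open>K\<close> new objects except for
  its overlap with the previous union, whose exponential moment is bounded because that union has at
  most \<open>r * K\<close> objects. So the union behaves like that of disjoint sets up to the term
  with \<open>exp \<theta>\<close>. The fixed bound \<open>r\<close> makes the contribution of every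
  set the same.\<close>

lemma expectation_exp_neg_card_Union_le:
  assumes "finite R" "K \<le> P" "1 \<le> P" "0 \<le> \<theta>" "card R \<le> r"
  shows "measure_pmf.expectation (Pi_pmf R {} (\<lambda>_. unif_sets P K)) (\<lambda>S. exp (- \<theta> * real (card (\<Union>(S ` R))))) \<le>
    exp (real (card R) * (real r * exp \<theta> * ((real K)\<^sup>2 / real P) - \<theta> * real K))"
  using assms(1,5)
proof (induction R rule: finite_induct)
  case (insert i R)
  define a where "a = real r * exp \<theta> * ((real K)\<^sup>2 / real P) - \<theta> * real K"
  have split: "Pi_pmf (insert i R) {} (\<lambda>_. unif_sets P K) =
      bind_pmf (Pi_pmf R {} (\<lambda>_. unif_sets P K)) (\<lambda>f. map_pmf (\<lambda>A. f(i := A)) (unif_sets P K))"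
    using insert.hyps unfolding Pi_pmf_insert[OF insert.hyps] pair_pmf_def
    by (subst bind_commute_pmf) (simp add: map_bind_pmf map_pmf_def bind_assoc_pmf bind_return_pmf)
  have "measure_pmf.expectation (Pi_pmf (insert i R) {} (\<lambda>_. unif_sets P K)) (\<lambda>S. exp (- \<theta> * real (card (\<Union>(S ` insert i R))))) =
     measure_pmf.expectation (Pi_pmf R {} (\<lambda>_. unif_sets P K)) (\<lambda>f. measure_pmf.expectation (unif_sets P K)
        (\<lambda>A. exp (- \<theta> * real (card (\<Union>((f(i := A)) ` insert i R))))))"
    unfolding split using assms(2) insert.hyps(2) finite_set_Pi_unif_sets[OF insert.hyps(1) assms(2)]
    by (subst expectation_bind_pmf_finite) auto
  also have "\<dots> \<le> measure_pmf.expectation (Pi_pmf R {} (\<lambda>_. unif_sets P K))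
      (\<lambda>f. exp a * exp (- \<theta> * real (card (\<Union>(f ` R)))))"
  proof (rule integral_mono_AE)
    show "AE f in measure_pmf (Pi_pmf R {} (\<lambda>_. unif_sets P K)). measure_pmf.expectation (unif_sets P K)
        (\<lambda>A. exp (- \<theta> * real (card (\<Union>((f(i := A)) ` insert i R))))) \<le> exp a * exp (- \<theta> * real (card (\<Union>(f ` R))))"
      unfolding AE_measure_pmf_iff
    proof
      fix f assume f: "f \<in> set_pmf (Pi_pmf R {} (\<lambda>_. unif_sets P K))"
      define V where "V = \<Union>(f ` R)"
      have V: "V \<subseteq> {1..P}" "card V \<le> card R * K"
        using Union_Pi_unif_sets[OF f insert.hyps(1) assms(2)] by (auto simp: V_def)
      have finV: "finite V" using V(1) finite_subset by blast
      have "card V \<le> r * K"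
        using V(2) insert.prems insert.hyps by (meson card_insert_le mult_le_mono1 order_trans)
      then have cV: "real (card V) \<le> real r * real K" by (metis of_nat_le_iff of_nat_mult)
      have "measure_pmf.expectation (unif_sets P K) (\<lambda>A. exp (- \<theta> * real (card (\<Union>((f(i := A)) ` insert i R))))) =
        measure_pmf.expectation (unif_sets P K) (\<lambda>A. exp (- \<theta> * real (card V) - \<theta> * real K) * exp (\<theta> * real (card (A \<inter> V))))"
      proof (rule integral_cong_AE)
        show "AE A in measure_pmf (unif_sets P K). exp (- \<theta> * real (card (\<Union>((f(i := A)) ` insert i R)))) =
           exp (- \<theta> * real (card V) - \<theta> * real K) * exp (\<theta> * real (card (A \<inter> V)))"
          unfolding AE_measure_pmf_iff set_unif_sets[OF assms(2)]
        proof
          fix A assume A: "A \<in> {A. A \<subseteq> {1..P} \<and> card A = K}"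
          then have finA: "finite A" using finite_subset by blast
          have "\<Union>((f(i := A)) ` insert i R) = A \<union> V" using insert.hyps(2) by (auto simp: V_def split: if_splits)
          moreover have "card A + card V = card (A \<union> V) + card (A \<inter> V)" using finA finV by (rule card_Un_Int)
          ultimately have eq: "real (card (\<Union>((f(i := A)) ` insert i R))) = real (card V) + real K - real (card (A \<inter> V))"
            using A by simp
          show "exp (- \<theta> * real (card (\<Union>((f(i := A)) ` insert i R)))) =
           exp (- \<theta> * real (card V) - \<theta> * real K) * exp (\<theta> * real (card (A \<inter> V)))"
            unfolding eq by (simp add: exp_add[symmetric] algebra_simps)
        qed
      qed auto
      also have "\<dots> = exp (- \<theta> * real (card V) - \<theta> * real K) * measure_pmf.expectation (unif_sets P K) (\<lambda>A. exp (\<theta> * real (card (A \<inter> V))))"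
        by simp
      also have "\<dots> \<le> exp (- \<theta> * real (card V) - \<theta> * real K) * exp (real (card V) * exp \<theta> * real K / real P)"
        by (intro mult_left_mono expectation_exp_card_Int_le assms finV) auto
      also have "\<dots> \<le> exp (- \<theta> * real (card V) - \<theta> * real K) * exp ((real r * real K) * exp \<theta> * real K / real P)"
        using cV by (intro mult_left_mono exp_le_cancel_iff[THEN iffD2] divide_right_mono mult_right_mono) auto
      also have "\<dots> = exp a * exp (- \<theta> * real (card (\<Union>(f ` R))))"
        by (simp add: a_def V_def exp_add[symmetric] power2_eq_square algebra_simps)
      finally show "measure_pmf.expectation (unif_sets P K)
        (\<lambda>A. exp (- \<theta> * real (card (\<Union>((f(i := A)) ` insert i R))))) \<le> exp a * exp (- \<theta> * real (card (\<Union>(f ` R))))" .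
    qed
  qed (use finite_set_Pi_unif_sets[OF insert.hyps(1) assms(2)] in \<open>auto intro!: integrable_measure_pmf_finite\<close>)
  also have "\<dots> = exp a * measure_pmf.expectation (Pi_pmf R {} (\<lambda>_. unif_sets P K)) (\<lambda>f. exp (- \<theta> * real (card (\<Union>(f ` R)))))"
    by simp
  also have "\<dots> \<le> exp a * exp (real (card R) * a)"
    using insert.IH insert.prems insert.hyps by (intro mult_left_mono) (auto simp: a_def)
  also have "\<dots> = exp (real (card (insert i R)) * a)"
    using insert.hyps by (simp add: exp_add[symmetric] algebra_simps)
  finally show ?case unfolding a_def .
qed simp

text \<open>The nodes are revealed in the order in which the tree grows: each new set must hit the
  set of its parent, which is known by then and has \<open>K\<close> objects. Cycles would spoil
  this, which is why a spanning tree is used.\<close>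

lemma prob_rooted_tree_le:
  assumes "rooted_tree f v T" "finite C" "T \<subseteq> C" "K \<le> P" "1 \<le> P"
  shows "measure_pmf.prob (Pi_pmf C {} (\<lambda>_. unif_sets P K)) {S. \<forall>w\<in>T - {v}. S w \<inter> S (f w) \<noteq> {}} \<le>
    ((real K)\<^sup>2 / real P) ^ (card T - 1)"
proof -
  have "measure_pmf.prob (Pi_pmf T {} (\<lambda>_. unif_sets P K)) {S. \<forall>w\<in>T - {v}. S w \<inter> S (f w) \<noteq> {}} \<le>
    ((real K)\<^sup>2 / real P) ^ (card T - 1)"
    using assms(1)
  proof (induction rule: rooted_tree.induct)
    case (grow T w)
    have fin: "finite T" and v: "v \<in> T" 
      using rooted_tree_finite[OF grow.hyps(1)] rooted_tree_root[OF grow.hyps(1)] by auto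
    have closed: "f u \<in> T" if "u \<in> T - {v}" for u using rooted_tree_closed[OF grow.hyps(1) that] .
    have "measure_pmf.prob (Pi_pmf (insert w T) {} (\<lambda>_. unif_sets P K)) {S. \<forall>u\<in>insert w T - {v}. S u \<inter> S (f u) \<noteq> {}} =
       measure_pmf.prob (Pi_pmf (T \<union> {w}) {} (\<lambda>_. unif_sets P K))
        {S. (\<forall>u\<in>T - {v}. S u \<inter> S (f u) \<noteq> {}) \<and> (\<forall>j\<in>{w}. S j \<in> {B. B \<inter> S (f w) \<noteq> {}})}"
      using v grow.hyps(2) by (intro arg_cong2[where f = measure_pmf.prob]) (auto simp: insert_Diff_if)
    also have "\<dots> \<le> ((real K)\<^sup>2 / real P) * measure_pmf.prob (Pi_pmf T {} (\<lambda>_. unif_sets P K)) {S. \<forall>u\<in>T - {v}. S u \<inter> S (f u) \<noteq> {}}"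
    proof (rule prob_Pi_pmf_split_le)
      fix S S' :: "'a \<Rightarrow> nat set" assume "\<And>i. i \<in> T \<Longrightarrow> S i = S' i"
      then show "(\<forall>u\<in>T - {v}. S u \<inter> S (f u) \<noteq> {}) = (\<forall>u\<in>T - {v}. S' u \<inter> S' (f u) \<noteq> {})"
        using closed by simp
    next
      fix S S' :: "'a \<Rightarrow> nat set" and j assume "\<And>i. i \<in> T \<Longrightarrow> S i = S' i"
      then show "{B. B \<inter> S (f w) \<noteq> {}} = {B. B \<inter> S' (f w) \<noteq> {}}" using grow.hyps(3) by simp
    next
      fix S assume S: "S \<in> set_pmf (Pi_pmf T {} (\<lambda>_. unif_sets P K))"
      note Sw = set_Pi_unif_sets[OF S fin assms(4) grow.hyps(3)]
      show "(\<Prod>j\<in>{w}. measure_pmf.prob (unif_sets P K) {B. B \<inter> S (f w) \<noteq> {}}) \<le> (real K)\<^sup>2 / real P"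
        using prob_unif_sets_hit_le[OF assms(4,5) Sw(3)] Sw(2) by (simp add: power2_eq_square)
    qed (use fin grow.hyps in auto)
    also have "\<dots> \<le> ((real K)\<^sup>2 / real P) * ((real K)\<^sup>2 / real P) ^ (card T - 1)"
      by (intro mult_left_mono grow.IH) auto
    also have "\<dots> = ((real K)\<^sup>2 / real P) ^ (card (insert w T) - 1)"
      using fin v grow.hyps(2) by (cases "card T") (auto simp: card_eq_0_iff)
    finally show ?case .
  qed simp
  moreover have "measure_pmf.prob (Pi_pmf C {} (\<lambda>_. unif_sets P K)) {S. \<forall>w\<in>T - {v}. S w \<inter> S (f w) \<noteq> {}} =
     measure_pmf.prob (Pi_pmf T {} (\<lambda>_. unif_sets P K)) {S. \<forall>w\<in>T - {v}. S w \<inter> S (f w) \<noteq> {}}"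
  proof (rule prob_Pi_pmf_marginal[OF assms(2,3)])
    fix S S' :: "'a \<Rightarrow> nat set" assume "\<And>i. i \<in> T \<Longrightarrow> S i = S' i"
    then show "(\<forall>u\<in>T - {v}. S u \<inter> S (f u) \<noteq> {}) = (\<forall>u\<in>T - {v}. S' u \<inter> S' (f u) \<noteq> {})"
      using rooted_tree_closed[OF assms(1)] by simp
  qed
  ultimately show ?thesis by simp
qed

lemma prob_not_disjoint_le:
  assumes "finite R" "K \<le> P" "1 \<le> P"
  shows "measure_pmf.prob (Pi_pmf R {} (\<lambda>_. unif_sets P K)) {S. \<not> disjoint_family_on S R} \<le>
    (real (card R))\<^sup>2 * ((real K)\<^sup>2 / real P)"
proof -
  let ?M = "Pi_pmf R {} (\<lambda>_. unif_sets P K)"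
  let ?Z = "{z \<in> R \<times> R. fst z \<noteq> snd z}"
  have "measure_pmf.prob ?M {S. \<not> disjoint_family_on S R} \<le> measure_pmf.prob ?M (\<Union>z\<in>?Z. {S. S (snd z) \<inter> S (fst z) \<noteq> {}})"
  proof (intro measure_pmf.finite_measure_mono subsetI)
    fix S assume "S \<in> {S. \<not> disjoint_family_on S R}"
    then obtain i j where "i \<in> R" "j \<in> R" "i \<noteq> j" "S j \<inter> S i \<noteq> {}"
      unfolding disjoint_family_on_def by blast
    then show "S \<in> (\<Union>z\<in>?Z. {S. S (snd z) \<inter> S (fst z) \<noteq> {}})" by (intro UN_I[of "(i, j)"]) auto
  qed simp
  also have "\<dots> \<le> (\<Sum>z\<in>?Z. measure_pmf.prob ?M {S. S (snd z) \<inter> S (fst z) \<noteq> {}})"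
    using assms(1) by (intro measure_pmf.finite_measure_subadditive_finite) auto
  also have "\<dots> \<le> (\<Sum>z\<in>?Z. (real K)\<^sup>2 / real P)"
  proof (rule sum_mono)
    fix z assume "z \<in> ?Z"
    then obtain i j where z: "z = (i, j)" "i \<in> R" "j \<in> R" "i \<noteq> j" by auto
    \<comment> \<open>A single edge is a tree with two nodes.\<close>
    have "rooted_tree (\<lambda>_. i) i (insert j {i})"
      using z by (intro rooted_tree.grow rooted_tree.root) auto
    from prob_rooted_tree_le[OF this assms(1) _ assms(2,3)]
    have "measure_pmf.prob ?M {S. \<forall>w\<in>{j, i} - {i}. S w \<inter> S i \<noteq> {}} \<le> ((real K)\<^sup>2 / real P) ^ (card {j, i} - 1)"
      using z by simp
    moreover have "{j, i} - {i} = {j}" "card {j, i} - 1 = 1" using z by auto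
    ultimately show "measure_pmf.prob ?M {S. S (snd z) \<inter> S (fst z) \<noteq> {}} \<le> (real K)\<^sup>2 / real P"
      using z by simp
  qed
  also have "\<dots> = real (card ?Z) * ((real K)\<^sup>2 / real P)" by simp
  also have "\<dots> \<le> (real (card R))\<^sup>2 * ((real K)\<^sup>2 / real P)"
  proof (rule mult_right_mono)
    have "card ?Z \<le> card (R \<times> R)" using assms(1) by (intro card_mono) auto
    then show "real (card ?Z) \<le> (real (card R))\<^sup>2"
      by (simp add: card_cartesian_product power2_eq_square flip: of_nat_mult)
  qed simp
  finally show ?thesis .
qed

section \<open>Prescribed neighbourhoods of a fixed group of nodes\<close>

lemma prod_dichotomy:
  fixes a b :: "'c::comm_monoid_mult"
  assumes "finite B" "M \<subseteq> B"
  shows "(\<Prod>j\<in>B. if j \<in> M then a else b) = a ^ card M * b ^ (card B - card M)"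
proof -
  have "(\<Prod>j\<in>B. if j \<in> M then a else b) = (\<Prod>j\<in>B \<inter> {j. j \<in> M}. a) * (\<Prod>j\<in>B \<inter> - {j. j \<in> M}. b)"
    using assms(1) by (rule prod.If_cases)
  also have "B \<inter> {j. j \<in> M} = M" using assms(2) by auto
  also have "B \<inter> - {j. j \<in> M} = B - M" by auto
  also have "card (B - M) = card B - card M" using assms finite_subset by (intro card_Diff_subset) auto
  then have "(\<Prod>j\<in>B - M. b) = b ^ (card B - card M)" by simp
  finally show ?thesis by simp
qed

text \<open>Such a family is determined by its union, at most \<open>n ^ m\<close> choices, and for
  each element of the union by the members of \<open>R\<close> whose sets contain it. The factor
  \<open>2 ^ card R\<close> per element is harmless because \<open>R\<close> has bounded
  size.\<close>

lemma card_families_with_union_le: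
  assumes "finite B" "finite R" "card B \<le> n"
  shows "card {J \<in> R \<rightarrow>\<^sub>E Pow B. card (\<Union>(J ` R)) = m} \<le> (2 ^ card R * n) ^ m"
proof -
  let ?Ms = "{M. M \<subseteq> B \<and> card M = m}"
  have finM: "finite ?Ms" using assms(1) by (intro finite_subset[of ?Ms "Pow B"]) auto
  have "{J \<in> R \<rightarrow>\<^sub>E Pow B. card (\<Union>(J ` R)) = m} \<subseteq> (\<Union>M\<in>?Ms. R \<rightarrow>\<^sub>E Pow M)"
  proof
    fix J assume J: "J \<in> {J \<in> R \<rightarrow>\<^sub>E Pow B. card (\<Union>(J ` R)) = m}"
    then have "\<Union>(J ` R) \<in> ?Ms" by auto
    moreover have "J \<in> R \<rightarrow>\<^sub>E Pow (\<Union>(J ` R))" using J by (auto simp: PiE_def)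
    ultimately show "J \<in> (\<Union>M\<in>?Ms. R \<rightarrow>\<^sub>E Pow M)" by blast
  qed
  then have "card {J \<in> R \<rightarrow>\<^sub>E Pow B. card (\<Union>(J ` R)) = m} \<le> card (\<Union>M\<in>?Ms. R \<rightarrow>\<^sub>E Pow M)"
    using finM assms(1,2) by (intro card_mono finite_UN_I finite_PiE) (auto intro: finite_subset)
  also have "\<dots> \<le> (\<Sum>M\<in>?Ms. card (R \<rightarrow>\<^sub>E Pow M))" by (rule card_UN_le[OF finM])
  also have "\<dots> = (\<Sum>M\<in>?Ms. (2 ^ m) ^ card R)"
    using assms by (intro sum.cong refl) (auto simp: card_PiE card_Pow finite_subset)
  also have "\<dots> = (card B choose m) * (2 ^ m) ^ card R" using assms(1) by (simp add: n_subsets)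
  also have "\<dots> \<le> n ^ m * (2 ^ m) ^ card R"
  proof (rule mult_le_mono1)
    show "card B choose m \<le> n ^ m"
    proof (cases "m \<le> card B")
      case True
      then have "card B choose m \<le> card B ^ m" by (rule binomial_le_pow)
      also have "\<dots> \<le> n ^ m" using assms(3) by (rule power_mono) simp
      finally show ?thesis .
    qed (simp add: binomial_eq_0)
  qed
  also have "\<dots> = (2 ^ card R * n) ^ m"
    by (simp add: power_mult_distrib power_mult[symmetric] mult.commute)
  finally show ?thesis .
qed

text \<open>
  The object sets that make the node \<open>j\<close> adjacent to exactly those \<open>i \<in> R\<close> with \<open>j \<in> J i\<close>; thus \<open>J i\<close>
  prescribes the neighbours of \<open>i\<close> outside \<open>R\<close>.
\<close>

definition attach :: "nat set \<Rightarrow> (nat \<Rightarrow> nat set) \<Rightarrow> nat \<Rightarrow> (nat \<Rightarrow> nat set) \<Rightarrow> nat set set" where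
  "attach R J j S = {B. {i \<in> R. S i \<inter> B \<noteq> {}} = {i \<in> R. j \<in> J i}}"

lemma attach_cong:
  assumes "\<And>i. i \<in> R \<Longrightarrow> S i = S' i"
  shows "attach R J j S = attach R J j S'"
proof -
  have "{i \<in> R. S i \<inter> B \<noteq> {}} = {i \<in> R. S' i \<inter> B \<noteq> {}}" for B using assms by auto
  then show ?thesis by (simp add: attach_def)
qed

text \<open>A node with a prescribed neighbour is only required to hit one of the sets. All other
  nodes must avoid the whole union, and they account for the exponential.\<close>

lemma prob_attach_product_le:
  assumes R: "finite R" and B: "finite B" and KP: "K \<le> P" "1 \<le> P"
    and S: "S \<in> set_pmf (Pi_pmf R {} (\<lambda>_. unif_sets P K))" and J: "J \<in> R \<rightarrow>\<^sub>E Pow B"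
  shows "(\<Prod>j\<in>B. measure_pmf.prob (unif_sets P K) (attach R J j S)) \<le>
    ((real K)\<^sup>2 / real P) ^ card (\<Union>(J ` R)) *
    exp (- (real (card (\<Union>(S ` R))) * real K / real P)) ^ (card B - card (\<Union>(J ` R)))"
proof -
  let ?M = "\<Union>(J ` R)" and ?U = "\<Union>(S ` R)"
  have M: "?M \<subseteq> B" using J by auto
  have "(\<Prod>j\<in>B. measure_pmf.prob (unif_sets P K) (attach R J j S)) \<le>
      (\<Prod>j\<in>B. if j \<in> ?M then (real K)\<^sup>2 / real P else exp (- (real (card ?U) * real K / real P)))"
  proof (rule prod_mono, rule conjI)
    fix j assume "j \<in> B"
    show "measure_pmf.prob (unif_sets P K) (attach R J j S) \<le>
       (if j \<in> ?M then (real K)\<^sup>2 / real P else exp (- (real (card ?U) * real K / real P)))"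
    proof (cases "j \<in> ?M")
      case True
      then obtain i where i: "i \<in> R" "j \<in> J i" by auto
      note Si = set_Pi_unif_sets[OF S R KP(1) i(1)]
      have "measure_pmf.prob (unif_sets P K) (attach R J j S) \<le> measure_pmf.prob (unif_sets P K) {A. A \<inter> S i \<noteq> {}}"
        using i by (intro measure_pmf.finite_measure_mono) (auto simp: attach_def)
      also have "\<dots> \<le> real (card (S i)) * real K / real P" by (rule prob_unif_sets_hit_le[OF KP Si(3)])
      finally show ?thesis using True Si(2) by (simp add: power2_eq_square)
    next
      case False
      then have "attach R J j S \<subseteq> {A. A \<inter> ?U = {}}" by (fastforce simp: attach_def)
      then have "measure_pmf.prob (unif_sets P K) (attach R J j S) \<le> measure_pmf.prob (unif_sets P K) {A. A \<inter> ?U = {}}"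
        by (intro measure_pmf.finite_measure_mono) auto
      also have "\<dots> \<le> exp (- (real (card ?U) * real K / real P))"
        by (rule prob_unif_sets_disjoint_le[OF KP Union_Pi_unif_sets(1)[OF S R KP(1)]])
      finally show ?thesis using False by simp
    qed
  qed simp
  also have "\<dots> = ((real K)\<^sup>2 / real P) ^ card ?M * exp (- (real (card ?U) * real K / real P)) ^ (card B - card ?M)"
    by (rule prod_dichotomy[OF B M])
  finally show ?thesis .
qed

text \<open>The event is split according to the neighbourhoods \<open>J i\<close> outside
  \<open>R\<close>; edges inside \<open>R\<close> are ignored, which only enlarges it. Enough nodes
  remain that must avoid the union of the object sets, so what is left is an exponential moment of
  the size of this union.\<close>

lemma low_degree_prob_le_families:
  assumes R: "R \<subseteq> {1..n}" and KP: "K \<le> P" "1 \<le> P" and k: "1 \<le> k" and n: "card R * k \<le> n"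
  shows "measure_pmf.prob (unif_model n P K) {S. R \<subseteq> low_degree n k S} \<le>
    (\<Sum>J\<in>R \<rightarrow>\<^sub>E {J. J \<subseteq> {1..n} - R \<and> card J < k}. ((real K)\<^sup>2 / real P) ^ card (\<Union>(J ` R))) *
    measure_pmf.expectation (Pi_pmf R {} (\<lambda>_. unif_sets P K))
      (\<lambda>S. exp (- (real K * (real n - real (card R * k)) / real P) * real (card (\<Union>(S ` R)))))"
proof -
  define B where "B = {1..n} - R"
  define \<theta> where "\<theta> = real K * (real n - real (card R * k)) / real P"
  define M where "M = Pi_pmf R {} (\<lambda>_. unif_sets P K)"
  define \<J> where "\<J> = R \<rightarrow>\<^sub>E {J. J \<subseteq> B \<and> card J < k}"
  have fin: "finite R" "finite B" using finite_subset[OF R] by (simp_all add: B_def)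
  have RB: "{1..n} = R \<union> B" "R \<inter> B = {}" using R by (auto simp: B_def)
  have cardB: "card B = n - card R" using R fin(1) unfolding B_def by (simp add: card_Diff_subset)
  have "finite {J. J \<subseteq> B \<and> card J < k}" by (rule finite_subset[of _ "Pow B"]) (use fin(2) in auto)
  then have fin\<J>: "finite \<J>" using fin(1) by (auto simp: \<J>_def intro!: finite_PiE)
  have J_Pow: "J \<in> R \<rightarrow>\<^sub>E Pow B" if "J \<in> \<J>" for J using that by (auto simp: \<J>_def PiE_def Pi_def)
  have "measure_pmf.prob (unif_model n P K) {S. R \<subseteq> low_degree n k S} \<le>
     measure_pmf.prob (unif_model n P K) (\<Union>J\<in>\<J>. {S. True \<and> (\<forall>j\<in>B. S j \<in> attach R J j S)})"
  proof (intro measure_pmf.finite_measure_mono subsetI)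
    fix S :: "nat \<Rightarrow> nat set" assume S: "S \<in> {S. R \<subseteq> low_degree n k S}"
    define J where "J = restrict (\<lambda>i. nbrs n S i \<inter> B) R"
    have "card (nbrs n S i \<inter> B) < k" if "i \<in> R" for i
    proof -
      have "card (nbrs n S i \<inter> B) \<le> card (nbrs n S i)" by (intro card_mono) auto
      then show ?thesis using S that by (force simp: low_degree_def)
    qed
    then have "J \<in> \<J>" by (auto simp: J_def \<J>_def)
    moreover have "S j \<in> attach R J j S" if "j \<in> B" for j
      using that RB by (auto simp: attach_def J_def nbrs_def)
    ultimately show "S \<in> (\<Union>J\<in>\<J>. {S. True \<and> (\<forall>j\<in>B. S j \<in> attach R J j S)})" by auto
  qed simp
  also have "\<dots> \<le> (\<Sum>J\<in>\<J>. measure_pmf.prob (unif_model n P K) {S. True \<and> (\<forall>j\<in>B. S j \<in> attach R J j S)})"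
    by (intro measure_pmf.finite_measure_subadditive_finite fin\<J>) auto
  also have "\<dots> \<le> (\<Sum>J\<in>\<J>. ((real K)\<^sup>2 / real P) ^ card (\<Union>(J ` R)) *
      measure_pmf.expectation M (\<lambda>S. exp (- \<theta> * real (card (\<Union>(S ` R))))))"
  proof (rule sum_mono)
    fix J assume J: "J \<in> \<J>"
    let ?m = "card (\<Union>(J ` R))"
    have "?m \<le> (\<Sum>i\<in>R. card (J i))" by (rule card_UN_le[OF fin(1)])
    also have "\<dots> \<le> (\<Sum>i\<in>R. k - 1)" 
    proof (rule sum_mono)
      fix i assume "i \<in> R"
      then show "card (J i) \<le> k - 1" using PiE_mem[OF J[unfolded \<J>_def]] by fastforce
    qed
    finally have "?m \<le> card R * (k - 1)" by simp
    \<comment> \<open>At most \<open>k - 1\<close> neighbours for each node of \<open>R\<close>,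
      together with the node itself.\<close>
    then have "?m + card R \<le> card R * k" using k by (cases k) auto
    then have m: "real n - real (card R * k) \<le> real (card B - ?m)"
      using n cardB by linarith
    have "measure_pmf.prob (unif_model n P K) {S. True \<and> (\<forall>j\<in>B. S j \<in> attach R J j S)} =
      measure_pmf.expectation M (\<lambda>S. indicator {S. True} S * (\<Prod>j\<in>B. measure_pmf.prob (unif_sets P K) (attach R J j S)))"
      unfolding unif_model_def RB(1) M_def 
      by (rule prob_Pi_pmf_split[OF fin RB(2) refl attach_cong])
    also have "\<dots> \<le> measure_pmf.expectation M (\<lambda>S. ((real K)\<^sup>2 / real P) ^ ?m * exp (- \<theta> * real (card (\<Union>(S ` R)))))"
    proof (rule integral_mono_AE)
      show "AE S in measure_pmf M. indicator {S. True} S * (\<Prod>j\<in>B. measure_pmf.prob (unif_sets P K) (attach R J j S))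
         \<le> ((real K)\<^sup>2 / real P) ^ ?m * exp (- \<theta> * real (card (\<Union>(S ` R))))"
        unfolding AE_measure_pmf_iff
      proof
        fix S assume S: "S \<in> set_pmf M"
        let ?U = "\<Union>(S ` R)"
        have "(\<Prod>j\<in>B. measure_pmf.prob (unif_sets P K) (attach R J j S)) \<le>
            ((real K)\<^sup>2 / real P) ^ ?m * exp (- (real (card ?U) * real K / real P)) ^ (card B - ?m)"
          by (rule prob_attach_product_le[OF fin KP S[unfolded M_def] J_Pow[OF J]])
        also have "exp (- (real (card ?U) * real K / real P)) ^ (card B - ?m) =
            exp (- ((real (card ?U) * real K / real P) * real (card B - ?m)))"
          by (simp add: exp_of_nat_mult[symmetric] mult.commute)
        also have "\<dots> \<le> exp (- ((real (card ?U) * real K / real P) * (real n - real (card R * k))))"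
          using m by (intro exp_le_cancel_iff[THEN iffD2] le_imp_neg_le mult_left_mono) auto
        also have "\<dots> = exp (- \<theta> * real (card ?U))" by (simp add: \<theta>_def mult_ac)
        finally show "indicator {S. True} S * (\<Prod>j\<in>B. measure_pmf.prob (unif_sets P K) (attach R J j S))
         \<le> ((real K)\<^sup>2 / real P) ^ ?m * exp (- \<theta> * real (card (\<Union>(S ` R))))"
          by (simp add: mult_left_mono)
      qed
    qed (use finite_set_Pi_unif_sets[OF fin(1) KP(1)] in \<open>auto simp: M_def intro!: integrable_measure_pmf_finite\<close>)
    finally show "measure_pmf.prob (unif_model n P K) {S. True \<and> (\<forall>j\<in>B. S j \<in> attach R J j S)} \<le>
      ((real K)\<^sup>2 / real P) ^ ?m * measure_pmf.expectation M (\<lambda>S. exp (- \<theta> * real (card (\<Union>(S ` R)))))"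
      by simp
  qed
  finally show ?thesis by (simp add: sum_distrib_right \<J>_def B_def \<theta>_def M_def)
qed

lemma binomial_mono_left: "a \<le> b \<Longrightarrow> a choose c \<le> b choose c"
  by (rule lift_Suc_mono_le[of "\<lambda>n. n choose c"]) (cases c; simp)

text \<open>The main term comes from families of sets of size \<open>k - 1\<close> with a union of
  full size, that is, pairwise disjoint sets. Any other family has a smaller union and contributes a
  lower power of \<open>n * x\<close>, the expected degree.\<close>

lemma sum_families_le:
  assumes R: "finite R" and B: "finite B" "card B \<le> n" and k: "1 \<le> k" and x: "0 \<le> (x::real)"
  shows "(\<Sum>J\<in>R \<rightarrow>\<^sub>E {J. J \<subseteq> B \<and> card J < k}. x ^ card (\<Union>(J ` R))) \<le>
    (real (n choose (k - 1)) * x ^ (k - 1)) ^ card R + (\<Sum>m<card R * (k - 1). (2 ^ card R * real n * x) ^ m)"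
proof -
  define \<J> where "\<J> = R \<rightarrow>\<^sub>E {J. J \<subseteq> B \<and> card J < k}"
  define t where "t = card R * (k - 1)"
  define \<F> where "\<F> m = {J \<in> R \<rightarrow>\<^sub>E Pow B. card (\<Union>(J ` R)) = m}" for m
  define \<G> where "\<G> = R \<rightarrow>\<^sub>E {J. J \<subseteq> B \<and> card J = k - 1}"
  have fin\<F>: "finite (\<F> m)" for m
    unfolding \<F>_def by (rule finite_subset[of _ "R \<rightarrow>\<^sub>E Pow B"]) (use R B in \<open>auto intro!: finite_PiE\<close>)
  have finc: "finite {J. J \<subseteq> B \<and> card J = k - 1}" by (rule finite_subset[of _ "Pow B"]) (use B(1) in auto)
  then have fin\<G>: "finite \<G>" unfolding \<G>_def using R by (intro finite_PiE) auto
  have sub: "\<J> \<subseteq> \<G> \<union> (\<Union>m<t. \<F> m)"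
  proof
    fix J assume J: "J \<in> \<J>"
    then have Ji: "J i \<subseteq> B" "card (J i) \<le> k - 1" if "i \<in> R" for i
      using PiE_mem[OF J[unfolded \<J>_def] that] by auto
    have le: "card (\<Union>(J ` R)) \<le> (\<Sum>i\<in>R. card (J i))" by (rule card_UN_le[OF R])
    show "J \<in> \<G> \<union> (\<Union>m<t. \<F> m)"
    proof (cases "\<forall>i\<in>R. card (J i) = k - 1")
      case True
      then have "J \<in> \<G>" using J by (auto simp: \<J>_def \<G>_def PiE_def Pi_def)
      then show ?thesis by simp
    next
      case False
      then obtain i where i: "i \<in> R" "card (J i) < k - 1" using Ji(2) by (meson le_neq_implies_less)
      have "(\<Sum>i\<in>R. card (J i)) < (\<Sum>i\<in>R. k - 1)"
        by (rule sum_strict_mono_ex1[OF R]) (use i Ji(2) in auto)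
      then have "card (\<Union>(J ` R)) < t" using le by (simp add: t_def)
      moreover have "J \<in> R \<rightarrow>\<^sub>E Pow B" using J by (auto simp: \<J>_def PiE_def Pi_def)
      ultimately show ?thesis by (auto simp: \<F>_def)
    qed
  qed
  define \<G>' where "\<G>' = {J \<in> \<G>. card (\<Union>(J ` R)) = t}"
  have sub': "\<J> \<subseteq> \<G>' \<union> (\<Union>m<t. \<F> m)"
  proof
    fix J assume J: "J \<in> \<J>"
    show "J \<in> \<G>' \<union> (\<Union>m<t. \<F> m)"
    proof (cases "J \<in> \<G>")
      case True
      have "card (\<Union>(J ` R)) \<le> (\<Sum>i\<in>R. card (J i))" by (rule card_UN_le[OF R])
      also have "\<dots> = t" using True by (simp add: \<G>_def t_def PiE_def Pi_def)
      finally have "card (\<Union>(J ` R)) \<le> t" .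
      moreover have "J \<in> R \<rightarrow>\<^sub>E Pow B" using True by (auto simp: \<G>_def PiE_def Pi_def)
      ultimately show ?thesis using True by (auto simp: \<G>'_def \<F>_def le_less)
    next
      case False
      then show ?thesis using sub J by auto
    qed
  qed
  have "(\<Sum>J\<in>\<J>. x ^ card (\<Union>(J ` R))) \<le> (\<Sum>J\<in>\<G>' \<union> (\<Union>m<t. \<F> m). x ^ card (\<Union>(J ` R)))"
    using sub' fin\<F> fin\<G> x by (intro sum_mono2) (auto simp: \<G>'_def)
  also have "\<dots> \<le> (\<Sum>J\<in>\<G>'. x ^ card (\<Union>(J ` R))) + (\<Sum>J\<in>(\<Union>m<t. \<F> m). x ^ card (\<Union>(J ` R)))"
    using fin\<F> fin\<G> x by (subst sum.union_inter[symmetric]) (auto simp: \<G>'_def intro!: sum_nonneg)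
  also have "(\<Sum>J\<in>\<G>'. x ^ card (\<Union>(J ` R))) \<le> (real (n choose (k - 1)) * x ^ (k - 1)) ^ card R"
  proof -
    have "(\<Sum>J\<in>\<G>'. x ^ card (\<Union>(J ` R))) = real (card \<G>') * x ^ t" by (simp add: \<G>'_def)
    also have "\<dots> \<le> real (card \<G>) * x ^ t"
      using x fin\<G> by (intro mult_right_mono of_nat_mono card_mono) (auto simp: \<G>'_def)
    also have "card \<G> = (card B choose (k - 1)) ^ card R"
      using R B(1) by (simp add: \<G>_def card_PiE n_subsets)
    also have "real ((card B choose (k - 1)) ^ card R) * x ^ t \<le> real ((n choose (k - 1)) ^ card R) * x ^ t"
      using x B(2) by (intro mult_right_mono of_nat_mono power_mono binomial_mono_left) auto
    also have "\<dots> = (real (n choose (k - 1)) * x ^ (k - 1)) ^ card R"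
      by (simp add: t_def power_mult_distrib power_mult[symmetric] mult.commute)
    finally show ?thesis .
  qed
  also have "(\<Sum>J\<in>(\<Union>m<t. \<F> m). x ^ card (\<Union>(J ` R))) = (\<Sum>m<t. \<Sum>J\<in>\<F> m. x ^ card (\<Union>(J ` R)))"
    using fin\<F> by (intro sum.UNION_disjoint) (auto simp: \<F>_def)
  also have "\<dots> \<le> (\<Sum>m<t. (2 ^ card R * real n * x) ^ m)"
  proof (rule sum_mono)
    fix m
    have "(\<Sum>J\<in>\<F> m. x ^ card (\<Union>(J ` R))) = real (card (\<F> m)) * x ^ m" by (simp add: \<F>_def)
    also have "\<dots> \<le> real ((2 ^ card R * n) ^ m) * x ^ m"
      unfolding \<F>_def using x card_families_with_union_le[OF B(1) R B(2)] by (intro mult_right_mono of_nat_mono) auto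
    also have "\<dots> = (2 ^ card R * real n * x) ^ m" by (simp add: power_mult_distrib)
    finally show "(\<Sum>J\<in>\<F> m. x ^ card (\<Union>(J ` R))) \<le> (2 ^ card R * real n * x) ^ m" .
  qed
  finally show ?thesis by (simp add: \<J>_def t_def)
qed

text \<open>The decay rate \<open>\<theta>\<close> per object is kept exactly in the main exponent;
  only in the overlap term, which will be negligible, it is replaced by the larger
  \<open>K * n / P\<close>.\<close>

lemma low_degree_prob_le:
  fixes x :: real
  assumes R: "R \<subseteq> {1..n}" "card R = r" and KP: "K \<le> P" "1 \<le> P" and k: "1 \<le> k" and n: "r * k \<le> n"
  defines "x \<equiv> (real K)\<^sup>2 / real P"
  shows "measure_pmf.prob (unif_model n P K) {S. R \<subseteq> low_degree n k S} \<le>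
    ((real (n choose (k - 1)) * x ^ (k - 1)) ^ r + (\<Sum>m<r * (k - 1). (2 ^ r * real n * x) ^ m)) *
    exp (real r * (real r * exp (real K * real n / real P) * x - x * (real n - real (r * k))))"
proof -
  define \<theta> where "\<theta> = real K * (real n - real (r * k)) / real P"
  have fin: "finite R" using R(1) finite_subset by blast
  have \<theta>0: "0 \<le> \<theta>" unfolding \<theta>_def using n by (intro divide_nonneg_nonneg mult_nonneg_nonneg) (auto simp flip: of_nat_mult)
  have \<theta>1: "\<theta> \<le> real K * real n / real P"
    unfolding \<theta>_def by (intro divide_right_mono mult_left_mono) auto
  have \<theta>K: "\<theta> * real K = x * (real n - real (r * k))"
    by (simp add: \<theta>_def x_def power2_eq_square)
  have x0: "0 \<le> x" by (simp add: x_def)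
  have cardB: "card ({1..n} - R) \<le> n" using card_mono[of "{1..n}" "{1..n} - R"] by simp
  have "measure_pmf.prob (unif_model n P K) {S. R \<subseteq> low_degree n k S} \<le>
    (\<Sum>J\<in>R \<rightarrow>\<^sub>E {J. J \<subseteq> {1..n} - R \<and> card J < k}. x ^ card (\<Union>(J ` R))) *
    measure_pmf.expectation (Pi_pmf R {} (\<lambda>_. unif_sets P K)) (\<lambda>S. exp (- \<theta> * real (card (\<Union>(S ` R)))))"
    using low_degree_prob_le_families[OF R(1) KP k] n unfolding R(2) \<theta>_def x_def by blast
  also have "\<dots> \<le> ((real (n choose (k - 1)) * x ^ (k - 1)) ^ r + (\<Sum>m<r * (k - 1). (2 ^ r * real n * x) ^ m)) *
      exp (real r * (real r * exp \<theta> * x - \<theta> * real K))"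
  proof (rule mult_mono)
    show "(\<Sum>J\<in>R \<rightarrow>\<^sub>E {J. J \<subseteq> {1..n} - R \<and> card J < k}. x ^ card (\<Union>(J ` R))) \<le>
       (real (n choose (k - 1)) * x ^ (k - 1)) ^ r + (\<Sum>m<r * (k - 1). (2 ^ r * real n * x) ^ m)"
      using sum_families_le[OF fin _ cardB k x0] R(2) by simp
    show "measure_pmf.expectation (Pi_pmf R {} (\<lambda>_. unif_sets P K)) (\<lambda>S. exp (- \<theta> * real (card (\<Union>(S ` R))))) \<le>
      exp (real r * (real r * exp \<theta> * x - \<theta> * real K))"
      using expectation_exp_neg_card_Union_le[OF fin KP \<theta>0, of r] R(2) by (simp add: x_def)
  qed (use x0 in \<open>auto intro!: add_nonneg_nonneg sum_nonneg integral_nonneg\<close>)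
  also have "\<dots> \<le> ((real (n choose (k - 1)) * x ^ (k - 1)) ^ r + (\<Sum>m<r * (k - 1). (2 ^ r * real n * x) ^ m)) *
      exp (real r * (real r * exp (real K * real n / real P) * x - x * (real n - real (r * k))))"
    unfolding \<theta>K using \<theta>1 x0
    by (intro mult_left_mono exp_le_cancel_iff[THEN iffD2] diff_right_mono mult_right_mono)
      (auto intro!: add_nonneg_nonneg sum_nonneg)
  finally show ?thesis .
qed

section \<open>Lower bound for small degrees of a fixed group of nodes\<close>

lemma one_minus_exp_neg_ge:
  fixes x :: real
  assumes "0 \<le> x"
  shows "x - x\<^sup>2 \<le> 1 - exp (- x)"
proof -
  have "(1 - x + x\<^sup>2) * (1 + x) = 1 + x ^ 3" by (simp add: algebra_simps power2_eq_square power3_eq_cube)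
  then have "1 \<le> (1 - x + x\<^sup>2) * (1 + x)" using assms by simp
  moreover have "0 \<le> 1 - x + x\<^sup>2"
    using zero_le_power2[of "x - 1 / 2"] by (simp add: power2_eq_square algebra_simps)
  then have "(1 - x + x\<^sup>2) * (1 + x) \<le> (1 - x + x\<^sup>2) * exp x"
    by (intro mult_left_mono exp_ge_add_one_self)
  ultimately have "1 \<le> (1 - x + x\<^sup>2) * exp x" by linarith
  then have "exp (- x) \<le> 1 - x + x\<^sup>2" by (simp add: exp_minus field_simps)
  then show ?thesis by simp
qed

lemma disjoint_family_if_card_Union:
  assumes "finite R" "\<And>i. i \<in> R \<Longrightarrow> finite (J i)" "\<And>i. i \<in> R \<Longrightarrow> card (J i) = c"
    and "card (\<Union>(J ` R)) = card R * c"
  shows "disjoint_family_on J R"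
proof (rule ccontr)
  assume "\<not> disjoint_family_on J R"
  then obtain i i' j where i: "i \<in> R" "i' \<in> R" "i \<noteq> i'" "j \<in> J i" "j \<in> J i'"
    unfolding disjoint_family_on_def by blast
  have "\<Union>(J ` R) \<subseteq> (J i - {j}) \<union> \<Union>(J ` (R - {i}))" using i by auto
  then have "card (\<Union>(J ` R)) \<le> card ((J i - {j}) \<union> \<Union>(J ` (R - {i})))"
    using assms(1,2) i(1) by (intro card_mono) auto
  also have "\<dots> \<le> card (J i - {j}) + card (\<Union>(J ` (R - {i})))" by (rule card_Un_le)
  also have "card (\<Union>(J ` (R - {i}))) \<le> (\<Sum>l\<in>R - {i}. card (J l))" using assms(1) by (intro card_UN_le) auto
  also have "\<dots> = (card R - 1) * c" using assms(1,3) i(1) by simp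
  also have "card (J i - {j}) = c - 1" using assms(2,3) i by simp
  finally have "card R * c \<le> (c - 1) + (card R - 1) * c" using assms(4) by simp
  moreover have "0 < c" using assms(2,3) i by (metis card_gt_0_iff empty_iff)
  moreover have "0 < card R" using assms(1) i(1) by (auto simp: card_gt_0_iff)
  ultimately show False by (cases "card R"; cases c) auto
qed

text \<open>Hitting \<open>S i\<close> has probability at least x - x^2, with x = K^2 / P. Hitting
  another of the disjoint sets as well requires two distinct objects and costs only a multiple of
  x^2.\<close>

lemma prob_hit_one_only_ge:
  assumes R: "finite R" and KP: "K \<le> P" "1 \<le> P"
    and S: "S \<in> set_pmf (Pi_pmf R {} (\<lambda>_. unif_sets P K))" and disj: "disjoint_family_on S R" and i: "i \<in> R"
  shows "(real K)\<^sup>2 / real P - (real (card R) + 1) * ((real K)\<^sup>2 / real P)\<^sup>2 \<le>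
    measure_pmf.prob (unif_sets P K) {B. {l \<in> R. S l \<inter> B \<noteq> {}} = {i}}"
proof -
  define x where "x = (real K)\<^sup>2 / real P"
  define V where "V = \<Union>(S ` (R - {i}))"
  note Sl = set_Pi_unif_sets[OF S R KP(1)]
  have finV: "finite V" using Sl(3) R by (auto simp: V_def)
  have "card V \<le> (\<Sum>l\<in>R - {i}. card (S l))" unfolding V_def using R by (intro card_UN_le) auto
  also have "\<dots> = (card R - 1) * K" using Sl(2) i R by simp
  also have "\<dots> \<le> card R * K" by simp
  finally have cardV: "real (card V) \<le> real (card R) * real K" by (metis of_nat_le_iff of_nat_mult)
  have SV: "S i \<inter> V = {}" using disj i by (auto simp: V_def disjoint_family_on_def)
  let ?H = "{A. A \<inter> S i \<noteq> {}}" and ?B = "{A. A \<inter> S i \<noteq> {} \<and> A \<inter> V \<noteq> {}}"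
  have "measure_pmf.prob (unif_sets P K) {A. A \<inter> S i = {}} \<le> exp (- x)"
    using prob_unif_sets_disjoint_le[OF KP Sl(1)[OF i]] Sl(2)[OF i] by (simp add: x_def power2_eq_square)
  moreover have "?H = UNIV - {A. A \<inter> S i = {}}" by auto
  then have "measure_pmf.prob (unif_sets P K) ?H = 1 - measure_pmf.prob (unif_sets P K) {A. A \<inter> S i = {}}"
    by (metis measure_pmf.prob_compl sets_measure_pmf space_measure_pmf UNIV_I)
  ultimately have "x - x\<^sup>2 \<le> measure_pmf.prob (unif_sets P K) ?H"
    using one_minus_exp_neg_ge[of x] by (simp add: x_def)
  also have "\<dots> \<le> measure_pmf.prob (unif_sets P K) ({B. {l \<in> R. S l \<inter> B \<noteq> {}} = {i}} \<union> ?B)"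
  proof (intro measure_pmf.finite_measure_mono subsetI)
    fix A assume A: "A \<in> ?H"
    show "A \<in> {B. {l \<in> R. S l \<inter> B \<noteq> {}} = {i}} \<union> ?B"
    proof (cases "A \<inter> V = {}")
      case True
      then have "S l \<inter> A = {}" if "l \<in> R" "l \<noteq> i" for l using that by (auto simp: V_def)
      then have "{l \<in> R. S l \<inter> A \<noteq> {}} = {i}" using A i by auto
      then show ?thesis by simp
    qed (use A in simp)
  qed simp
  also have "\<dots> \<le> measure_pmf.prob (unif_sets P K) {B. {l \<in> R. S l \<inter> B \<noteq> {}} = {i}} + measure_pmf.prob (unif_sets P K) ?B"
    by (intro measure_Un_le) auto
  also have "measure_pmf.prob (unif_sets P K) ?B \<le> real (card (S i)) * real (card V) * (real K / real P)\<^sup>2"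
    by (rule prob_unif_sets_hit_both_le[OF KP Sl(3)[OF i] finV SV])
  also have "\<dots> \<le> real K * (real (card R) * real K) * (real K / real P)\<^sup>2"
    using cardV Sl(2)[OF i] by (intro mult_right_mono mult_mono) auto
  also have "\<dots> = real (card R) * x\<^sup>2" by (simp add: x_def power2_eq_square)
  finally show ?thesis by (simp add: x_def[symmetric] algebra_simps)
qed

text \<open>From all families of sets of size \<open>c\<close> those with a smaller union are
  subtracted; their number is of lower order in \<open>n\<close>.\<close>

lemma card_good_families_ge:
  assumes R: "finite R" and B: "finite B" "card B \<le> n"
  shows "real (card B choose c) ^ card R - (\<Sum>m<card R * c. (2 ^ card R * real n) ^ m) \<le>
    real (card {J \<in> R \<rightarrow>\<^sub>E {J. J \<subseteq> B \<and> card J = c}. card (\<Union>(J ` R)) = card R * c})"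
proof -
  define \<G> where "\<G> = R \<rightarrow>\<^sub>E {J. J \<subseteq> B \<and> card J = c}"
  define \<F> where "\<F> m = {J \<in> R \<rightarrow>\<^sub>E Pow B. card (\<Union>(J ` R)) = m}" for m
  define \<G>' where "\<G>' = {J \<in> \<G>. card (\<Union>(J ` R)) = card R * c}"
  have fin\<F>: "finite (\<F> m)" for m
    unfolding \<F>_def by (rule finite_subset[of _ "R \<rightarrow>\<^sub>E Pow B"]) (use R B in \<open>auto intro!: finite_PiE\<close>)
  have finc: "finite {J. J \<subseteq> B \<and> card J = c}" by (rule finite_subset[of _ "Pow B"]) (use B(1) in auto)
  then have fin\<G>: "finite \<G>" unfolding \<G>_def using R by (intro finite_PiE) auto
  have "\<G> \<subseteq> \<G>' \<union> (\<Union>m<card R * c. \<F> m)"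
  proof
    fix J assume J: "J \<in> \<G>"
    have Ji: "J i \<subseteq> B" "card (J i) = c" if "i \<in> R" for i
      using PiE_mem[OF J[unfolded \<G>_def] that] by auto
    have "card (\<Union>(J ` R)) \<le> (\<Sum>i\<in>R. card (J i))" by (rule card_UN_le[OF R])
    also have "\<dots> = card R * c" using Ji by simp
    finally have "card (\<Union>(J ` R)) \<le> card R * c" .
    moreover have "J \<in> R \<rightarrow>\<^sub>E Pow B" using J by (auto simp: \<G>_def PiE_def Pi_def)
    ultimately show "J \<in> \<G>' \<union> (\<Union>m<card R * c. \<F> m)" using J by (auto simp: \<G>'_def \<F>_def le_less)
  qed
  then have "card \<G> \<le> card (\<G>' \<union> (\<Union>m<card R * c. \<F> m))"
    using fin\<F> fin\<G> by (intro card_mono) (auto simp: \<G>'_def)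
  also have "\<dots> \<le> card \<G>' + card (\<Union>m<card R * c. \<F> m)" by (rule card_Un_le)
  also have "card (\<Union>m<card R * c. \<F> m) \<le> (\<Sum>m<card R * c. card (\<F> m))" by (intro card_UN_le) simp
  also have "\<dots> \<le> (\<Sum>m<card R * c. (2 ^ card R * n) ^ m)"
    unfolding \<F>_def using card_families_with_union_le[OF B(1) R B(2)] by (intro sum_mono)
  finally have "card \<G> \<le> card \<G>' + (\<Sum>m<card R * c. (2 ^ card R * n) ^ m)" by simp
  moreover have "card \<G> = (card B choose c) ^ card R"
    using R B(1) by (simp add: \<G>_def card_PiE n_subsets)
  ultimately have "real ((card B choose c) ^ card R) \<le> real (card \<G>' + (\<Sum>m<card R * c. (2 ^ card R * n) ^ m))"
    by (metis of_nat_le_iff)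
  then show ?thesis by (simp add: \<G>'_def \<G>_def)
qed

text \<open>It suffices to count disjoint object sets on \<open>R\<close> together with disjoint
  prescribed neighbourhoods of size exactly \<open>k - 1\<close>. Disjointness rules out edges
  inside \<open>R\<close>, so the prescribed sets are the full neighbourhoods.\<close>

lemma low_degree_prob_ge:
  fixes x :: real
  assumes R: "R \<subseteq> {1..n}" "card R = r" and KP: "(r + 1) * K \<le> P" "K < P" and k: "1 \<le> k"
  defines "x \<equiv> (real K)\<^sup>2 / real P"
  assumes pos: "0 \<le> real ((n - r) choose (k - 1)) ^ r - (\<Sum>m<r * (k - 1). (2 ^ r * real n) ^ m)"
    "(real r + 1) * x \<le> 1"
  shows "(real ((n - r) choose (k - 1)) ^ r - (\<Sum>m<r * (k - 1). (2 ^ r * real n) ^ m)) *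
     ((x - (real r + 1) * x\<^sup>2) ^ (r * (k - 1)) * (1 - real (r * K) / (real P - real K)) ^ (K * n) * (1 - (real r)\<^sup>2 * x)) \<le>
    measure_pmf.prob (unif_model n P K) {S. R \<subseteq> low_degree n k S}"
proof -
  define B where "B = {1..n} - R"
  define M where "M = Pi_pmf R {} (\<lambda>_. unif_sets P K)"
  define t where "t = r * (k - 1)"
  define \<G> where "\<G> = {J \<in> R \<rightarrow>\<^sub>E {J. J \<subseteq> B \<and> card J = k - 1}. card (\<Union>(J ` R)) = card R * (k - 1)}"
  define v0 where "v0 = x - (real r + 1) * x\<^sup>2"
  define u0 where "u0 = (1 - real (r * K) / (real P - real K)) ^ K"
  have KP': "K \<le> P" "1 \<le> P" using KP(2) by auto
  have fin: "finite R" "finite B" using finite_subset[OF R(1)] by (simp_all add: B_def)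
  have RB: "{1..n} = R \<union> B" "R \<inter> B = {}" using R(1) by (auto simp: B_def)
  have cardB: "card B = n - r" using R fin(1) unfolding B_def by (simp add: card_Diff_subset)
  have x0: "0 \<le> x" by (simp add: x_def)
  have v0: "0 \<le> v0"
    using mult_left_mono[OF pos(2) x0] by (simp add: v0_def power2_eq_square algebra_simps)
  have "real (r * K) + real K \<le> real P" using KP(1) by (metis add_mult_distrib mult_1 of_nat_add of_nat_le_iff)
  then have frac: "0 \<le> real (r * K) / (real P - real K)" "real (r * K) / (real P - real K) \<le> 1"
    using KP(2) by (auto simp: divide_simps)
  then have u0: "0 \<le> u0" "u0 \<le> 1" unfolding u0_def by (auto intro: power_le_one)
  have "finite {J. J \<subseteq> B \<and> card J = k - 1}" by (rule finite_subset[of _ "Pow B"]) (use fin(2) in auto)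
  then have "finite (R \<rightarrow>\<^sub>E {J. J \<subseteq> B \<and> card J = k - 1})" using fin(1) by (intro finite_PiE) auto
  then have fin\<G>: "finite \<G>" by (simp add: \<G>_def)
  have Ji: "J i \<subseteq> B" "card (J i) = k - 1" "finite (J i)" if "J \<in> \<G>" "i \<in> R" for J i
  proof -
    have "J i \<in> {J. J \<subseteq> B \<and> card J = k - 1}" using that by (intro PiE_mem[of J R]) (auto simp: \<G>_def)
    then show "J i \<subseteq> B" "card (J i) = k - 1" "finite (J i)" using fin(2) finite_subset by auto
  qed
  have disjJ: "disjoint_family_on J R" if "J \<in> \<G>" for J
    by (rule disjoint_family_if_card_Union[OF fin(1), of J "k - 1"]) (use Ji[OF that] that in \<open>auto simp: \<G>_def\<close>)
  define Ev where "Ev J = {S :: nat \<Rightarrow> nat set. disjoint_family_on S R \<and> (\<forall>j\<in>B. S j \<in> attach R J j S)}" for J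
  \<comment> \<open>The family can be read off from the object sets, so the events of different
    families are disjoint and their probabilities add up exactly.\<close>
  have recover: "J i = {j \<in> B. S i \<inter> S j \<noteq> {}}" if "J \<in> \<G>" "S \<in> Ev J" "i \<in> R" for J S i
    using Ji(1)[OF that(1,3)] that(2,3) by (fastforce simp: Ev_def attach_def)
  have "disjoint_family_on Ev \<G>"
    unfolding disjoint_family_on_def
  proof (intro ballI impI)
    fix J J' assume J: "J \<in> \<G>" "J' \<in> \<G>" "J \<noteq> J'"
    show "Ev J \<inter> Ev J' = {}"
    proof (rule ccontr)
      assume "Ev J \<inter> Ev J' \<noteq> {}"
      then obtain S where S: "S \<in> Ev J" "S \<in> Ev J'" by auto
      have "J = J'"
      proof (rule PiE_ext)
        show "J \<in> R \<rightarrow>\<^sub>E {J. J \<subseteq> B \<and> card J = k - 1}" "J' \<in> R \<rightarrow>\<^sub>E {J. J \<subseteq> B \<and> card J = k - 1}"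
          using J by (auto simp: \<G>_def)
      qed (use recover[OF J(1) S(1)] recover[OF J(2) S(2)] in auto)
      then show False using J(3) by simp
    qed
  qed
  then have "measure_pmf.prob (unif_model n P K) (\<Union>J\<in>\<G>. Ev J) = (\<Sum>J\<in>\<G>. measure_pmf.prob (unif_model n P K) (Ev J))"
    using fin\<G> by (intro measure_pmf.finite_measure_finite_Union) auto
  moreover have "(\<Union>J\<in>\<G>. Ev J) \<subseteq> {S. R \<subseteq> low_degree n k S}"
  proof
    fix S assume "S \<in> (\<Union>J\<in>\<G>. Ev J)"
    then obtain J where J: "J \<in> \<G>" "S \<in> Ev J" by auto
    have "nbrs n S i = J i" if "i \<in> R" for i
    proof -
      have "S i \<inter> S l = {}" if "l \<in> R" "l \<noteq> i" for l
        using J(2) that \<open>i \<in> R\<close> by (auto simp: Ev_def disjoint_family_on_def)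
      then show ?thesis unfolding nbrs_def recover[OF J that] RB(1) using RB(2) that by auto
    qed
    then show "S \<in> {S. R \<subseteq> low_degree n k S}"
      using Ji(2)[OF J(1)] R(1) k by (auto simp: low_degree_def)
  qed
  then have "measure_pmf.prob (unif_model n P K) (\<Union>J\<in>\<G>. Ev J) \<le> measure_pmf.prob (unif_model n P K) {S. R \<subseteq> low_degree n k S}"
    by (intro measure_pmf.finite_measure_mono) auto
  moreover have "(\<Sum>J\<in>\<G>. v0 ^ t * u0 ^ n * (1 - (real r)\<^sup>2 * x)) \<le> (\<Sum>J\<in>\<G>. measure_pmf.prob (unif_model n P K) (Ev J))"
  proof (rule sum_mono)
    fix J assume J: "J \<in> \<G>"
    let ?M = "\<Union>(J ` R)"
    have MB: "?M \<subseteq> B" using Ji(1)[OF J] by auto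
    have "measure_pmf.prob M {S. \<not> disjoint_family_on S R} \<le> (real r)\<^sup>2 * x"
      using prob_not_disjoint_le[OF fin(1) KP'] R(2) by (simp add: M_def x_def)
    moreover have "{S. disjoint_family_on S R} = UNIV - {S :: nat \<Rightarrow> nat set. \<not> disjoint_family_on S R}" by auto
    then have "measure_pmf.prob M {S. disjoint_family_on S R} = 1 - measure_pmf.prob M {S. \<not> disjoint_family_on S R}"
      by (metis measure_pmf.prob_compl sets_measure_pmf space_measure_pmf UNIV_I)
    ultimately have disjM: "1 - (real r)\<^sup>2 * x \<le> measure_pmf.prob M {S. disjoint_family_on S R}" by simp
    have "v0 ^ t * u0 ^ n * (1 - (real r)\<^sup>2 * x) \<le> v0 ^ t * u0 ^ n * measure_pmf.prob M {S. disjoint_family_on S R}"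
      using v0 u0 disjM by (intro mult_left_mono) auto
    also have "\<dots> = measure_pmf.expectation M (\<lambda>S. indicator {S. disjoint_family_on S R} S * (v0 ^ t * u0 ^ n))"
      by simp
    also have "\<dots> \<le> measure_pmf.expectation M (\<lambda>S. indicator {S. disjoint_family_on S R} S *
        (\<Prod>j\<in>B. measure_pmf.prob (unif_sets P K) (attach R J j S)))"
    proof (rule integral_mono_AE)
      show "AE S in measure_pmf M. indicator {S. disjoint_family_on S R} S * (v0 ^ t * u0 ^ n) \<le>
        indicator {S. disjoint_family_on S R} S * (\<Prod>j\<in>B. measure_pmf.prob (unif_sets P K) (attach R J j S))"
        unfolding AE_measure_pmf_iff
      proof
        fix S assume S: "S \<in> set_pmf M"
        note S' = S[unfolded M_def]
        show "indicator {S. disjoint_family_on S R} S * (v0 ^ t * u0 ^ n) \<le>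
          indicator {S. disjoint_family_on S R} S * (\<Prod>j\<in>B. measure_pmf.prob (unif_sets P K) (attach R J j S))"
        proof (cases "disjoint_family_on S R")
          case True
          have cardU: "card (\<Union>(S ` R)) \<le> r * K"
            using Union_Pi_unif_sets(2)[OF S' fin(1) KP'(1)] R(2) by simp
          \<comment> \<open>Fewer than \<open>n\<close> nodes have to avoid the union; the larger
            exponent is a simplification that costs only boundedly many factors near 1.\<close>
          have "v0 ^ t * u0 ^ n \<le> v0 ^ t * u0 ^ (card B - t)"
            using v0 u0 cardB by (intro mult_left_mono power_decreasing) auto
          also have "\<dots> = (\<Prod>j\<in>B. if j \<in> ?M then v0 else u0)"
            using prod_dichotomy[OF fin(2) MB, of v0 u0] J R(2) by (simp add: \<G>_def t_def)
          also have "\<dots> \<le> (\<Prod>j\<in>B. measure_pmf.prob (unif_sets P K) (attach R J j S))"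
          proof (rule prod_mono, rule conjI)
            fix j assume j: "j \<in> B"
            show "0 \<le> (if j \<in> ?M then v0 else u0)" using v0 u0 by simp
            show "(if j \<in> ?M then v0 else u0) \<le> measure_pmf.prob (unif_sets P K) (attach R J j S)"
            proof (cases "j \<in> ?M")
              case jM: True
              then obtain i where i: "i \<in> R" "j \<in> J i" by auto
              have "{l \<in> R. j \<in> J l} = {i}" using disjJ[OF J] i by (auto simp: disjoint_family_on_def)
              then have "attach R J j S = {B. {l \<in> R. S l \<inter> B \<noteq> {}} = {i}}" by (simp add: attach_def)
              then show ?thesis
                using prob_hit_one_only_ge[OF fin(1) KP' S' True i(1)] jM R(2) by (simp add: v0_def x_def)
            next
              case jM: False
              have "attach R J j S = {A. A \<inter> \<Union>(S ` R) = {}}"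
                using jM by (fastforce simp: attach_def)
              moreover have "u0 \<le> (1 - real (card (\<Union>(S ` R))) / (real P - real K)) ^ K"
                unfolding u0_def using of_nat_mono[OF cardU, where 'a = real] KP(2) frac
                by (intro power_mono diff_left_mono divide_right_mono) auto
              moreover have "(1 - real (card (\<Union>(S ` R))) / (real P - real K)) ^ K \<le>
                  measure_pmf.prob (unif_sets P K) {A. A \<inter> \<Union>(S ` R) = {}}"
                using cardU KP Union_Pi_unif_sets(1)[OF S' fin(1) KP'(1)]
                by (intro prob_unif_sets_disjoint_ge) auto
              ultimately show ?thesis using jM by simp
            qed
          qed
          finally show ?thesis using True by simp
        qed simp
      qed
    qed (use finite_set_Pi_unif_sets[OF fin(1) KP'(1)] in \<open>auto simp: M_def intro!: integrable_measure_pmf_finite\<close>)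
    also have "\<dots> = measure_pmf.prob (unif_model n P K) (Ev J)"
      unfolding unif_model_def RB(1) M_def Ev_def
    proof (rule prob_Pi_pmf_split[OF fin RB(2), symmetric])
      fix S S' :: "nat \<Rightarrow> nat set" assume "\<And>i. i \<in> R \<Longrightarrow> S i = S' i"
      then show "disjoint_family_on S R = disjoint_family_on S' R" by (simp add: disjoint_family_on_def)
    qed (rule attach_cong)
    finally show "v0 ^ t * u0 ^ n * (1 - (real r)\<^sup>2 * x) \<le> measure_pmf.prob (unif_model n P K) (Ev J)" .
  qed
  moreover have "(\<Sum>J\<in>\<G>. v0 ^ t * u0 ^ n * (1 - (real r)\<^sup>2 * x)) = real (card \<G>) * (v0 ^ t * u0 ^ n * (1 - (real r)\<^sup>2 * x))"
    by simp
  moreover have "(real ((n - r) choose (k - 1)) ^ r - (\<Sum>m<t. (2 ^ r * real n) ^ m)) * (v0 ^ t * u0 ^ n * (1 - (real r)\<^sup>2 * x)) \<le>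
      measure_pmf.prob (unif_model n P K) {S. R \<subseteq> low_degree n k S}"
  proof (cases "0 \<le> 1 - (real r)\<^sup>2 * x")
    case True
    have "real ((n - r) choose (k - 1)) ^ r - (\<Sum>m<t. (2 ^ r * real n) ^ m) \<le> real (card \<G>)"
      using card_good_families_ge[OF fin, of n "k - 1"] cardB R(2) by (simp add: \<G>_def t_def)
    then have "(real ((n - r) choose (k - 1)) ^ r - (\<Sum>m<t. (2 ^ r * real n) ^ m)) * (v0 ^ t * u0 ^ n * (1 - (real r)\<^sup>2 * x)) \<le>
       real (card \<G>) * (v0 ^ t * u0 ^ n * (1 - (real r)\<^sup>2 * x))"
      using True v0 u0 by (intro mult_right_mono) auto
    with calculation show ?thesis by linarith
  next
    case False
    then have "(real ((n - r) choose (k - 1)) ^ r - (\<Sum>m<t. (2 ^ r * real n) ^ m)) * (v0 ^ t * u0 ^ n * (1 - (real r)\<^sup>2 * x)) \<le> 0"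
      using pos(1) v0 u0 unfolding t_def by (intro mult_nonneg_nonpos) auto
    then show ?thesis using measure_nonneg order_trans by blast
  qed
  ultimately show ?thesis
    by (simp add: v0_def u0_def t_def power_mult)
qed

subsection \<open>Disconnected graphs with large minimum degree\<close>

lemma prob_UN_le:
  assumes "finite I" "\<And>i. i \<in> I \<Longrightarrow> measure_pmf.prob M (A i) \<le> c i"
  shows "measure_pmf.prob M (\<Union>i\<in>I. A i) \<le> sum c I"
proof -
  have "measure_pmf.prob M (\<Union>i\<in>I. A i) \<le> (\<Sum>i\<in>I. measure_pmf.prob M (A i))"
    using assms(1) by (intro measure_pmf.finite_measure_subadditive_finite) auto
  also have "\<dots> \<le> sum c I" using assms(2) by (rule sum_mono)
  finally show ?thesis .
qed

lemma power_le_fact_mult_exp: "real t ^ t \<le> fact t * exp (real t)"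
proof -
  have s: "(\<lambda>j. real t ^ j /\<^sub>R fact j) sums exp (real t)" by (rule exp_converges)
  have "(\<Sum>j\<in>{t}. real t ^ j /\<^sub>R fact j) \<le> (\<Sum>j. real t ^ j /\<^sub>R fact j)"
    using s by (intro sum_le_suminf) (auto simp: sums_iff)
  then show ?thesis using sums_unique[OF s] by (simp add: field_simps)
qed

text \<open>Since t^t is at most t! * e^t, a factor t^t in a union bound over
  \<open>t\<close>-element sets is absorbed at the price of a constant per element. In this form the
  powers of \<open>t\<close> from parent functions and from union sizes disappear.\<close>

lemma binomial_mult_power_le: "real (n choose t) * real t ^ t \<le> (exp 1 * real n) ^ t"
proof -
  have "real (n choose t) * real t ^ t \<le> real (n choose t) * (fact t * exp (real t))"
    by (intro mult_left_mono power_le_fact_mult_exp) simp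
  also have "\<dots> = real ((n choose t) * fact t) * exp (real t)" by simp
  also have "\<dots> \<le> real (n ^ t) * exp (real t)"
    by (intro mult_right_mono of_nat_mono binomial_fact_pow) simp
  also have "\<dots> = (exp 1 * real n) ^ t"
    by (simp add: power_mult_distrib exp_of_nat_mult[symmetric])
  finally show ?thesis .
qed

lemma sum_power_half_le:
  fixes b :: real
  assumes "0 \<le> b" "b \<le> 1 / 2"
  shows "(\<Sum>t\<in>{a..<a + m}. b ^ t) \<le> 2 * b ^ a"
proof -
  have "(\<Sum>t\<in>{a..<a + m}. b ^ t) \<le> 2 * b ^ a - 2 * b ^ (a + m)"
  proof (induction m)
    case (Suc m)
    have "2 * b ^ (a + Suc m) \<le> b ^ (a + m)"
      using mult_right_mono[of "2 * b" 1 "b ^ (a + m)"] assms by simp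
    then show ?case using Suc by simp
  qed simp
  also have "\<dots> \<le> 2 * b ^ a" using assms by simp
  finally show ?thesis .
qed

text \<open>If the union is small, all sets lie in one common set \<open>V\<close> of size
  \<open>u\<close>; for fixed \<open>V\<close> the nodes are independent, and a union bound over
  \<open>V\<close> remains.\<close>

lemma prob_small_union_le:
  assumes T: "T \<subseteq> {1..n}" and KP: "K \<le> P" and u: "u \<le> P"
  shows "measure_pmf.prob (unif_model n P K) {S. card (\<Union>(S ` T)) \<le> u} \<le>
    real (P choose u) * (real u / real P) ^ (K * card T)"
proof -
  let ?Vs = "{V. V \<subseteq> {1..P} \<and> card V = u}"
  have finT: "finite T" using T finite_subset by blast
  have "measure_pmf.prob (unif_model n P K) {S. card (\<Union>(S ` T)) \<le> u} =
      measure_pmf.prob (Pi_pmf T {} (\<lambda>_. unif_sets P K)) {S. card (\<Union>(S ` T)) \<le> u}"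
    unfolding unif_model_def
    by (rule prob_Pi_pmf_marginal[OF _ T]) (auto cong: image_cong)
  also have "\<dots> \<le> measure_pmf.prob (Pi_pmf T {} (\<lambda>_. unif_sets P K)) (\<Union>V\<in>?Vs. Pi T (\<lambda>_. {A. A \<subseteq> V}))"
  proof (rule measure_pmf.finite_measure_mono_AE)
    show "AE S in measure_pmf (Pi_pmf T {} (\<lambda>_. unif_sets P K)). S \<in> {S. card (\<Union>(S ` T)) \<le> u} \<longrightarrow>
       S \<in> (\<Union>V\<in>?Vs. Pi T (\<lambda>_. {A. A \<subseteq> V}))"
      unfolding AE_measure_pmf_iff
    proof (intro ballI impI)
      fix S assume S: "S \<in> set_pmf (Pi_pmf T {} (\<lambda>_. unif_sets P K))" and c: "S \<in> {S. card (\<Union>(S ` T)) \<le> u}"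
      have "\<Union>(S ` T) \<subseteq> {1..P}" by (rule Union_Pi_unif_sets(1)[OF S finT KP])
      then obtain V where "\<Union>(S ` T) \<subseteq> V" "V \<subseteq> {1..P}" "card V = u"
        using exists_subset_between[of "\<Union>(S ` T)" u "{1..P}"] c u by auto
      then show "S \<in> (\<Union>V\<in>?Vs. Pi T (\<lambda>_. {A. A \<subseteq> V}))" by blast
    qed
  qed simp
  also have "\<dots> \<le> (\<Sum>V\<in>?Vs. (real u / real P) ^ (K * card T))"
  proof (rule prob_UN_le)
    fix V assume V: "V \<in> ?Vs"
    have "measure_pmf.prob (Pi_pmf T {} (\<lambda>_. unif_sets P K)) (Pi T (\<lambda>_. {A. A \<subseteq> V})) =
       (\<Prod>i\<in>T. measure_pmf.prob (unif_sets P K) {A. A \<subseteq> V})" by (rule measure_Pi_pmf_Pi[OF finT])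
    also have "\<dots> \<le> (\<Prod>i\<in>T. (real u / real P) ^ K)"
      using prob_unif_sets_subset_le[OF KP, of V] V by (intro prod_mono) auto
    also have "\<dots> = (real u / real P) ^ (K * card T)" by (simp add: power_mult)
    finally show "measure_pmf.prob (Pi_pmf T {} (\<lambda>_. unif_sets P K)) (Pi T (\<lambda>_. {A. A \<subseteq> V})) \<le> (real u / real P) ^ (K * card T)" .
  qed simp
  also have "\<dots> = real (P choose u) * (real u / real P) ^ (K * card T)" by (simp add: n_subsets)
  finally show ?thesis .
qed

text \<open>
  The constant 32 is chosen such that the exponential gain \<open>exp (- 4 * K)\<close> per node exceeds the cost
  \<open>exp K\<close> of choosing the union of the object sets.
\<close>

lemma prob_no_expansion_le:
  assumes T: "T \<subseteq> {1..n}" "1 \<le> card T" and K: "8 \<le> K" "K \<le> P"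
    and small: "real (card T) * real K \<le> exp (- 32) * real P"
  shows "measure_pmf.prob (unif_model n P K) {S. real (card (\<Union>(S ` T))) < 7 / 8 * real (card T) * real K} \<le>
    (real (card T) * real K / real P * exp (32 - 3 * real K)) ^ card T"
proof -
  define t where "t = card T"
  define z where "z = real t * real K / real P"
  define u where "u = nat \<lfloor>7 / 8 * real t * real K\<rfloor>"
  have P0: "0 < real P" using K by simp
  have t1: "1 \<le> real t" "1 \<le> t" using T(2) by (auto simp: t_def)
  have u_le: "real u \<le> 7 / 8 * real t * real K" unfolding u_def by (rule of_nat_floor) simp
  have z0: "0 \<le> z" and z1: "z \<le> exp (- 32)"
    using small P0 by (auto simp: z_def t_def pos_divide_le_eq)
  have "exp (- 32 :: real) \<le> 1" by simp
  then have z_le_1: "z \<le> 1" using z1 by linarith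
  have "0 \<le> real t * real K" by simp
  then have u_tK: "real u \<le> real t * real K" using u_le unfolding mult.assoc by linarith
  also have "\<dots> \<le> real P" using z_le_1 P0 by (simp add: z_def divide_simps split: if_splits)
  finally have uP: "u \<le> P" by simp
  have uz: "real u / real P \<le> z"
    unfolding z_def using u_tK P0 by (intro divide_right_mono) auto
  have uKt: "u \<le> K * t" using u_tK by (metis mult.commute of_nat_le_iff of_nat_mult)
  \<comment> \<open>The missing eighth of the union leaves this surplus of factors \<open>z\<close>.
    At \<open>z \<le> exp (- 32)\<close> an eighth of \<open>K\<close> factors per node yields the
    gain \<open>exp (- 4 * K)\<close>.\<close>
  have diff: "real (K * t - u) \<ge> 1 / 8 * real t * real K" using u_le uKt by (simp add: of_nat_diff algebra_simps)
  have Kt: "1 / 8 * real t * real K \<ge> real t" using K(1) t1 by (simp add: field_simps)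
  then have t_le: "t \<le> K * t - u" using diff by linarith
  have "measure_pmf.prob (unif_model n P K) {S. real (card (\<Union>(S ` T))) < 7 / 8 * real (card T) * real K} \<le>
      measure_pmf.prob (unif_model n P K) {S. card (\<Union>(S ` T)) \<le> u}"
  proof (intro measure_pmf.finite_measure_mono subsetI)
    fix S :: "nat \<Rightarrow> nat set" assume "S \<in> {S. real (card (\<Union>(S ` T))) < 7 / 8 * real (card T) * real K}"
    then have "real (card (\<Union>(S ` T))) \<le> 7 / 8 * real t * real K" by (simp add: t_def)
    then have "card (\<Union>(S ` T)) \<le> u" unfolding u_def by (simp add: le_nat_floor)
    then show "S \<in> {S. card (\<Union>(S ` T)) \<le> u}" by simp
  qed simp
  also have "\<dots> \<le> real (P choose u) * (real u / real P) ^ (K * t)"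
    unfolding t_def by (rule prob_small_union_le[OF T(1) K(2) uP])
  also have "(real u / real P) ^ (K * t) = (real u / real P) ^ u * (real u / real P) ^ (K * t - u)"
    using uKt by (simp flip: power_add)
  also have "real (P choose u) * ((real u / real P) ^ u * (real u / real P) ^ (K * t - u)) =
      (real (P choose u) * real u ^ u / real P ^ u) * (real u / real P) ^ (K * t - u)"
    by (simp add: power_divide)
  also have "\<dots> \<le> exp (real u) * z ^ (K * t - u)"
  proof (rule mult_mono)
    have "real (P choose u) * real u ^ u / real P ^ u \<le> (exp 1 * real P) ^ u / real P ^ u"
      by (intro divide_right_mono binomial_mult_power_le) simp
    also have "\<dots> = exp (real u)" using P0 by (simp add: power_mult_distrib exp_of_nat_mult[symmetric])
    finally show "real (P choose u) * real u ^ u / real P ^ u \<le> exp (real u)" .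
    show "(real u / real P) ^ (K * t - u) \<le> z ^ (K * t - u)" using uz by (intro power_mono) auto
  qed (use z0 in auto)
  \<comment> \<open>One factor \<open>z\<close> per node is kept, which is possible as
    \<open>8 \<le> K\<close>: its smallness K / P has to pay for the choice of the node in the union
    bound over \<open>T\<close>.\<close>
  also have "z ^ (K * t - u) = z ^ t * z ^ (K * t - u - t)" 
    using t_le by (metis le_add_diff_inverse power_add)
  also have "exp (real u) * (z ^ t * z ^ (K * t - u - t)) \<le> exp (real t * real K) * (z ^ t * exp (real t * (32 - 4 * real K)))"
  proof (intro mult_mono)
    show "exp (real u) \<le> exp (real t * real K)" using u_tK by simp
    have "z ^ (K * t - u - t) \<le> exp (- 32) ^ (K * t - u - t)" using z0 z1 by (intro power_mono)
    also have "\<dots> = exp (- 32 * real (K * t - u - t))" by (simp add: exp_of_nat_mult[symmetric] mult.commute)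
    also have "\<dots> \<le> exp (real t * (32 - 4 * real K))"
    proof (rule exp_le_cancel_iff[THEN iffD2])
      have "real (K * t - u - t) = real (K * t - u) - real t" using t_le by simp
      then show "- 32 * real (K * t - u - t) \<le> real t * (32 - 4 * real K)" using diff by (simp add: algebra_simps)
    qed
    finally show "z ^ (K * t - u - t) \<le> exp (real t * (32 - 4 * real K))" .
  qed (use z0 in auto)
  also have "\<dots> = z ^ t * exp (real t * (32 - 3 * real K))"
    by (simp add: exp_add[symmetric] algebra_simps)
  also have "\<dots> = (z * exp (32 - 3 * real K)) ^ t"
    by (simp only: power_mult_distrib exp_of_nat_mult)
  finally show ?thesis unfolding t_def z_def .
qed

text \<open>The constant \<open>exp 33\<close> joins \<open>exp 32\<close> from a single part with
  the \<open>exp 1\<close> per node that its choice costs. What results is a geometric series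
  beginning with two nodes.\<close>

lemma prob_exists_no_expansion_le:
  fixes b :: real and n :: nat
  assumes K: "8 \<le> K" "K \<le> P" and t0: "real t0 * real K \<le> exp (- 32) * real P"
  defines "b \<equiv> exp 33 * (real n * real K / real P) * exp (- 3 * real K)"
  assumes b: "b \<le> 1 / 2"
  shows "measure_pmf.prob (unif_model n P K)
     {S. \<exists>T\<subseteq>{1..n}. 2 \<le> card T \<and> card T \<le> t0 \<and> real (card (\<Union>(S ` T))) < 7 / 8 * real (card T) * real K} \<le> 2 * b\<^sup>2"
proof -
  let ?Ts = "\<lambda>t. {T. T \<subseteq> {1..n} \<and> card T = t}"
  let ?Ev = "\<lambda>T. {S :: nat \<Rightarrow> nat set. real (card (\<Union>(S ` T))) < 7 / 8 * real (card T) * real K}"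
  have b0: "0 \<le> b" by (simp add: b_def)
  have P0: "0 < real P" using K by simp
  have "measure_pmf.prob (unif_model n P K)
     {S. \<exists>T\<subseteq>{1..n}. 2 \<le> card T \<and> card T \<le> t0 \<and> real (card (\<Union>(S ` T))) < 7 / 8 * real (card T) * real K} \<le>
     measure_pmf.prob (unif_model n P K) (\<Union>t\<in>{2..t0}. \<Union>T\<in>?Ts t. ?Ev T)"
  proof (intro measure_pmf.finite_measure_mono subsetI)
    fix S :: "nat \<Rightarrow> nat set"
    assume "S \<in> {S. \<exists>T\<subseteq>{1..n}. 2 \<le> card T \<and> card T \<le> t0 \<and> real (card (\<Union>(S ` T))) < 7 / 8 * real (card T) * real K}"
    then obtain T where "T \<subseteq> {1..n}" "2 \<le> card T" "card T \<le> t0" "S \<in> ?Ev T" by blast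
    then show "S \<in> (\<Union>t\<in>{2..t0}. \<Union>T\<in>?Ts t. ?Ev T)" by (intro UN_I[of "card T"] UN_I[of T]) auto
  qed simp
  also have "\<dots> \<le> (\<Sum>t\<in>{2..t0}. b ^ t)"
  proof (rule prob_UN_le)
    fix t assume t: "t \<in> {2..t0}"
    have "measure_pmf.prob (unif_model n P K) (\<Union>T\<in>?Ts t. ?Ev T) \<le>
        (\<Sum>T\<in>?Ts t. (real t * real K / real P * exp (32 - 3 * real K)) ^ t)"
    proof (rule prob_UN_le)
      fix T assume T: "T \<in> ?Ts t"
      have "real t * real K \<le> real t0 * real K" using t by (intro mult_right_mono) auto
      then have "real (card T) * real K \<le> exp (- 32) * real P" using t0 T by simp
      then show "measure_pmf.prob (unif_model n P K) (?Ev T) \<le> (real t * real K / real P * exp (32 - 3 * real K)) ^ t"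
        using prob_no_expansion_le[of T n K P] T t K by simp
    qed simp
    also have "\<dots> = (real (n choose t) * real t ^ t) * (real K / real P * exp (32 - 3 * real K)) ^ t"
      by (simp add: n_subsets power_mult_distrib power_divide)
    also have "\<dots> \<le> (exp 1 * real n) ^ t * (real K / real P * exp (32 - 3 * real K)) ^ t"
      by (intro mult_right_mono binomial_mult_power_le) auto
    also have "\<dots> = (exp 1 * real n * (real K / real P * exp (32 - 3 * real K))) ^ t"
      by (simp only: power_mult_distrib)
    also have "exp 1 * real n * (real K / real P * exp (32 - 3 * real K)) = b"
    proof -
      have "exp 1 * exp (32 - 3 * real K) = exp 33 * exp (- 3 * real K)" by (simp add: exp_add[symmetric])
      then show ?thesis by (simp add: b_def algebra_simps)
    qed
    finally show "measure_pmf.prob (unif_model n P K) (\<Union>T\<in>?Ts t. ?Ev T) \<le> b ^ t" .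
  qed simp
  also have "\<dots> \<le> (\<Sum>t\<in>{2..<2 + t0}. b ^ t)" using b0 by (intro sum_mono2) auto
  also have "\<dots> \<le> 2 * b\<^sup>2" by (rule sum_power_half_le[OF b0 b])
  finally show ?thesis .
qed

section \<open>Few neighbours outside a given part\<close>

definition separated :: "nat \<Rightarrow> (nat \<Rightarrow> 'b set) \<Rightarrow> nat set \<Rightarrow> nat set \<Rightarrow> bool" where
  "separated n S T X \<longleftrightarrow> (\<forall>j\<in>X. S j \<inter> \<Union>(S ` T) \<noteq> {}) \<and> (\<forall>j\<in>{1..n} - T - X. S j \<inter> \<Union>(S ` T) = {})"

text \<open>Given the object sets in \<open>T\<close>, the outside nodes are independent: those in
  \<open>X\<close> pay for hitting the union, all others for avoiding at least \<open>h\<close>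
  objects. The event \<open>E\<close> concerns \<open>T\<close> alone, so its probability stays as a
  factor; it will be a tree event or trivial.\<close>

lemma prob_separated_le:
  fixes x h :: real
  assumes T: "T \<subseteq> {1..n}" and X: "X \<subseteq> {1..n} - T" and KP: "K \<le> P" "1 \<le> P"
    and E: "\<And>S S'. (\<And>i. i \<in> T \<Longrightarrow> S i = S' i) \<Longrightarrow> E S = E S'"
  defines "x \<equiv> (real K)\<^sup>2 / real P"
  assumes rest: "0 \<le> h" "q \<le> real (n - card T - card X)"
  shows "measure_pmf.prob (unif_model n P K) {S. E S \<and> h \<le> real (card (\<Union>(S ` T))) \<and> separated n S T X} \<le>
    ((real (card T) * x) ^ card X * exp (- (h * real K / real P * q))) * measure_pmf.prob (unif_model n P K) {S. E S}"
proof -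
  define B where "B = {1..n} - T"
  define F where "F j S = (if j \<in> X then {A :: nat set. A \<inter> \<Union>(S ` T) \<noteq> {}} else {A. A \<inter> \<Union>(S ` T) = {}})" for j and S :: "nat \<Rightarrow> nat set"
  have finT: "finite T" using T finite_subset by blast
  have finB: "finite B" by (simp add: B_def)
  have TB: "T \<inter> B = {}" "{1..n} = T \<union> B" using T by (auto simp: B_def)
  have cardB: "card B = n - card T" using T finT unfolding B_def by (simp add: card_Diff_subset)
  have XB: "X \<subseteq> B" using X by (simp add: B_def)
  have "separated n S T X \<longleftrightarrow> (\<forall>j\<in>X. S j \<in> F j S) \<and> (\<forall>j\<in>B - X. S j \<in> F j S)" for S
    by (simp add: separated_def F_def B_def)
  then have "{S. E S \<and> h \<le> real (card (\<Union>(S ` T))) \<and> separated n S T X} =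
      {S. (E S \<and> h \<le> real (card (\<Union>(S ` T)))) \<and> (\<forall>j\<in>B. S j \<in> F j S)}"
    using XB by blast
  then have "measure_pmf.prob (unif_model n P K) {S. E S \<and> h \<le> real (card (\<Union>(S ` T))) \<and> separated n S T X} =
      measure_pmf.prob (Pi_pmf (T \<union> B) {} (\<lambda>_. unif_sets P K)) {S. (E S \<and> h \<le> real (card (\<Union>(S ` T)))) \<and> (\<forall>j\<in>B. S j \<in> F j S)}"
    unfolding unif_model_def TB(2) by simp
  also have "\<dots> \<le> ((real (card T) * x) ^ card X * exp (- (h * real K / real P * q))) *
      measure_pmf.prob (Pi_pmf T {} (\<lambda>_. unif_sets P K)) {S. E S \<and> h \<le> real (card (\<Union>(S ` T)))}"
  proof (rule prob_Pi_pmf_split_le[OF finT finB TB(1)])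
    fix S S' :: "nat \<Rightarrow> nat set" assume eq: "\<And>i. i \<in> T \<Longrightarrow> S i = S' i"
    then have "\<Union>(S ` T) = \<Union>(S' ` T)" by simp
    then show "(E S \<and> h \<le> real (card (\<Union>(S ` T)))) = (E S' \<and> h \<le> real (card (\<Union>(S' ` T))))"
      and "F j S = F j S'" for j
      using E[OF eq] by (simp_all add: F_def)
  next
    fix S assume S: "S \<in> set_pmf (Pi_pmf T {} (\<lambda>_. unif_sets P K))" and ES: "E S \<and> h \<le> real (card (\<Union>(S ` T)))"
    let ?U = "\<Union>(S ` T)"
    note U = Union_Pi_unif_sets[OF S finT KP(1)]
    have finU: "finite ?U" using U(1) finite_subset by blast
    have "(\<Prod>j\<in>B. measure_pmf.prob (unif_sets P K) (F j S)) \<le>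
        (\<Prod>j\<in>B. if j \<in> X then real (card T) * x else exp (- (h * real K / real P)))"
    proof (rule prod_mono, rule conjI)
      fix j
      show "measure_pmf.prob (unif_sets P K) (F j S) \<le> (if j \<in> X then real (card T) * x else exp (- (h * real K / real P)))"
      proof (cases "j \<in> X")
        case True
        have "measure_pmf.prob (unif_sets P K) {A. A \<inter> ?U \<noteq> {}} \<le> real (card ?U) * real K / real P"
          by (rule prob_unif_sets_hit_le[OF KP finU])
        also have "\<dots> \<le> real (card T * K) * real K / real P"
          using U(2) by (intro divide_right_mono mult_right_mono of_nat_mono) auto
        finally show ?thesis using True by (simp add: F_def x_def power2_eq_square)
      next
        case False
        have "measure_pmf.prob (unif_sets P K) {A. A \<inter> ?U = {}} \<le> exp (- (real (card ?U) * real K / real P))"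
          by (rule prob_unif_sets_disjoint_le[OF KP U(1)])
        also have "\<dots> \<le> exp (- (h * real K / real P))"
          using ES by (intro exp_le_cancel_iff[THEN iffD2] le_imp_neg_le divide_right_mono mult_right_mono) auto
        finally show ?thesis using False by (simp add: F_def)
      qed
    qed simp
    also have "\<dots> = (real (card T) * x) ^ card X * exp (- (h * real K / real P)) ^ (card B - card X)"
      by (rule prod_dichotomy[OF finB XB])
    also have "exp (- (h * real K / real P)) ^ (card B - card X) = exp (- (h * real K / real P * real (n - card T - card X)))"
      by (simp add: cardB exp_of_nat_mult[symmetric] mult.commute)
    also have "(real (card T) * x) ^ card X * exp (- (h * real K / real P * real (n - card T - card X))) \<le>
       (real (card T) * x) ^ card X * exp (- (h * real K / real P * q))"
      using rest by (intro mult_left_mono exp_le_cancel_iff[THEN iffD2] le_imp_neg_le) (auto simp: x_def)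
    finally show "(\<Prod>j\<in>B. measure_pmf.prob (unif_sets P K) (F j S)) \<le>
      (real (card T) * x) ^ card X * exp (- (h * real K / real P * q))" .
  qed
  also have "measure_pmf.prob (Pi_pmf T {} (\<lambda>_. unif_sets P K)) {S. E S \<and> h \<le> real (card (\<Union>(S ` T)))} \<le>
      measure_pmf.prob (Pi_pmf T {} (\<lambda>_. unif_sets P K)) {S. E S}"
    by (intro measure_pmf.finite_measure_mono) auto
  also have "\<dots> = measure_pmf.prob (unif_model n P K) {S. E S}"
    unfolding unif_model_def by (rule prob_Pi_pmf_marginal[OF _ T E, symmetric]) simp
  finally show ?thesis by (simp add: mult_left_mono x_def)
qed

text \<open>As \<open>n * a\<close> is at least 1, its \<open>k\<close>-th power dominates the
  contribution of every size below \<open>k\<close>.\<close>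

lemma sum_small_subsets_le:
  fixes a :: real
  assumes B: "finite B" "card B \<le> n" and a: "0 \<le> a" "1 \<le> real n * a"
  shows "(\<Sum>X\<in>{X. X \<subseteq> B \<and> card X < k}. a ^ card X) \<le> real k * (real n * a) ^ k"
proof -
  have fin: "finite {X. X \<subseteq> B \<and> card X = i}" for i by (rule finite_subset[of _ "Pow B"]) (use B(1) in auto)
  have "{X. X \<subseteq> B \<and> card X < k} = (\<Union>i<k. {X. X \<subseteq> B \<and> card X = i})" by auto
  then have "(\<Sum>X\<in>{X. X \<subseteq> B \<and> card X < k}. a ^ card X) = (\<Sum>i<k. \<Sum>X\<in>{X. X \<subseteq> B \<and> card X = i}. a ^ card X)"
    using fin by (simp only:) (intro sum.UNION_disjoint, auto)
  also have "\<dots> \<le> (\<Sum>i<k. (real n * a) ^ k)"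
  proof (rule sum_mono)
    fix i assume i: "i \<in> {..<k}"
    have "(\<Sum>X\<in>{X. X \<subseteq> B \<and> card X = i}. a ^ card X) = real (card B choose i) * a ^ i"
      using B(1) by (simp add: n_subsets)
    also have "\<dots> \<le> real (n ^ i) * a ^ i"
    proof (intro mult_right_mono of_nat_mono)
      have "card B choose i \<le> n choose i" by (rule binomial_mono_left[OF B(2)])
      also have "\<dots> \<le> n ^ i" by (cases "i \<le> n") (auto simp: binomial_le_pow binomial_eq_0)
      finally show "card B choose i \<le> n ^ i" .
    qed (use a in auto)
    also have "\<dots> = (real n * a) ^ i" by (simp add: power_mult_distrib)
    also have "\<dots> \<le> (real n * a) ^ k" using a i by (intro power_increasing) auto
    finally show "(\<Sum>X\<in>{X. X \<subseteq> B \<and> card X = i}. a ^ card X) \<le> (real n * a) ^ k" .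
  qed
  finally show ?thesis by simp
qed

text \<open>The factors are: \<open>n * exp t * y ^ (t - 1)\<close> for the part, its parent
  function and the tree edges together, \<open>t\<close> for the root,
  \<open>k * (t * y) ^ k\<close> for fewer than \<open>k\<close> outside neighbours, and the
  exponential for all other nodes avoiding at least \<open>7 / 8 * t * K\<close> objects.\<close>

definition small_part_term :: "nat \<Rightarrow> nat \<Rightarrow> real \<Rightarrow> nat \<Rightarrow> real" where
  "small_part_term n k y t = real k * real n * real t * exp (real t) * y ^ (t - 1) * (real t * y) ^ k *
     exp (- (7 / 8 * real t * y * (1 - (real t + real k) / real n)))"

text \<open>The n^t from choosing the part meets only x^(t - 1) from the \<open>t - 1\<close> tree
  edges, which leaves powers of \<open>y\<close> and a single factor \<open>n\<close>. That factor
  must later be beaten by the avoidance term.\<close>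

lemma prob_small_parts_le:
  fixes x y :: real
  assumes t: "1 \<le> t" and n: "1 \<le> n" and KP: "K \<le> P" "1 \<le> P"
  defines "x \<equiv> (real K)\<^sup>2 / real P"
  defines "y \<equiv> real n * x"
  assumes y: "1 \<le> y"
  shows "measure_pmf.prob (unif_model n P K)
    (\<Union>T\<in>{T. T \<subseteq> {1..n} \<and> card T = t}. \<Union>v\<in>T. \<Union>f\<in>{f \<in> T \<rightarrow>\<^sub>E T. rooted_tree f v T}. \<Union>X\<in>{X. X \<subseteq> {1..n} - T \<and> card X < k}.
       {S. (\<forall>w\<in>T - {v}. S w \<inter> S (f w) \<noteq> {}) \<and> 7 / 8 * real t * real K \<le> real (card (\<Union>(S ` T))) \<and> separated n S T X})
    \<le> small_part_term n k y t"
proof -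
  define c where "c = exp (- (7 / 8 * real t * y * (1 - (real t + real k) / real n)))"
  define a where "a = real t * x"
  have x0: "0 \<le> x" by (simp add: x_def)
  have na: "real n * a = real t * y" by (simp add: a_def y_def)
  have "1 \<le> real t * y" using t y by (metis mult_mono mult_1 of_nat_1 of_nat_le_iff of_nat_0_le_iff zero_le_one)
  then have a1: "0 \<le> a" "1 \<le> real n * a" unfolding na using x0 by (simp_all add: a_def)
  let ?Ev = "\<lambda>T v f X. {S :: nat \<Rightarrow> nat set. (\<forall>w\<in>T - {v}. S w \<inter> S (f w) \<noteq> {}) \<and> 7 / 8 * real t * real K \<le> real (card (\<Union>(S ` T))) \<and> separated n S T X}"
  have one: "measure_pmf.prob (unif_model n P K) (?Ev T v f X) \<le> a ^ card X * (c * x ^ (t - 1))"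
    if T: "T \<subseteq> {1..n}" "card T = t" and f: "rooted_tree f v T" and X: "X \<subseteq> {1..n} - T" "card X < k" for T v f X
  proof -
    have "measure_pmf.prob (unif_model n P K) (?Ev T v f X) \<le>
        ((real (card T) * x) ^ card X * exp (- (7 / 8 * real t * real K * real K / real P * (real n - real t - real k)))) *
        measure_pmf.prob (unif_model n P K) {S. \<forall>w\<in>T - {v}. S w \<inter> S (f w) \<noteq> {}}"
      unfolding x_def
    proof (rule prob_separated_le[OF T(1) X(1) KP])
      fix S S' :: "nat \<Rightarrow> nat set" assume "\<And>i. i \<in> T \<Longrightarrow> S i = S' i"
      then show "(\<forall>w\<in>T - {v}. S w \<inter> S (f w) \<noteq> {}) = (\<forall>w\<in>T - {v}. S' w \<inter> S' (f w) \<noteq> {})"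
        using rooted_tree_closed[OF f] by simp
    next
      show "real n - real t - real k \<le> real (n - card T - card X)" using X(2) T(2) by linarith
    qed simp
    also have "7 / 8 * real t * real K * real K / real P * (real n - real t - real k) =
        7 / 8 * real t * y * (1 - (real t + real k) / real n)"
    proof -
      have "real n * (1 - (real t + real k) / real n) = real n - real t - real k"
        using n by (simp add: right_diff_distrib)
      moreover have "7 / 8 * real t * y * (1 - (real t + real k) / real n) =
          7 / 8 * real t * x * (real n * (1 - (real t + real k) / real n))" by (simp add: y_def)
      moreover have "7 / 8 * real t * real K * real K / real P * w = 7 / 8 * real t * x * w" for w
        by (simp add: x_def power2_eq_square)
      ultimately show ?thesis by (simp only:)
    qed
    also have "((real (card T) * x) ^ card X * exp (- (7 / 8 * real t * y * (1 - (real t + real k) / real n)))) *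
        measure_pmf.prob (unif_model n P K) {S. \<forall>w\<in>T - {v}. S w \<inter> S (f w) \<noteq> {}} \<le> (a ^ card X * c) * x ^ (t - 1)"
      unfolding a_def c_def T(2) using prob_rooted_tree_le[OF f _ T(1) KP] T(2) x0
      by (intro mult_left_mono) (auto simp: unif_model_def x_def)
    finally show ?thesis by (simp add: mult.assoc)
  qed
  have "measure_pmf.prob (unif_model n P K)
    (\<Union>T\<in>{T. T \<subseteq> {1..n} \<and> card T = t}. \<Union>v\<in>T. \<Union>f\<in>{f \<in> T \<rightarrow>\<^sub>E T. rooted_tree f v T}. \<Union>X\<in>{X. X \<subseteq> {1..n} - T \<and> card X < k}. ?Ev T v f X)
    \<le> (\<Sum>T\<in>{T. T \<subseteq> {1..n} \<and> card T = t}. real t * (real (t ^ t) * (real k * (real t * y) ^ k * (c * x ^ (t - 1)))))"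
  proof (rule prob_UN_le)
    show "finite {T. T \<subseteq> {1..n} \<and> card T = t}" by simp
    fix T assume "T \<in> {T. T \<subseteq> {1..n} \<and> card T = t}"
    then have T: "T \<subseteq> {1..n}" "card T = t" "finite T" using finite_subset by auto
    have "measure_pmf.prob (unif_model n P K) (\<Union>v\<in>T. \<Union>f\<in>{f \<in> T \<rightarrow>\<^sub>E T. rooted_tree f v T}. \<Union>X\<in>{X. X \<subseteq> {1..n} - T \<and> card X < k}. ?Ev T v f X)
      \<le> (\<Sum>v\<in>T. real (t ^ t) * (real k * (real t * y) ^ k * (c * x ^ (t - 1))))"
    proof (rule prob_UN_le[OF T(3)])
      fix v
      have finf: "finite (T \<rightarrow>\<^sub>E T)" using T(3) by (intro finite_PiE) auto
      have cardf: "card {f \<in> T \<rightarrow>\<^sub>E T. rooted_tree f v T} \<le> t ^ t"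
        using card_mono[OF finf, of "{f \<in> T \<rightarrow>\<^sub>E T. rooted_tree f v T}"] T(2,3) by (simp add: card_PiE)
      have "measure_pmf.prob (unif_model n P K) (\<Union>f\<in>{f \<in> T \<rightarrow>\<^sub>E T. rooted_tree f v T}. \<Union>X\<in>{X. X \<subseteq> {1..n} - T \<and> card X < k}. ?Ev T v f X)
        \<le> (\<Sum>f\<in>{f \<in> T \<rightarrow>\<^sub>E T. rooted_tree f v T}. real k * (real t * y) ^ k * (c * x ^ (t - 1)))"
      proof (rule prob_UN_le)
        show "finite {f \<in> T \<rightarrow>\<^sub>E T. rooted_tree f v T}" using finf by simp
        fix f assume f: "f \<in> {f \<in> T \<rightarrow>\<^sub>E T. rooted_tree f v T}"
        have "measure_pmf.prob (unif_model n P K) (\<Union>X\<in>{X. X \<subseteq> {1..n} - T \<and> card X < k}. ?Ev T v f X) \<le>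
           (\<Sum>X\<in>{X. X \<subseteq> {1..n} - T \<and> card X < k}. a ^ card X * (c * x ^ (t - 1)))"
        proof (rule prob_UN_le)
          show "finite {X. X \<subseteq> {1..n} - T \<and> card X < k}" by (rule finite_subset[of _ "Pow {1..n}"]) auto
          fix X assume "X \<in> {X. X \<subseteq> {1..n} - T \<and> card X < k}"
          then show "measure_pmf.prob (unif_model n P K) (?Ev T v f X) \<le> a ^ card X * (c * x ^ (t - 1))"
            using f by (intro one[OF T(1,2)]) auto
        qed
        also have "\<dots> = (\<Sum>X\<in>{X. X \<subseteq> {1..n} - T \<and> card X < k}. a ^ card X) * (c * x ^ (t - 1))"
          by (simp add: sum_distrib_right)
        also have "\<dots> \<le> real k * (real n * a) ^ k * (c * x ^ (t - 1))"
          using card_mono[of "{1..n}" "{1..n} - T"] a1 x0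
          by (intro mult_right_mono sum_small_subsets_le) (auto simp: c_def)
        finally show "measure_pmf.prob (unif_model n P K) (\<Union>X\<in>{X. X \<subseteq> {1..n} - T \<and> card X < k}. ?Ev T v f X) \<le>
          real k * (real t * y) ^ k * (c * x ^ (t - 1))" by (simp only: na)
      qed
      also have "\<dots> = real (card {f \<in> T \<rightarrow>\<^sub>E T. rooted_tree f v T}) * (real k * (real t * y) ^ k * (c * x ^ (t - 1)))"
        by (simp only: sum_constant)
      also have "\<dots> \<le> real (t ^ t) * (real k * (real t * y) ^ k * (c * x ^ (t - 1)))"
        using cardf x0 y by (intro mult_right_mono of_nat_mono) (auto simp: c_def)
      finally show "measure_pmf.prob (unif_model n P K) (\<Union>f\<in>{f \<in> T \<rightarrow>\<^sub>E T. rooted_tree f v T}. \<Union>X\<in>{X. X \<subseteq> {1..n} - T \<and> card X < k}. ?Ev T v f X)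
        \<le> real (t ^ t) * (real k * (real t * y) ^ k * (c * x ^ (t - 1)))" .
    qed
    then show "measure_pmf.prob (unif_model n P K) (\<Union>v\<in>T. \<Union>f\<in>{f \<in> T \<rightarrow>\<^sub>E T. rooted_tree f v T}. \<Union>X\<in>{X. X \<subseteq> {1..n} - T \<and> card X < k}. ?Ev T v f X)
      \<le> real t * (real (t ^ t) * (real k * (real t * y) ^ k * (c * x ^ (t - 1))))"
      by (simp only: sum_constant T(2))
  qed
  also have "\<dots> = (real (n choose t) * real t ^ t) * (real t * (real k * (real t * y) ^ k * (c * x ^ (t - 1))))"
    by (simp add: n_subsets)
  also have "\<dots> \<le> (exp 1 * real n) ^ t * (real t * (real k * (real t * y) ^ k * (c * x ^ (t - 1))))"
    using x0 y by (intro mult_right_mono binomial_mult_power_le) (auto simp: c_def)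
  also have "\<dots> = (exp (real t) * (real n * (real n ^ (t - 1) * x ^ (t - 1)))) * (real t * (real k * (real t * y) ^ k * c))"
    using t by (cases t) (simp_all add: power_mult_distrib exp_of_nat_mult[symmetric] exp_add mult_ac)
  also have "real n ^ (t - 1) * x ^ (t - 1) = y ^ (t - 1)" by (simp add: y_def power_mult_distrib)
  also have "(exp (real t) * (real n * y ^ (t - 1))) * (real t * (real k * (real t * y) ^ k * c)) = small_part_term n k y t"
    by (simp add: small_part_term_def c_def)
  finally show ?thesis .
qed

text \<open>The union here is a constant fraction of the pool, so almost n / 2 nodes avoiding it
  have probability exp (- const * K * n). For large \<open>K\<close> this beats all
  \<open>4 ^ n\<close> pairs of sets, and no spanning tree is required.\<close>

lemma prob_large_parts_le:
  fixes x y :: real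
  assumes n: "1 \<le> n" "2 * k \<le> n" and KP: "K \<le> P" "1 \<le> P" and t0: "exp (- 32) * real P \<le> 2 * real t0 * real K"
  defines "x \<equiv> (real K)\<^sup>2 / real P"
  defines "y \<equiv> real n * x"
  assumes y: "1 \<le> y"
  shows "measure_pmf.prob (unif_model n P K)
    (\<Union>z\<in>{z \<in> Pow {1..n} \<times> Pow {1..n}. snd z \<subseteq> {1..n} - fst z \<and> 2 * card (fst z) \<le> n \<and> card (snd z) < k}.
       {S. True \<and> 7 / 8 * real t0 * real K \<le> real (card (\<Union>(S ` fst z))) \<and> separated n S (fst z) (snd z)})
    \<le> 4 ^ n * y ^ k * exp (- (7 / 16 * exp (- 32) * real K * (real n / 2 - real k)))"
proof -
  let ?I = "{z \<in> Pow {1..n} \<times> Pow {1..n}. snd z \<subseteq> {1..n} - fst z \<and> 2 * card (fst z) \<le> n \<and> card (snd z) < k}"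
  define c where "c = exp (- (7 / 16 * exp (- 32) * real K * (real n / 2 - real k)))"
  have x0: "0 \<le> x" by (simp add: x_def)
  have fin: "finite ?I" by (rule finite_subset[of _ "Pow {1..n} \<times> Pow {1..n}"]) auto
  have "measure_pmf.prob (unif_model n P K)
    (\<Union>z\<in>?I. {S. True \<and> 7 / 8 * real t0 * real K \<le> real (card (\<Union>(S ` fst z))) \<and> separated n S (fst z) (snd z)}) \<le> (\<Sum>z\<in>?I. y ^ k * c)"
  proof (rule prob_UN_le[OF fin])
    fix z assume "z \<in> ?I"
    then obtain T X where z: "z = (T, X)" "T \<subseteq> {1..n}" "X \<subseteq> {1..n} - T" "2 * card T \<le> n" "card X < k" by (cases z) auto
    have "measure_pmf.prob (unif_model n P K) {S. True \<and> 7 / 8 * real t0 * real K \<le> real (card (\<Union>(S ` T))) \<and> separated n S T X} \<le>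
       ((real (card T) * x) ^ card X * exp (- (7 / 8 * real t0 * real K * real K / real P * (real n / 2 - real k)))) *
       measure_pmf.prob (unif_model n P K) {S. True}"
      unfolding x_def
    proof (rule prob_separated_le[OF z(2,3) KP])
      show "real n / 2 - real k \<le> real (n - card T - card X)" using z(4,5) by linarith
    qed simp_all
    also have "\<dots> = (real (card T) * x) ^ card X * exp (- (7 / 8 * real t0 * real K * real K / real P * (real n / 2 - real k)))"
      by simp
    also have "\<dots> \<le> y ^ k * c"
    proof (rule mult_mono)
      have "card T \<le> n" using z(4) by simp
      then have "real (card T) * x \<le> y" unfolding y_def using x0 by (intro mult_right_mono) auto
      then have "(real (card T) * x) ^ card X \<le> y ^ card X" using x0 by (intro power_mono) auto
      also have "\<dots> \<le> y ^ k" using y z(5) by (intro power_increasing) auto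
      finally show "(real (card T) * x) ^ card X \<le> y ^ k" .
      have P0: "0 < real P" using KP by simp
      \<comment> \<open>\<open>7 / 16\<close> is half of \<open>7 / 8\<close>, as
        \<open>t0 * K\<close> may fall short of \<open>exp (- 32) * P\<close> by a factor 2.\<close>
      have "7 / 16 * exp (- 32) * real K = 7 / 16 * (exp (- 32) * real P) * real K / real P" using P0 by simp
      also have "\<dots> \<le> 7 / 16 * (2 * real t0 * real K) * real K / real P"
        by (intro divide_right_mono mult_right_mono mult_left_mono t0) auto
      also have "\<dots> = 7 / 8 * real t0 * real K * real K / real P" by simp
      finally have "7 / 16 * exp (- 32) * real K * (real n / 2 - real k) \<le> 7 / 8 * real t0 * real K * real K / real P * (real n / 2 - real k)"
        using n(2) by (intro mult_right_mono) linarith+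
      then show "exp (- (7 / 8 * real t0 * real K * real K / real P * (real n / 2 - real k))) \<le> c"
        by (simp add: c_def)
    qed (use y in auto)
    finally show "measure_pmf.prob (unif_model n P K)
       {S. True \<and> 7 / 8 * real t0 * real K \<le> real (card (\<Union>(S ` fst z))) \<and> separated n S (fst z) (snd z)} \<le> y ^ k * c"
      using z(1) by simp
  qed
  also have "\<dots> = real (card ?I) * (y ^ k * c)" by (simp only: sum_constant)
  also have "\<dots> \<le> real (4 ^ n) * (y ^ k * c)"
  proof (intro mult_right_mono of_nat_mono)
    have "card ?I \<le> card (Pow {1..n} \<times> Pow {1..n})" by (intro card_mono) auto
    also have "\<dots> = 4 ^ n" by (simp add: card_cartesian_product card_Pow power_mult_distrib[symmetric])
    finally show "card ?I \<le> 4 ^ n" .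
  qed (use y in \<open>auto simp: c_def\<close>)
  finally show ?thesis by (simp add: c_def mult.assoc)
qed

text \<open>Expansion is available only while \<open>card T * K\<close> is below a constant fraction
  of the pool, and \<open>t0\<close> marks this limit up to rounding. Parts up to that size are
  counted with their spanning trees, larger ones by brute force.\<close>

lemma prob_not_connected_min_degree_le:
  fixes y b :: real
  assumes n: "k < n" "2 * k \<le> n" and K: "8 \<le> K" "K \<le> P"
    and t0: "2 \<le> t0" "real t0 * real K \<le> exp (- 32) * real P" "exp (- 32) * real P \<le> 2 * real t0 * real K"
  defines "y \<equiv> real n * ((real K)\<^sup>2 / real P)"
  defines "b \<equiv> exp 33 * (real n * real K / real P) * exp (- 3 * real K)"
  assumes y: "1 \<le> y" and b: "b \<le> 1 / 2"
  shows "measure_pmf.prob (unif_model n P K) {S. low_degree n k S = {} \<and> \<not> k_connected k (intersection_graph n S)} \<le>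
    2 * b\<^sup>2 + (\<Sum>t\<in>{2..n div 2}. small_part_term n k y t) +
    4 ^ n * y ^ k * exp (- (7 / 16 * exp (- 32) * real K * (real n / 2 - real k)))"
proof -
  let ?M = "unif_model n P K"
  let ?F = "{S :: nat \<Rightarrow> nat set. \<exists>T\<subseteq>{1..n}. 2 \<le> card T \<and> card T \<le> t0 \<and> real (card (\<Union>(S ` T))) < 7 / 8 * real (card T) * real K}"
  let ?A = "\<Union>t\<in>{2..n div 2}. \<Union>T\<in>{T. T \<subseteq> {1..n} \<and> card T = t}. \<Union>v\<in>T. \<Union>f\<in>{f \<in> T \<rightarrow>\<^sub>E T. rooted_tree f v T}. \<Union>X\<in>{X. X \<subseteq> {1..n} - T \<and> card X < k}.
       {S :: nat \<Rightarrow> nat set. (\<forall>w\<in>T - {v}. S w \<inter> S (f w) \<noteq> {}) \<and> 7 / 8 * real t * real K \<le> real (card (\<Union>(S ` T))) \<and> separated n S T X}"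
  let ?L = "\<Union>z\<in>{z \<in> Pow {1..n} \<times> Pow {1..n}. snd z \<subseteq> {1..n} - fst z \<and> 2 * card (fst z) \<le> n \<and> card (snd z) < k}.
       {S :: nat \<Rightarrow> nat set. True \<and> 7 / 8 * real t0 * real K \<le> real (card (\<Union>(S ` fst z))) \<and> separated n S (fst z) (snd z)}"
  have P1: "1 \<le> P" using K by simp
  have "measure_pmf.prob ?M {S. low_degree n k S = {} \<and> \<not> k_connected k (intersection_graph n S)} \<le> measure_pmf.prob ?M ((?F \<union> ?A) \<union> ?L)"
  proof (rule measure_pmf.finite_measure_mono_AE)
    show "AE S in measure_pmf ?M. S \<in> {S. low_degree n k S = {} \<and> \<not> k_connected k (intersection_graph n S)} \<longrightarrow> S \<in> (?F \<union> ?A) \<union> ?L"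
      unfolding AE_measure_pmf_iff
    proof (intro ballI impI)
      fix S assume SM: "S \<in> set_pmf ?M" and S: "S \<in> {S. low_degree n k S = {} \<and> \<not> k_connected k (intersection_graph n S)}"
      obtain T X f v where T: "T \<subseteq> {1..n}" "2 \<le> card T" "2 * card T \<le> n" "X \<subseteq> {1..n} - T" "card X < k"
        "v \<in> T" "f \<in> T \<rightarrow>\<^sub>E T" "rooted_tree f v T" "sparse_part n S T X f v"
        using sparse_part_if_not_k_connected[OF n(1), of S] S by auto
      have tree: "\<forall>w\<in>T - {v}. S w \<inter> S (f w) \<noteq> {}" and sep: "separated n S T X"
        using T(9) by (auto simp: sparse_part_def separated_def)
      have finU: "finite (\<Union>(S ` T))"
      proof -
        have "\<Union>(S ` T) \<subseteq> \<Union>(S ` {1..n})" using T(1) by auto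
        also have "\<dots> \<subseteq> {1..P}" using Union_Pi_unif_sets(1)[OF SM[unfolded unif_model_def] _ K(2)] by simp
        finally show ?thesis using finite_subset by blast
      qed
      show "S \<in> (?F \<union> ?A) \<union> ?L"
      proof (cases "S \<in> ?F")
        case False
        then have exp: "7 / 8 * real (card T') * real K \<le> real (card (\<Union>(S ` T')))"
          if "T' \<subseteq> {1..n}" "2 \<le> card T'" "card T' \<le> t0" for T'
          using that by (auto simp: not_less)
        show ?thesis
        proof (cases "card T \<le> t0")
          case True
          have "S \<in> ?A"
            using T exp[OF T(1,2) True] tree sep by (intro UN_I[of "card T"] UN_I[of T] UN_I[of v] UN_I[of f] UN_I[of X]) auto
          then show ?thesis by simp
        next
          case large: False
          \<comment> \<open>Expansion of a subset of size exactly \<open>t0\<close> already makes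
            the union of the larger part a constant fraction of the pool.\<close>
          obtain T' where T': "T' \<subseteq> T" "card T' = t0"
            using obtain_subset_with_card_n[of t0 T] large by auto
          have "7 / 8 * real t0 * real K \<le> real (card (\<Union>(S ` T')))" using exp[of T'] T' T(1) t0(1) by auto
          also have "\<dots> \<le> real (card (\<Union>(S ` T)))"
            using T'(1) finU by (intro of_nat_mono card_mono) auto
          finally have "S \<in> ?L" using T sep by (intro UN_I[of "(T, X)"]) auto
          then show ?thesis by simp
        qed
      qed simp
    qed
  qed simp
  also have "\<dots> \<le> measure_pmf.prob ?M (?F \<union> ?A) + measure_pmf.prob ?M ?L" by (intro measure_Un_le) auto
  also have "measure_pmf.prob ?M (?F \<union> ?A) \<le> measure_pmf.prob ?M ?F + measure_pmf.prob ?M ?A" by (intro measure_Un_le) auto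
  also have "measure_pmf.prob ?M ?F \<le> 2 * b\<^sup>2"
    unfolding b_def by (rule prob_exists_no_expansion_le[OF K t0(2)]) (use b in \<open>simp add: b_def\<close>)
  also have "measure_pmf.prob ?M ?A \<le> (\<Sum>t\<in>{2..n div 2}. small_part_term n k y t)"
  proof (rule prob_UN_le)
    fix t assume "t \<in> {2..n div 2}"
    then show "measure_pmf.prob ?M (\<Union>T\<in>{T. T \<subseteq> {1..n} \<and> card T = t}. \<Union>v\<in>T. \<Union>f\<in>{f \<in> T \<rightarrow>\<^sub>E T. rooted_tree f v T}. \<Union>X\<in>{X. X \<subseteq> {1..n} - T \<and> card X < k}.
       {S :: nat \<Rightarrow> nat set. (\<forall>w\<in>T - {v}. S w \<inter> S (f w) \<noteq> {}) \<and> 7 / 8 * real t * real K \<le> real (card (\<Union>(S ` T))) \<and> separated n S T X})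
      \<le> small_part_term n k y t"
      unfolding y_def using n K P1 y[unfolded y_def] by (intro prob_small_parts_le) auto
  qed simp
  also have "measure_pmf.prob ?M ?L \<le> 4 ^ n * y ^ k * exp (- (7 / 16 * exp (- 32) * real K * (real n / 2 - real k)))"
    unfolding y_def using n K P1 y[unfolded y_def] t0 by (intro prob_large_parts_le) auto
  finally show ?thesis by simp
qed

subsection \<open>Asymptotics for sets of equal size\<close>

lemma binomial_le_power_div_fact: "real (n choose s) \<le> real n ^ s / fact s"
proof -
  have "real ((n choose s) * fact s) \<le> real (n ^ s)" by (intro of_nat_mono binomial_fact_pow)
  then show ?thesis by (simp add: field_simps)
qed

lemma binomial_asymp: "(\<lambda>n. real ((n - r) choose s) * fact s / real n ^ s) \<longlonglongrightarrow> 1"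
proof -
  have "(\<lambda>n. \<Prod>i<s. (real n - real r - real i) / real n) \<longlonglongrightarrow> (\<Prod>i<s. 1)"
    by (rule tendsto_prod) real_asymp
  moreover have "\<forall>\<^sub>F n in sequentially. (\<Prod>i<s. (real n - real r - real i) / real n) = real ((n - r) choose s) * fact s / real n ^ s"
    using eventually_ge_at_top[of r]
  proof eventually_elim
    case (elim n)
    then show ?case
      by (simp add: binomial_gbinomial gbinomial_prod_rev prod_dividef atLeast0LessThan of_nat_diff)
  qed
  ultimately show ?thesis by (simp add: tendsto_cong)
qed

lemma filterlim_ln_nat: "filterlim (\<lambda>n. ln (real n)) at_top sequentially"
  by real_asymp

text \<open>The constants 1 / 8 and 4 are what scaling by integers can guarantee: rounding the
  factor of the sizes down loses up to a factor 4 below the target ln n / 2, and rounding the factor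
  of the pool down up to a factor 2 above the target 2 * ln n.\<close>

locale critical =
  fixes K P :: "nat \<Rightarrow> nat" and k :: nat and c :: real
  assumes k: "1 \<le> k" and c: "0 < c"
    and KP: "\<forall>\<^sub>F n in sequentially. 1 \<le> K n \<and> K n \<le> P n"
    and K_ge: "\<forall>\<^sub>F n in sequentially. c * sqrt (ln (real n)) \<le> real (K n)"
    and y_lower: "\<forall>\<^sub>F n in sequentially. ln (real n) / 8 \<le> real n * ((real (K n))\<^sup>2 / real (P n))"
    and y_upper: "\<forall>\<^sub>F n in sequentially. real n * ((real (K n))\<^sup>2 / real (P n)) \<le> 4 * ln (real n)"
begin

definition x :: "nat \<Rightarrow> real" where "x n = (real (K n))\<^sup>2 / real (P n)"
definition y :: "nat \<Rightarrow> real" where "y n = real n * x n"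
text \<open>The Poisson weight of \<open>k - 1\<close> for mean \<open>y n\<close>. As the mean
  tends to infinity, degree \<open>k - 1\<close> outweighs all smaller degrees together.\<close>

definition \<psi> :: "nat \<Rightarrow> real" where "\<psi> n = y n ^ (k - 1) / fact (k - 1) * exp (- y n)"

lemma x_nonneg: "0 \<le> x n" by (simp add: x_def)
lemma y_nonneg: "0 \<le> y n" by (simp add: y_def x_nonneg)

lemma y_ge: "\<forall>\<^sub>F n in sequentially. ln (real n) / 8 \<le> y n"
  using y_lower by (simp add: y_def x_def)

lemma y_le: "\<forall>\<^sub>F n in sequentially. y n \<le> 4 * ln (real n)"
  using y_upper by (simp add: y_def x_def)

lemma y_at_top: "filterlim y at_top sequentially"
proof (rule filterlim_at_top_mono[OF _ y_ge])
  show "filterlim (\<lambda>n. ln (real n) / 8) at_top sequentially" by real_asymp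
qed

lemma K_at_top: "filterlim (\<lambda>n. real (K n)) at_top sequentially"
proof (rule filterlim_at_top_mono[OF _ K_ge])
  show "filterlim (\<lambda>n. c * sqrt (ln (real n))) at_top sequentially" using c by real_asymp
qed

lemma y_pos: "\<forall>\<^sub>F n in sequentially. 1 \<le> y n"
  using y_at_top by (simp add: filterlim_at_top)

lemma x_eq: "0 < n \<Longrightarrow> x n = y n / real n"
  by (simp add: y_def)

lemma x_tendsto: "x \<longlonglongrightarrow> 0"
proof (rule tendsto_sandwich[OF always_eventually])
  show "\<forall>n. 0 \<le> x n" by (simp add: x_nonneg)
  show "\<forall>\<^sub>F n in sequentially. x n \<le> 4 * ln (real n) / real n"
    using y_le eventually_gt_at_top[of 0]
    by eventually_elim (simp add: x_eq divide_right_mono)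
  show "(\<lambda>n. 4 * ln (real n) / real n) \<longlonglongrightarrow> 0" by real_asymp
qed simp

lemma xy_tendsto: "(\<lambda>n. x n * y n) \<longlonglongrightarrow> 0"
proof (rule tendsto_sandwich[OF always_eventually])
  show "\<forall>n. 0 \<le> x n * y n" by (simp add: x_nonneg y_nonneg)
  show "\<forall>\<^sub>F n in sequentially. x n * y n \<le> (4 * ln (real n))\<^sup>2 / real n"
    using y_le eventually_gt_at_top[of 0]
  proof eventually_elim
    case (elim n)
    have "x n * y n = (y n)\<^sup>2 / real n" using elim by (simp add: x_eq power2_eq_square)
    also have "\<dots> \<le> (4 * ln (real n))\<^sup>2 / real n"
      using elim y_nonneg by (intro divide_right_mono power_mono) auto
    finally show ?case .
  qed
  show "(\<lambda>n. (4 * ln (real n))\<^sup>2 / real n) \<longlonglongrightarrow> 0" by real_asymp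
qed simp

text \<open>
  Overlaps of the object sets of the chosen nodes are negligible because of this limit, which needs the
  lower bound on the set sizes.
\<close>

lemma exp_theta_x_tendsto: "(\<lambda>n. exp (real (K n) * real n / real (P n)) * x n) \<longlonglongrightarrow> 0"
proof (rule tendsto_sandwich[OF always_eventually])
  show "\<forall>n. 0 \<le> exp (real (K n) * real n / real (P n)) * x n" by (simp add: x_nonneg)
  show "\<forall>\<^sub>F n in sequentially. exp (real (K n) * real n / real (P n)) * x n \<le>
      exp (4 / c * sqrt (ln (real n))) * (4 * ln (real n)) / real n"
    using y_le eventually_gt_at_top[of 1] KP K_ge
  proof eventually_elim
    case (elim n)
    have L: "0 < ln (real n)" using elim by simp
    \<comment> \<open>The exponent is at most of order sqrt (ln n), so its exponential grows more
      slowly than any power of n, while \<open>x n\<close> is at most of order ln n / n.\<close>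
    have "real (K n) * real n / real (P n) = y n / real (K n)"
      using elim by (simp add: y_def x_def power2_eq_square)
    also have "\<dots> \<le> 4 * ln (real n) / (c * sqrt (ln (real n)))"
      using elim L c by (intro frac_le) auto
    also have "\<dots> = 4 / c * sqrt (ln (real n))"
    proof -
      have "ln (real n) = sqrt (ln (real n)) * sqrt (ln (real n))" using L by simp
      then show ?thesis using L c by (simp add: field_simps)
    qed
    finally have "exp (real (K n) * real n / real (P n)) * x n \<le> exp (4 / c * sqrt (ln (real n))) * (4 * ln (real n) / real n)"
      using elim y_nonneg by (intro mult_mono) (auto simp: x_eq divide_right_mono)
    then show ?case by simp
  qed
  show "(\<lambda>n. exp (4 / c * sqrt (ln (real n))) * (4 * ln (real n)) / real n) \<longlonglongrightarrow> 0" using c by real_asymp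
qed simp

lemma inverse_y_tendsto: "(\<lambda>n. inverse (y n)) \<longlonglongrightarrow> 0"
  using y_at_top by (rule tendsto_inverse_0_at_top)

lemma low_degree_upper:
  "\<exists>u. u \<longlonglongrightarrow> 1 \<and> (\<forall>\<^sub>F n in sequentially. \<forall>R. R \<subseteq> {1..n} \<longrightarrow> card R = r \<longrightarrow>
     measure_pmf.prob (unif_model n (P n) (K n)) {S. R \<subseteq> low_degree n k S} \<le> u n * \<psi> n ^ r)"
proof -
  define t where "t = r * (k - 1)"
  define f :: real where "f = fact (k - 1)"
  \<comment> \<open>The weight of the families with a smaller union relative to the main term; every
    summand contains a positive power of 1 / y.\<close>
  define \<delta> where "\<delta> n = f ^ r * (\<Sum>m<t. (2 ^ r) ^ m * inverse (y n) ^ (t - m))" for n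
  \<comment> \<open>The first summand stems from overlaps of object sets, the second from the
    \<open>r * k\<close> nodes that are not counted as avoiding.\<close>
  define e where "e n = real r * real r * (exp (real (K n) * real n / real (P n)) * x n) + real r * real r * real k * x n" for n
  have "\<delta> \<longlonglongrightarrow> f ^ r * (\<Sum>m<t. (2 ^ r) ^ m * 0 ^ (t - m))"
    unfolding \<delta>_def by (intro tendsto_intros inverse_y_tendsto)
  also have "f ^ r * (\<Sum>m<t. (2 ^ r) ^ m * 0 ^ (t - m)) = 0" by (simp add: power_0_left)
  finally have \<delta>: "\<delta> \<longlonglongrightarrow> 0" .
  have "e \<longlonglongrightarrow> real r * real r * 0 + real r * real r * real k * 0"
    unfolding e_def by (intro tendsto_intros exp_theta_x_tendsto x_tendsto)
  then have "(\<lambda>n. (1 + \<delta> n) * exp (e n)) \<longlonglongrightarrow> (1 + 0) * exp 0"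
    by (intro tendsto_intros \<delta>) simp
  then have lim: "(\<lambda>n. (1 + \<delta> n) * exp (e n)) \<longlonglongrightarrow> 1" by simp
  have "\<forall>\<^sub>F n in sequentially. \<forall>R. R \<subseteq> {1..n} \<longrightarrow> card R = r \<longrightarrow>
     measure_pmf.prob (unif_model n (P n) (K n)) {S. R \<subseteq> low_degree n k S} \<le> (1 + \<delta> n) * exp (e n) * \<psi> n ^ r"
    using KP y_pos eventually_ge_at_top[of "r * k"]
  proof eventually_elim
    case (elim n)
    have f0: "0 < f" by (simp add: f_def)
    define A where "A = y n ^ (k - 1) / f"
    have Ar: "A ^ r = y n ^ t / f ^ r" by (simp add: A_def power_divide t_def power_mult[symmetric] mult.commute)
    show ?case
    proof (intro allI impI)
      fix R assume R: "R \<subseteq> {1..n}" "card R = r"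
      have "measure_pmf.prob (unif_model n (P n) (K n)) {S. R \<subseteq> low_degree n k S} \<le>
        ((real (n choose (k - 1)) * x n ^ (k - 1)) ^ r + (\<Sum>m<t. (2 ^ r * real n * x n) ^ m)) *
        exp (real r * (real r * exp (real (K n) * real n / real (P n)) * x n - x n * (real n - real (r * k))))"
        unfolding x_def t_def by (rule low_degree_prob_le[OF R _ _ k]) (use elim in auto)
      also have "\<dots> \<le> (A ^ r + A ^ r * \<delta> n) *
        exp (real r * (real r * exp (real (K n) * real n / real (P n)) * x n - x n * (real n - real (r * k))))"
      proof (intro mult_right_mono add_mono)
        have "real (n choose (k - 1)) * x n ^ (k - 1) \<le> real n ^ (k - 1) / f * x n ^ (k - 1)"
          unfolding f_def by (intro mult_right_mono binomial_le_power_div_fact) (simp add: x_nonneg)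
        also have "\<dots> = A" by (simp add: A_def y_def power_mult_distrib)
        finally show "(real (n choose (k - 1)) * x n ^ (k - 1)) ^ r \<le> A ^ r"
          using x_nonneg by (intro power_mono) auto
        have "(2 ^ r * real n * x n) ^ m = y n ^ t * ((2 ^ r) ^ m * inverse (y n) ^ (t - m))" if "m < t" for m
        proof -
          have "y n ^ t = y n ^ m * y n ^ (t - m)" using that by (simp flip: power_add)
          moreover have "y n ^ (t - m) * inverse (y n) ^ (t - m) = 1"
            using elim(2) by (simp flip: power_mult_distrib)
          moreover have "(2 ^ r * real n * x n) ^ m = (2 ^ r) ^ m * y n ^ m" by (simp add: y_def power_mult_distrib)
          ultimately show ?thesis by (simp add: mult_ac)
        qed
        then have "(\<Sum>m<t. (2 ^ r * real n * x n) ^ m) = y n ^ t * (\<Sum>m<t. (2 ^ r) ^ m * inverse (y n) ^ (t - m))"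
          by (simp add: sum_distrib_left)
        also have "\<dots> = A ^ r * \<delta> n" using f0 by (simp add: Ar \<delta>_def)
        finally show "(\<Sum>m<t. (2 ^ r * real n * x n) ^ m) \<le> A ^ r * \<delta> n" by simp
      qed simp
      also have "real r * (real r * exp (real (K n) * real n / real (P n)) * x n - x n * (real n - real (r * k))) =
          - (real r * y n) + e n"
        by (simp add: e_def y_def algebra_simps)
      also have "(A ^ r + A ^ r * \<delta> n) * exp (- (real r * y n) + e n) = (1 + \<delta> n) * exp (e n) * \<psi> n ^ r"
      proof -
        have "exp (- (real r * y n)) = exp (- y n) ^ r" by (simp flip: exp_of_nat_mult)
        then have "\<psi> n ^ r = A ^ r * exp (- (real r * y n))"
          unfolding \<psi>_def A_def f_def by (simp only: power_mult_distrib)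
        then show ?thesis by (simp only: exp_add) (simp add: algebra_simps)
      qed
      finally show "measure_pmf.prob (unif_model n (P n) (K n)) {S. R \<subseteq> low_degree n k S} \<le> (1 + \<delta> n) * exp (e n) * \<psi> n ^ r" .
    qed
  qed
  with lim show ?thesis by (intro exI[of _ "\<lambda>n. (1 + \<delta> n) * exp (e n)"]) simp
qed

lemma low_degree_lower:
  "\<exists>l. l \<longlonglongrightarrow> 1 \<and> (\<forall>\<^sub>F n in sequentially. \<forall>R. R \<subseteq> {1..n} \<longrightarrow> card R = r \<longrightarrow>
     l n * \<psi> n ^ r \<le> measure_pmf.prob (unif_model n (P n) (K n)) {S. R \<subseteq> low_degree n k S})"
proof -
  define t where "t = r * (k - 1)"
  define f :: real where "f = fact (k - 1)"
  \<comment> \<open>The number of disjoint families relative to its asymptotic value: the quotient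
    of binomials tends to 1 and the subtracted families are of lower order in n.\<close>
  define D where "D n = (real ((n - r) choose (k - 1)) * f / real n ^ (k - 1)) ^ r -
     f ^ r * (\<Sum>m<t. (2 ^ r) ^ m * inverse (real n) ^ (t - m))" for n
  \<comment> \<open>The error in the exponent, from ln (1 - w) \<ge> - w - 2 * w^2 with w at most 2
    * r * x and from replacing P - K by P in the denominator of w.\<close>
  define \<epsilon> where "\<epsilon> n = 2 * real r * (x n * y n) + 4 * real r * real r * (x n * y n) * (1 + 2 * x n)" for n
  define l where "l n = D n * ((1 - (real r + 1) * x n) ^ t * exp (- \<epsilon> n) * (1 - (real r)\<^sup>2 * x n))" for n
  have f0: "0 < f" by (simp add: f_def)
  have "D \<longlonglongrightarrow> 1 ^ r - f ^ r * (\<Sum>m<t. (2 ^ r) ^ m * 0 ^ (t - m))"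
    unfolding D_def f_def by (intro tendsto_intros binomial_asymp lim_inverse_n)
  also have "1 ^ r - f ^ r * (\<Sum>m<t. (2 ^ r) ^ m * 0 ^ (t - m)) = 1" by (simp add: power_0_left)
  finally have D: "D \<longlonglongrightarrow> 1" .
  have "\<epsilon> \<longlonglongrightarrow> 2 * real r * 0 + 4 * real r * real r * 0 * (1 + 2 * 0)"
    unfolding \<epsilon>_def by (intro tendsto_intros xy_tendsto x_tendsto)
  then have \<epsilon>: "\<epsilon> \<longlonglongrightarrow> 0" by simp
  have "l \<longlonglongrightarrow> 1 * ((1 - (real r + 1) * 0) ^ t * exp (- 0) * (1 - (real r)\<^sup>2 * 0))"
    unfolding l_def by (intro tendsto_intros D \<epsilon> x_tendsto)
  then have lim: "l \<longlonglongrightarrow> 1" by simp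
  have D0: "\<forall>\<^sub>F n in sequentially. 0 < D n" using D by (rule order_tendstoD) simp
  have x_small: "\<forall>\<^sub>F n in sequentially. x n < 1 / (4 * (real r + 1))"
    using x_tendsto by (rule order_tendstoD) simp
  have "\<forall>\<^sub>F n in sequentially. \<forall>R. R \<subseteq> {1..n} \<longrightarrow> card R = r \<longrightarrow>
     l n * \<psi> n ^ r \<le> measure_pmf.prob (unif_model n (P n) (K n)) {S. R \<subseteq> low_degree n k S}"
    using KP D0 x_small eventually_gt_at_top[of 0]
  proof eventually_elim
    case (elim n)
    have P0: "0 < real (P n)" and K1: "1 \<le> real (K n)" using elim by auto
    have rx: "4 * (real r + 1) * x n < 1" using elim(3) by (simp add: field_simps)
    \<comment> \<open>Since \<open>K n\<close> is at least 1, K / P is at most K^2 / P; so the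
      smallness of \<open>x n\<close> also makes the pool much larger than the sets.\<close>
    have Kx: "real (K n) / real (P n) \<le> x n"
      unfolding x_def using K1 P0 by (intro divide_right_mono) (auto simp: power2_eq_square)
    then have "4 * (real r + 1) * (real (K n) / real (P n)) < 1"
      using rx by (smt (verit) mult_left_mono of_nat_0_le_iff)
    then have rKP: "4 * (real r + 1) * real (K n) < real (P n)" using P0 by (simp add: field_simps)
    have "real ((r + 1) * K n) \<le> real (P n)" using rKP K1 by (simp add: algebra_simps)
    then have KP1: "(r + 1) * K n \<le> P n" by (simp only: of_nat_le_iff)
    have K4: "4 * real (K n) < real (P n)" using rKP K1 by (simp add: algebra_simps) (smt (verit) mult_nonneg_nonneg of_nat_0_le_iff)
    then have KP2: "K n < P n" by linarith
    define w where "w = real (r * K n) / (real (P n) - real (K n))"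
    have PK: "0 < real (P n) - real (K n)" using K4 K1 by linarith
    have w0: "0 \<le> w" unfolding w_def using PK by simp
    have w1: "w \<le> 2 * real r * x n"
    proof -
      have "w \<le> real (r * K n) / (real (P n) / 2)" unfolding w_def using K4 P0 by (intro divide_left_mono) auto
      also have "\<dots> = 2 * real r * (real (K n) / real (P n))" by simp
      also have "\<dots> \<le> 2 * real r * x n" using Kx by (intro mult_left_mono) auto
      finally show ?thesis .
    qed
    have w2: "w \<le> 1 / 2" using w1 rx x_nonneg[of n] by (simp add: algebra_simps)
    have wK: "real (K n * n) * w \<le> real r * y n * (1 + 2 * x n)"
    proof -
      have "real (P n) / (real (P n) - real (K n)) \<le> 1 + 2 * (real (K n) / real (P n))"
      proof -
        have "real (P n) * real (P n) \<le> (real (P n) + 2 * real (K n)) * (real (P n) - real (K n))"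
        proof -
          have "(real (P n) + 2 * real (K n)) * (real (P n) - real (K n)) - real (P n) * real (P n) = real (K n) * (real (P n) - 2 * real (K n))"
            by (simp add: algebra_simps)
          moreover have "0 \<le> real (K n) * (real (P n) - 2 * real (K n))" using K4 K1 by (intro mult_nonneg_nonneg) auto
          ultimately show ?thesis by linarith
        qed
        then show ?thesis using PK P0 by (simp add: divide_simps mult.commute)
      qed
      also have "\<dots> \<le> 1 + 2 * x n" using Kx by simp
      finally have "real r * y n * (real (P n) / (real (P n) - real (K n))) \<le> real r * y n * (1 + 2 * x n)"
        using y_nonneg by (intro mult_left_mono) auto
      moreover have "real (K n * n) * w = real r * y n * (real (P n) / (real (P n) - real (K n)))"
        using P0 by (simp add: w_def y_def x_def power2_eq_square)
      ultimately show ?thesis by simp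
    qed
    have powbound: "exp (- (real r * y n) - \<epsilon> n) \<le> (1 - w) ^ (K n * n)"
    proof -
      have "real (K n * n) * (w + 2 * w\<^sup>2) = real (K n * n) * w * (1 + 2 * w)" by (simp add: power2_eq_square algebra_simps)
      also have "\<dots> \<le> real r * y n * (1 + 2 * x n) * (1 + 2 * (2 * real r * x n))"
        by (rule mult_mono[OF wK]) (use w1 w0 x_nonneg y_nonneg in auto)
      also have "\<dots> = real r * y n + \<epsilon> n" by (simp add: \<epsilon>_def algebra_simps)
      finally have "- (real r * y n) - \<epsilon> n \<le> real (K n * n) * (- w - 2 * w\<^sup>2)" by (simp add: algebra_simps)
      also have "\<dots> \<le> real (K n * n) * ln (1 - w)"
        using ln_one_minus_pos_lower_bound[OF w0 w2] by (intro mult_left_mono) auto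
      finally have "exp (- (real r * y n) - \<epsilon> n) \<le> exp (real (K n * n) * ln (1 - w))" by simp
      also have "\<dots> = (1 - w) ^ (K n * n)" using w2 by (simp only: exp_of_nat_mult) simp
      finally show ?thesis .
    qed
    have Dn: "real ((n - r) choose (k - 1)) ^ r - (\<Sum>m<t. (2 ^ r * real n) ^ m) = D n * (real n ^ (k - 1) / f) ^ r"
    proof -
      have nt: "(real n ^ (k - 1) / f) ^ r = real n ^ t / f ^ r"
        by (simp add: power_divide t_def power_mult[symmetric] mult.commute)
      have "(real ((n - r) choose (k - 1)) * f / real n ^ (k - 1)) ^ r * (real n ^ (k - 1) / f) ^ r = real ((n - r) choose (k - 1)) ^ r"
        using elim(4) f0 by (simp flip: power_mult_distrib)
      moreover have "f ^ r * (\<Sum>m<t. (2 ^ r) ^ m * inverse (real n) ^ (t - m)) * (real n ^ (k - 1) / f) ^ r = (\<Sum>m<t. (2 ^ r * real n) ^ m)"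
      proof -
        have "(2 ^ r * real n) ^ m = real n ^ t * ((2 ^ r) ^ m * inverse (real n) ^ (t - m))" if "m < t" for m
        proof -
          have "real n ^ t = real n ^ m * real n ^ (t - m)" using that by (simp flip: power_add)
          moreover have "real n ^ (t - m) * inverse (real n) ^ (t - m) = 1"
            using elim(4) by (simp flip: power_mult_distrib)
          ultimately show ?thesis by (simp add: mult_ac power_mult_distrib)
        qed
        then have "(\<Sum>m<t. (2 ^ r * real n) ^ m) = real n ^ t * (\<Sum>m<t. (2 ^ r) ^ m * inverse (real n) ^ (t - m))"
          by (simp add: sum_distrib_left)
        then show ?thesis unfolding nt using f0 by simp
      qed
      ultimately show ?thesis by (simp add: D_def left_diff_distrib)
    qed
    have Dpos: "0 \<le> real ((n - r) choose (k - 1)) ^ r - (\<Sum>m<t. (2 ^ r * real n) ^ m)"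
      unfolding Dn using elim(2) f0 by simp
    have rx1: "(real r + 1) * x n \<le> 1" using rx x_nonneg[of n] by (simp add: algebra_simps)
    have vx: "x n - (real r + 1) * (x n)\<^sup>2 = x n * (1 - (real r + 1) * x n)" by (simp add: power2_eq_square algebra_simps)
    have base: "l n * \<psi> n ^ r = D n * (real n ^ (k - 1) / f) ^ r *
        ((x n - (real r + 1) * (x n)\<^sup>2) ^ t * exp (- (real r * y n) - \<epsilon> n) * (1 - (real r)\<^sup>2 * x n))"
    proof -
      have "\<psi> n ^ r = (real n ^ (k - 1) / f) ^ r * (x n ^ t * exp (- (real r * y n)))"
        by (simp add: \<psi>_def f_def y_def t_def power_mult_distrib power_divide power_mult[symmetric] mult.commute exp_of_nat_mult[symmetric])
      moreover have "exp (- (real r * y n) - \<epsilon> n) = exp (- (real r * y n)) * exp (- \<epsilon> n)"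
        by (simp flip: exp_add)
      moreover have "(x n * (1 - (real r + 1) * x n)) ^ t = x n ^ t * (1 - (real r + 1) * x n) ^ t"
        by (rule power_mult_distrib)
      ultimately show ?thesis unfolding vx l_def by (simp only: mult_ac)
    qed
    show ?case
    proof (intro allI impI)
      fix R assume R: "R \<subseteq> {1..n}" "card R = r"
      have lower: "(real ((n - r) choose (k - 1)) ^ r - (\<Sum>m<t. (2 ^ r * real n) ^ m)) *
          ((x n - (real r + 1) * (x n)\<^sup>2) ^ t * (1 - w) ^ (K n * n) * (1 - (real r)\<^sup>2 * x n)) \<le>
          measure_pmf.prob (unif_model n (P n) (K n)) {S. R \<subseteq> low_degree n k S}"
        unfolding x_def t_def w_def
        by (rule low_degree_prob_ge[OF R KP1 KP2 k]) (use Dpos rx1 in \<open>auto simp: t_def x_def\<close>)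
      show "l n * \<psi> n ^ r \<le> measure_pmf.prob (unif_model n (P n) (K n)) {S. R \<subseteq> low_degree n k S}"
      proof (cases "0 \<le> 1 - (real r)\<^sup>2 * x n")
        case True
        have "l n * \<psi> n ^ r \<le> D n * (real n ^ (k - 1) / f) ^ r *
           ((x n - (real r + 1) * (x n)\<^sup>2) ^ t * (1 - w) ^ (K n * n) * (1 - (real r)\<^sup>2 * x n))"
          unfolding base vx using powbound True elim(2) f0 rx1 x_nonneg
          by (intro mult_left_mono mult_right_mono) auto
        then show ?thesis using lower unfolding Dn by (rule order_trans)
      next
        case False
        have "l n \<le> 0"
          unfolding l_def using False elim(2) rx1 by (intro mult_nonneg_nonpos) auto
        moreover have "0 \<le> \<psi> n ^ r" by (simp add: \<psi>_def y_nonneg)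
        ultimately show ?thesis by (meson measure_nonneg mult_nonpos_nonneg order_trans)
      qed
    qed
  qed
  with lim show ?thesis by blast
qed

end

section \<open>Moments of the number of nodes of small degree\<close>

lemma finite_set_unif_model: "K \<le> P \<Longrightarrow> finite (set_pmf (unif_model n P K))"
  unfolding unif_model_def by (rule finite_set_Pi_unif_sets) auto

lemma expectation_card_low_degree_choose:
  assumes "K \<le> P"
  shows "measure_pmf.expectation (unif_model n P K) (\<lambda>S. real (card (low_degree n k S) choose r)) =
    (\<Sum>R\<in>{R. R \<subseteq> {1..n} \<and> card R = r}. measure_pmf.prob (unif_model n P K) {S. R \<subseteq> low_degree n k S})"
proof -
  have "real (card (low_degree n k S) choose r) =
      (\<Sum>R\<in>{R. R \<subseteq> {1..n} \<and> card R = r}. indicator {S. R \<subseteq> low_degree n k S} S)" for S :: "nat \<Rightarrow> nat set"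
  proof -
    have "card (low_degree n k S) choose r = card {R. R \<subseteq> low_degree n k S \<and> card R = r}"
      by (simp add: n_subsets)
    also have "{R. R \<subseteq> low_degree n k S \<and> card R = r} = {R \<in> {R. R \<subseteq> {1..n} \<and> card R = r}. R \<subseteq> low_degree n k S}"
      by (auto simp: low_degree_def)
    finally show ?thesis
      by (simp add: indicator_def sum.If_cases Collect_conj_eq[symmetric] conj_ac Int_def)
  qed
  then show ?thesis
    using finite_set_unif_model[OF assms]
    by (simp add: integrable_measure_pmf_finite)
qed

text \<open>For positive \<open>Y\<close>, Pascal's rule collapses the truncated alternating sum to
  a single binomial coefficient of \<open>Y - 1\<close>. Taking the absolute value merges the two
  Bonferroni inequalities, for even and odd \<open>m\<close>, into one.\<close>

lemma alternating_binomial_bound: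
  "\<bar>(if Y = 0 then 1 else 0) - (\<Sum>r\<le>m. (- 1) ^ r * real (Y choose r))\<bar> \<le> real (Y choose m)"
proof (cases Y)
  case 0
  have "(\<Sum>r\<le>m. (- 1) ^ r * real (0 choose r)) = (\<Sum>r\<in>{0}. (- 1) ^ r * real (0 choose r))"
    by (intro sum.mono_neutral_right) (auto simp: binomial_eq_0)
  then show ?thesis using 0 by simp
next
  case (Suc Y')
  have "(\<Sum>r\<le>m. (- 1) ^ r * real (Suc Y' choose r)) = (- 1) ^ m * real (Y' choose m)"
  proof (induction m)
    case (Suc m)
    then show ?case by (simp add: algebra_simps)
  qed simp
  moreover have "Y' choose m \<le> Suc Y' choose m" by (rule binomial_mono_left) simp
  ultimately show ?thesis using Suc by (simp add: abs_mult)
qed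

context critical
begin

text \<open>The factorial moment divided by \<open>fact r\<close>; in this normalization the
  Bonferroni sums carry no further coefficients.\<close>

definition moment :: "nat \<Rightarrow> nat \<Rightarrow> real" where
  "moment r n = measure_pmf.expectation (unif_model n (P n) (K n)) (\<lambda>S. real (card (low_degree n k S) choose r))"

definition \<mu> :: "nat \<Rightarrow> real" where "\<mu> n = real n * \<psi> n"

lemma moment_asymp: "(\<lambda>n. moment r n / \<mu> n ^ r) \<longlonglongrightarrow> 1 / fact r"
proof -
  obtain u where u: "u \<longlonglongrightarrow> 1" "\<forall>\<^sub>F n in sequentially. \<forall>R. R \<subseteq> {1..n} \<longrightarrow> card R = r \<longrightarrow>
     measure_pmf.prob (unif_model n (P n) (K n)) {S. R \<subseteq> low_degree n k S} \<le> u n * \<psi> n ^ r"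
    using low_degree_upper by blast
  obtain l where l: "l \<longlonglongrightarrow> 1" "\<forall>\<^sub>F n in sequentially. \<forall>R. R \<subseteq> {1..n} \<longrightarrow> card R = r \<longrightarrow>
     l n * \<psi> n ^ r \<le> measure_pmf.prob (unif_model n (P n) (K n)) {S. R \<subseteq> low_degree n k S}"
    using low_degree_lower by blast
  define q where "q n = real (n choose r) * fact r / real n ^ r" for n
  have q: "q \<longlonglongrightarrow> 1" unfolding q_def using binomial_asymp[of 0 r] by simp
  have ev: "\<forall>\<^sub>F n in sequentially. q n / fact r * l n \<le> moment r n / \<mu> n ^ r \<and> moment r n / \<mu> n ^ r \<le> q n / fact r * u n"
    using u(2) l(2) KP y_pos eventually_gt_at_top[of 0]
  proof eventually_elim
    case (elim n)
    have \<psi>0: "0 < \<psi> n" using elim(4) by (simp add: \<psi>_def)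
    have m: "moment r n = (\<Sum>R\<in>{R. R \<subseteq> {1..n} \<and> card R = r}. measure_pmf.prob (unif_model n (P n) (K n)) {S. R \<subseteq> low_degree n k S})"
      unfolding moment_def by (rule expectation_card_low_degree_choose) (use elim in simp)
    have "moment r n \<le> (\<Sum>R\<in>{R. R \<subseteq> {1..n} \<and> card R = r}. u n * \<psi> n ^ r)"
      unfolding m using elim(1) by (intro sum_mono) auto
    also have "\<dots> = real (n choose r) * (u n * \<psi> n ^ r)" by (simp add: n_subsets)
    finally have 1: "moment r n \<le> real (n choose r) * (u n * \<psi> n ^ r)" .
    have "(\<Sum>R\<in>{R. R \<subseteq> {1..n} \<and> card R = r}. l n * \<psi> n ^ r) \<le> moment r n"
      unfolding m using elim(2) by (intro sum_mono) auto
    then have 2: "real (n choose r) * (l n * \<psi> n ^ r) \<le> moment r n" by (simp add: n_subsets)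
    have \<mu>r: "\<mu> n ^ r = real n ^ r * \<psi> n ^ r" "0 < \<mu> n ^ r"
      using \<psi>0 elim(5) by (auto simp: \<mu>_def power_mult_distrib)
    have eq: "q n / fact r * a = real (n choose r) * (a * \<psi> n ^ r) / \<mu> n ^ r" for a
      using \<psi>0 elim(5) by (simp add: q_def \<mu>r(1))
    show ?case
      unfolding eq using 1 2 \<mu>r(2) by (auto intro!: divide_right_mono)
  qed
  have lo: "\<forall>\<^sub>F n in sequentially. q n / fact r * l n \<le> moment r n / \<mu> n ^ r"
    using ev by (rule eventually_mono) simp
  have hi: "\<forall>\<^sub>F n in sequentially. moment r n / \<mu> n ^ r \<le> q n / fact r * u n"
    using ev by (rule eventually_mono) simp
  have "(\<lambda>n. q n / fact r * l n) \<longlonglongrightarrow> 1 / fact r * 1" "(\<lambda>n. q n / fact r * u n) \<longlonglongrightarrow> 1 / fact r * 1"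
    by (intro tendsto_intros q l(1) u(1); simp)+
  then have "(\<lambda>n. moment r n / \<mu> n ^ r) \<longlonglongrightarrow> 1 / fact r * 1" by (rule tendsto_sandwich[OF lo hi])
  then show ?thesis by simp
qed

definition p0 :: "nat \<Rightarrow> real" where
  "p0 n = measure_pmf.prob (unif_model n (P n) (K n)) {S. low_degree n k S = {}}"

lemma \<mu>_pos: "\<forall>\<^sub>F n in sequentially. 0 < \<mu> n"
  using y_pos eventually_gt_at_top[of 0] by eventually_elim (simp add: \<mu>_def \<psi>_def)

lemma moment_tendsto:
  assumes "\<mu> \<longlonglongrightarrow> \<rho>"
  shows "moment r \<longlonglongrightarrow> \<rho> ^ r / fact r"
proof -
  have "(\<lambda>n. moment r n / \<mu> n ^ r * \<mu> n ^ r) \<longlonglongrightarrow> 1 / fact r * \<rho> ^ r"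
    by (intro tendsto_intros moment_asymp assms)
  moreover have "\<forall>\<^sub>F n in sequentially. moment r n / \<mu> n ^ r * \<mu> n ^ r = moment r n"
    using \<mu>_pos by eventually_elim simp
  ultimately show ?thesis by (simp add: tendsto_cong)
qed

lemma p0_bonferroni:
  assumes "K n \<le> P n"
  shows "\<bar>p0 n - (\<Sum>r\<le>m. (- 1) ^ r * moment r n)\<bar> \<le> moment m n"
proof -
  let ?M = "unif_model n (P n) (K n)"
  have int: "integrable (measure_pmf ?M) g" for g :: "(nat \<Rightarrow> nat set) \<Rightarrow> real"
    using finite_set_unif_model[OF assms] by (rule integrable_measure_pmf_finite)
  let ?Y = "\<lambda>S. card (low_degree n k S)"
  have "p0 n = measure_pmf.expectation ?M (\<lambda>S. if ?Y S = 0 then 1 else 0)"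
  proof -
    have "p0 n = measure_pmf.expectation ?M (indicator {S. low_degree n k S = {}})" by (simp add: p0_def)
    also have "\<dots> = measure_pmf.expectation ?M (\<lambda>S. if ?Y S = 0 then 1 else 0)"
      by (intro Bochner_Integration.integral_cong) (auto simp: indicator_def)
    finally show ?thesis .
  qed
  moreover have "(\<Sum>r\<le>m. (- 1) ^ r * moment r n) = measure_pmf.expectation ?M (\<lambda>S. \<Sum>r\<le>m. (- 1) ^ r * real (?Y S choose r))"
    unfolding moment_def using int by simp
  ultimately have "\<bar>p0 n - (\<Sum>r\<le>m. (- 1) ^ r * moment r n)\<bar> =
      \<bar>measure_pmf.expectation ?M (\<lambda>S. (if ?Y S = 0 then 1 else 0) - (\<Sum>r\<le>m. (- 1) ^ r * real (?Y S choose r)))\<bar>"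
    using int by (subst Bochner_Integration.integral_diff) auto
  also have "\<dots> \<le> measure_pmf.expectation ?M (\<lambda>S. \<bar>(if ?Y S = 0 then 1 else 0) - (\<Sum>r\<le>m. (- 1) ^ r * real (?Y S choose r))\<bar>)"
    by (rule integral_abs_bound)
  also have "\<dots> \<le> moment m n"
    unfolding moment_def by (intro integral_mono int alternating_binomial_bound)
  finally show ?thesis .
qed

text \<open>At a fixed truncation \<open>m\<close> all moments converge, and the truncation error is
  at most the \<open>m\<close>-th moment, whose limit is a term of the convergent exponential
  series. So one large \<open>m\<close> serves both for the error and for the tail of the
  series.\<close>

lemma p0_tendsto_exp:
  assumes "\<mu> \<longlonglongrightarrow> \<rho>"
  shows "p0 \<longlonglongrightarrow> exp (- \<rho>)"
proof (rule LIMSEQ_I)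
  fix \<epsilon> :: real assume \<epsilon>: "0 < \<epsilon>"
  have s: "(\<lambda>r. (- \<rho>) ^ r /\<^sub>R fact r) sums exp (- \<rho>)" by (rule exp_converges)
  then have "(\<lambda>m. \<Sum>r\<le>m. (- \<rho>) ^ r /\<^sub>R fact r) \<longlonglongrightarrow> exp (- \<rho>)" by (simp add: sums_def_le)
  then have 1: "\<forall>\<^sub>F m in sequentially. dist (\<Sum>r\<le>m. (- \<rho>) ^ r /\<^sub>R fact r) (exp (- \<rho>)) < \<epsilon> / 4"
    using \<epsilon> by (intro tendstoD) auto
  have "summable (\<lambda>r. \<rho> ^ r /\<^sub>R fact r)" using exp_converges[of \<rho>] by (rule sums_summable)
  then have "(\<lambda>r. \<rho> ^ r /\<^sub>R fact r) \<longlonglongrightarrow> 0" by (rule summable_LIMSEQ_zero)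
  then have 2: "\<forall>\<^sub>F m in sequentially. dist (\<rho> ^ m /\<^sub>R fact m) 0 < \<epsilon> / 4" using \<epsilon> by (intro tendstoD) auto
  obtain m where m: "dist (\<Sum>r\<le>m. (- \<rho>) ^ r /\<^sub>R fact r) (exp (- \<rho>)) < \<epsilon> / 4" "dist (\<rho> ^ m /\<^sub>R fact m) 0 < \<epsilon> / 4"
    using eventually_conj[OF 1 2] by (auto simp: eventually_sequentially)
  have "(\<lambda>n. \<Sum>r\<le>m. (- 1) ^ r * moment r n) \<longlonglongrightarrow> (\<Sum>r\<le>m. (- 1) ^ r * (\<rho> ^ r / fact r))"
    by (intro tendsto_intros moment_tendsto assms)
  also have "(\<Sum>r\<le>m. (- 1) ^ r * (\<rho> ^ r / fact r)) = (\<Sum>r\<le>m. (- \<rho>) ^ r /\<^sub>R fact r)"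
    by (intro sum.cong refl) (simp add: power_minus[of \<rho>] field_simps)
  finally have 3: "\<forall>\<^sub>F n in sequentially. dist (\<Sum>r\<le>m. (- 1) ^ r * moment r n) (\<Sum>r\<le>m. (- \<rho>) ^ r /\<^sub>R fact r) < \<epsilon> / 4"
    using \<epsilon> by (intro tendstoD) auto
  have 4: "\<forall>\<^sub>F n in sequentially. dist (moment m n) (\<rho> ^ m / fact m) < \<epsilon> / 4"
    using \<epsilon> by (intro tendstoD moment_tendsto assms) auto
  have arith: "\<bar>p - E\<bar> < \<epsilon>" if "\<bar>p - a\<bar> \<le> M" "\<bar>z\<bar> < \<epsilon> / 4" "\<bar>a - s\<bar> < \<epsilon> / 4" "\<bar>M - z\<bar> < \<epsilon> / 4" "\<bar>s - E\<bar> < \<epsilon> / 4"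
    for p a M z s E :: real using that by linarith
  have "\<forall>\<^sub>F n in sequentially. norm (p0 n - exp (- \<rho>)) < \<epsilon>"
    using 3 4 KP
  proof eventually_elim
    case (elim n)
    have "\<bar>p0 n - (\<Sum>r\<le>m. (- 1) ^ r * moment r n)\<bar> \<le> moment m n"
      using elim by (intro p0_bonferroni) auto
    moreover have "\<rho> ^ m /\<^sub>R fact m = \<rho> ^ m / fact m" by (simp add: field_simps)
    then have "\<bar>\<rho> ^ m / fact m\<bar> < \<epsilon> / 4" using m(2) unfolding dist_real_def by simp
    ultimately show ?case using elim(1,2) m(1) unfolding dist_real_def real_norm_def by (rule arith)
  qed
  then show "\<exists>no. \<forall>n\<ge>no. norm (p0 n - exp (- \<rho>)) < \<epsilon>" by (simp add: eventually_sequentially)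
qed

lemma p0_tendsto_0:
  assumes "filterlim \<mu> at_top sequentially"
  shows "p0 \<longlonglongrightarrow> 0"
proof -
  \<comment> \<open>The variance of the count divided by its squared mean, expressed by binomial
    moments that are normalized by powers of \<open>\<mu> n\<close>.\<close>
  define g where "g n = (2 * (moment 2 n / \<mu> n ^ 2) + moment 1 n / \<mu> n ^ 1 * inverse (\<mu> n) - (moment 1 n / \<mu> n ^ 1)\<^sup>2) / (moment 1 n / \<mu> n ^ 1)\<^sup>2" for n
  have inv: "(\<lambda>n. inverse (\<mu> n)) \<longlonglongrightarrow> 0" using assms by (rule tendsto_inverse_0_at_top)
  have "g \<longlonglongrightarrow> (2 * (1 / fact 2) + 1 / fact 1 * 0 - (1 / fact 1)\<^sup>2) / (1 / fact 1)\<^sup>2"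
    unfolding g_def by (intro tendsto_intros moment_asymp inv) auto
  then have g: "g \<longlonglongrightarrow> 0" by (simp add: fact_numeral)
  have m1: "\<forall>\<^sub>F n in sequentially. 1 / 2 < moment 1 n / \<mu> n ^ 1"
    using moment_asymp[of 1] by (rule order_tendstoD) simp
  have "\<forall>\<^sub>F n in sequentially. p0 n \<le> g n"
    using \<mu>_pos m1 KP
  proof eventually_elim
    case (elim n)
    let ?M = "unif_model n (P n) (K n)"
    let ?Y = "\<lambda>S. real (card (low_degree n k S))"
    have int: "integrable (measure_pmf ?M) h" for h :: "(nat \<Rightarrow> nat set) \<Rightarrow> real"
      using finite_set_unif_model[of "K n" "P n"] elim(3) by (intro integrable_measure_pmf_finite) auto
    have m1': "moment 1 n = measure_pmf.expectation ?M ?Y" by (simp add: moment_def)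
    have m1pos: "0 < moment 1 n" using elim(1,2) by (simp add: field_simps)
    have sq: "(?Y S - moment 1 n)\<^sup>2 = 2 * real (card (low_degree n k S) choose 2) + ?Y S - 2 * moment 1 n * ?Y S + (moment 1 n)\<^sup>2" for S :: "nat \<Rightarrow> nat set"
    proof -
      have "2 * real (card (low_degree n k S) choose 2) = ?Y S * (?Y S - 1)"
        by (simp add: binomial_gbinomial gbinomial_prod_rev numeral_2_eq_2 field_simps)
      then show ?thesis by (simp add: power2_eq_square algebra_simps)
    qed
    have "p0 n * (moment 1 n)\<^sup>2 = measure_pmf.expectation ?M (\<lambda>S. indicator {S. low_degree n k S = {}} S * (moment 1 n)\<^sup>2)"
      by (simp add: p0_def)
    \<comment> \<open>Where the count vanishes, it deviates from its mean by the whole mean.\<close>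
    also have "\<dots> \<le> measure_pmf.expectation ?M (\<lambda>S. (?Y S - moment 1 n)\<^sup>2)"
      by (intro integral_mono int) (auto simp: indicator_def)
    also have "\<dots> = 2 * moment 2 n + moment 1 n - (moment 1 n)\<^sup>2"
      unfolding sq using int by (simp add: m1'[symmetric] moment_def[of 2, symmetric] power2_eq_square)
    finally have "p0 n \<le> (2 * moment 2 n + moment 1 n - (moment 1 n)\<^sup>2) / (moment 1 n)\<^sup>2"
      using m1pos by (simp add: pos_le_divide_eq)
    also have "\<dots> = ((2 * moment 2 n + moment 1 n - (moment 1 n)\<^sup>2) / (\<mu> n)\<^sup>2) / ((moment 1 n)\<^sup>2 / (\<mu> n)\<^sup>2)"
      using elim(1) by simp
    also have "\<dots> = g n"
      unfolding g_def using elim(1) m1pos by (simp add: field_simps power2_eq_square)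
    finally show ?case .
  qed
  then show ?thesis
    by (intro tendsto_sandwich[OF always_eventually _ tendsto_const g]) (auto simp: p0_def)
qed

end

section \<open>The bound for disconnected graphs vanishes\<close>

lemma power_mult_exp_tendsto_0:
  fixes a b :: real
  assumes "0 < b"
  shows "((\<lambda>z. (a * z) ^ k * exp (- (b * z))) \<longlongrightarrow> 0) at_top"
proof -
  have "filterlim (\<lambda>z. b * z) at_top at_top" using assms by real_asymp
  then have "((\<lambda>z. (b * z) ^ k / exp (b * z)) \<longlongrightarrow> 0) at_top"
    by (rule filterlim_compose[OF tendsto_power_div_exp_0])
  then have "((\<lambda>z. (a / b) ^ k * ((b * z) ^ k / exp (b * z))) \<longlongrightarrow> (a / b) ^ k * 0) at_top"
    by (rule tendsto_mult_left)
  moreover have "(a / b) ^ k * ((b * z) ^ k / exp (b * z)) = (a * z) ^ k * exp (- (b * z))" for z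
    using assms by (simp add: exp_minus divide_inverse flip: power_mult_distrib) (simp add: field_simps power_mult_distrib)
  ultimately show ?thesis by simp
qed

context critical
begin

text \<open>The exponent must exceed \<open>L\<close>, to beat the factor n = exp L, and grow
  linearly in \<open>t\<close>, to give a geometric series. The last factor may drop to 49 / 100
  when \<open>t\<close> is about n / 2, which just suffices from \<open>t = 3\<close> on; for
  \<open>t = 2\<close> it is at least 99 / 100. A single node would gain only about 7 / 8 *
  \<open>y n\<close>, less than \<open>L\<close> when \<open>y n\<close> is near \<open>L\<close>.
  The constant 95 / 100 leaves room for \<open>y n\<close> slightly below ln n.\<close>

lemma small_part_exponent:
  assumes y: "95 / 100 * L \<le> y n" and L: "0 \<le> L" and n: "100 * (k + 2) \<le> n" and t: "2 \<le> t" "2 * t \<le> n"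
  shows "(11 / 10 + (real t - 2) / 10) * L \<le> 7 / 8 * real t * y n * (1 - (real t + real k) / real n)"
proof -
  have n0: "0 < real n" using n by simp
  have rn: "100 * (real k + 2) \<le> real n" using of_nat_mono[OF n, where 'a = real] by simp
  define g where "g = 1 - (real t + real k) / real n"
  have kn: "real k / real n \<le> 1 / 100" using rn n0 by (simp add: divide_simps)
  have tn: "real t / real n \<le> 1 / 2" using t(2) n0 by (simp add: divide_simps)
  have g1: "49 / 100 \<le> g" using kn tn by (simp add: g_def add_divide_distrib)
  have key: "11 / 10 + (real t - 2) / 10 \<le> 7 / 8 * real t * (95 / 100) * g"
  proof (cases "t = 2")
    case True
    have "2 / real n + real k / real n \<le> 1 / 100" using rn n0 by (simp add: divide_simps)
    then have "99 / 100 \<le> g" using True by (simp add: g_def add_divide_distrib)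
    then show ?thesis using True by simp
  next
    case False
    then have t3: "3 \<le> real t" using t(1) by simp
    have "11 / 10 + (real t - 2) / 10 \<le> 7 / 8 * real t * (95 / 100) * (49 / 100)" using t3 by (simp add: field_simps)
    also have "\<dots> \<le> 7 / 8 * real t * (95 / 100) * g" using g1 by (intro mult_left_mono) auto
    finally show ?thesis .
  qed
  have "(11 / 10 + (real t - 2) / 10) * L \<le> (7 / 8 * real t * (95 / 100) * g) * L" using key L by (rule mult_right_mono)
  also have "\<dots> = 7 / 8 * real t * g * (95 / 100 * L)" by simp
  also have "\<dots> \<le> 7 / 8 * real t * g * y n" using y g1 by (intro mult_left_mono) auto
  finally show ?thesis unfolding g_def by (simp only: mult_ac)
qed

text \<open>The base of everything exponential in \<open>t\<close>: 2 and \<open>2 ^ k\<close> from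
  \<open>t \<le> 2 ^ t\<close>, \<open>exp 1\<close> from choosing the nodes, and 4 from
  \<open>y n \<le> 4 * ln n\<close>.\<close>

definition C0 :: real where "C0 = 8 * exp 1 * 2 ^ k"

lemma small_part_term_le:
  assumes n: "100 * (k + 2) \<le> n" and L1: "1 \<le> ln (real n)"
    and y: "95 / 100 * ln (real n) \<le> y n" "y n \<le> 4 * ln (real n)" and t: "2 \<le> t" "2 * t \<le> n"
  shows "small_part_term n k (y n) t \<le>
    (real k * (4 * ln (real n)) ^ k * (C0 * ln (real n))\<^sup>2 * exp (- (1 / 10 * ln (real n)))) * (C0 * ln (real n) * exp (- (1 / 10 * ln (real n)))) ^ (t - 2)"
proof -
  define L where "L = ln (real n)"
  have n0: "0 < real n" using n by simp
  have nL: "real n = exp L" using n0 by (simp add: L_def)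
  have L1': "1 \<le> L" using L1 by (simp add: L_def)
  have y': "95 / 100 * L \<le> y n" "y n \<le> 4 * L" using y by (simp_all add: L_def)
  have t2: "real t \<le> 2 ^ t" using of_nat_less_two_power[of t, where 'a = real] by linarith
  have e1: "y n ^ (t - 1) \<le> (4 * L) ^ t"
  proof -
    have "y n ^ (t - 1) \<le> (4 * L) ^ (t - 1)" using y'(2) y_nonneg by (intro power_mono) auto
    also have "\<dots> \<le> (4 * L) ^ t" using L1' by (intro power_increasing) auto
    finally show ?thesis .
  qed
  have e2: "(real t * y n) ^ k \<le> (2 ^ t * (4 * L)) ^ k"
    using t2 y'(2) y_nonneg by (intro power_mono mult_mono) auto
  have e3: "exp (- (7 / 8 * real t * y n * (1 - (real t + real k) / real n))) \<le> exp (- ((11 / 10 + (real t - 2) / 10) * L))"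
    using small_part_exponent[OF y'(1) _ n t] L1' by simp
  have "small_part_term n k (y n) t \<le> real k * real n * 2 ^ t * exp (real t) * (4 * L) ^ t * (2 ^ t * (4 * L)) ^ k *
      exp (- ((11 / 10 + (real t - 2) / 10) * L))"
    unfolding small_part_term_def using t2 e1 e2 e3 y_nonneg[of n] L1'
    by (intro mult_mono) (auto intro!: mult_nonneg_nonneg)
  also have "\<dots> = real k * (4 * L) ^ k * (2 ^ t * exp (real t) * (4 * L) ^ t * (2 ^ t) ^ k) * (exp L * exp (- ((11 / 10 + (real t - 2) / 10) * L)))"
    by (simp add: nL power_mult_distrib mult_ac)
  also have "2 ^ t * exp (real t) * (4 * L) ^ t * (2 ^ t) ^ k = (C0 * L) ^ t"
  proof -
    have "exp (real t) = exp 1 ^ t" by (simp flip: exp_of_nat_mult)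
    moreover have "((2::real) ^ t) ^ k = (2 ^ k) ^ t" by (simp add: power_mult[symmetric] mult.commute)
    ultimately have "2 ^ t * exp (real t) * (4 * L) ^ t * (2 ^ t) ^ k = (2 * exp 1 * (4 * L) * 2 ^ k) ^ t"
      by (simp only: power_mult_distrib)
    then show ?thesis by (simp add: C0_def mult_ac)
  qed
  \<comment> \<open>Of the exponent, \<open>L\<close> cancels the factor n; one tenth of
    \<open>L\<close> is left over, and another tenth for each node beyond the second.\<close>
  also have "exp L * exp (- ((11 / 10 + (real t - 2) / 10) * L)) = exp (- (1 / 10 * L)) * exp (- (1 / 10 * L)) ^ (t - 2)"
  proof -
    have "real (t - 2) = real t - 2" using t by simp
    then show ?thesis by (simp add: exp_of_nat_mult[symmetric] exp_add[symmetric] algebra_simps)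
  qed
  also have "(C0 * L) ^ t = (C0 * L)\<^sup>2 * (C0 * L) ^ (t - 2)" 
    using t(1) by (metis le_add_diff_inverse power_add)
  finally have le: "small_part_term n k (y n) t \<le>
      real k * (4 * L) ^ k * ((C0 * L)\<^sup>2 * (C0 * L) ^ (t - 2)) * (exp (- (1 / 10 * L)) * exp (- (1 / 10 * L)) ^ (t - 2))" .
  have eq: "(C0 * L * exp (- (1 / 10 * L))) ^ (t - 2) = (C0 * L) ^ (t - 2) * exp (- (1 / 10 * L)) ^ (t - 2)"
    by (rule power_mult_distrib)
  show ?thesis using le unfolding L_def[symmetric] eq by (simp only: mult_ac)
qed

lemma small_parts_tendsto:
  assumes y95: "\<forall>\<^sub>F n in sequentially. 95 / 100 * ln (real n) \<le> y n"
  shows "(\<lambda>n. \<Sum>t\<in>{2..n div 2}. small_part_term n k (y n) t) \<longlonglongrightarrow> 0"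
proof -
  define G where "G L = real k * (4 * L) ^ k * (C0 * L)\<^sup>2 * exp (- (1 / 10 * L))" for L
  define q where "q L = C0 * L * exp (- (1 / 10 * L))" for L :: real
  have C0: "0 < C0" by (simp add: C0_def)
  have q0: "(q \<longlongrightarrow> 0) at_top" unfolding q_def using C0 by real_asymp
  \<comment> \<open>Each of the two polynomial factors receives one half of the exponential.\<close>
  have "((\<lambda>L. real k * ((4 * L) ^ k * exp (- (1 / 20 * L))) * ((C0 * L) ^ 2 * exp (- (1 / 20 * L)))) \<longlongrightarrow> real k * 0 * 0) at_top"
    by (intro tendsto_mult tendsto_const power_mult_exp_tendsto_0) auto
  moreover have "real k * ((4 * L) ^ k * exp (- (1 / 20 * L))) * ((C0 * L) ^ 2 * exp (- (1 / 20 * L))) = G L" for L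
  proof -
    have "exp (- (1 / 10 * L)) = exp (- (1 / 20 * L)) * exp (- (1 / 20 * L))" by (simp flip: exp_add)
    then show ?thesis by (simp add: G_def)
  qed
  ultimately have G0: "(G \<longlongrightarrow> 0) at_top" by simp
  have qn: "\<forall>\<^sub>F n in sequentially. q (ln (real n)) < 1 / 2"
    using filterlim_compose[OF q0 filterlim_ln_nat] by (rule order_tendstoD) simp
  have L1: "\<forall>\<^sub>F n in sequentially. 1 \<le> ln (real n)" using filterlim_ln_nat by (simp add: filterlim_at_top)
  have hi: "\<forall>\<^sub>F n in sequentially. (\<Sum>t\<in>{2..n div 2}. small_part_term n k (y n) t) \<le> 2 * G (ln (real n))"
    using y95 y_le qn L1 eventually_ge_at_top[of "100 * (k + 2)"]
  proof eventually_elim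
    case (elim n)
    define L where "L = ln (real n)"
    have G_nonneg: "0 \<le> G L" using elim(4) by (simp add: G_def L_def)
    have q_nonneg: "0 \<le> q L" using elim(4) C0 by (simp add: q_def L_def)
    have "(\<Sum>t\<in>{2..n div 2}. small_part_term n k (y n) t) \<le> (\<Sum>t\<in>{2..n div 2}. G L * q L ^ (t - 2))"
    proof (rule sum_mono)
      fix t assume "t \<in> {2..n div 2}"
      then have "2 \<le> t" "2 * t \<le> n" by auto
      then show "small_part_term n k (y n) t \<le> G L * q L ^ (t - 2)"
        unfolding G_def q_def L_def using elim by (intro small_part_term_le) auto
    qed
    also have "\<dots> = G L * (\<Sum>t\<in>{2..n div 2}. q L ^ (t - 2))" by (simp add: sum_distrib_left)
    also have "(\<Sum>t\<in>{2..n div 2}. q L ^ (t - 2)) = (\<Sum>i\<in>{0..<0 + (n div 2 - 1)}. q L ^ i)"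
      by (rule sum.reindex_bij_witness[of _ "\<lambda>i. i + 2" "\<lambda>t. t - 2"]) auto
    also have "G L * (\<Sum>i\<in>{0..<0 + (n div 2 - 1)}. q L ^ i) \<le> G L * (2 * q L ^ 0)"
      using q_nonneg elim(3) G_nonneg by (intro mult_left_mono sum_power_half_le) (auto simp: L_def)
    finally show ?case by (simp add: L_def)
  qed
  have "(\<lambda>n. 2 * G (ln (real n))) \<longlonglongrightarrow> 2 * 0"
    by (intro tendsto_intros filterlim_compose[OF G0 filterlim_ln_nat])
  then have lim: "(\<lambda>n. 2 * G (ln (real n))) \<longlonglongrightarrow> 0" by simp
  have lo: "\<forall>\<^sub>F n in sequentially. 0 \<le> (\<Sum>t\<in>{2..n div 2}. small_part_term n k (y n) t)"
    by (intro always_eventually allI sum_nonneg) (simp add: small_part_term_def y_nonneg)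
  show ?thesis by (rule tendsto_sandwich[OF lo hi tendsto_const lim])
qed

text \<open>The lower bound on the set sizes enters here a second time: ln n is at most (K / c)^2,
  so n * K / P = y / K is at most linear in K and loses against exp (- 3 * K).\<close>

lemma expansion_bound_tendsto:
  "(\<lambda>n. exp 33 * (real n * real (K n) / real (P n)) * exp (- 3 * real (K n))) \<longlonglongrightarrow> 0"
proof -
  have lim: "((\<lambda>z. exp 33 * (4 / c\<^sup>2 * z) * exp (- 3 * z)) \<longlongrightarrow> 0) at_top" using c by real_asymp
  have "\<forall>\<^sub>F n in sequentially. exp 33 * (real n * real (K n) / real (P n)) * exp (- 3 * real (K n)) \<le>
      exp 33 * (4 / c\<^sup>2 * real (K n)) * exp (- 3 * real (K n))"
    using y_le KP K_ge eventually_gt_at_top[of 1]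
  proof eventually_elim
    case (elim n)
    have L: "0 < ln (real n)" using elim by simp
    have K1: "0 < real (K n)" using elim by simp
    have "(c * sqrt (ln (real n)))\<^sup>2 \<le> (real (K n))\<^sup>2" using elim(3) c L by (intro power_mono) auto
    then have LK: "ln (real n) \<le> (real (K n))\<^sup>2 / c\<^sup>2" using c L by (simp add: power_mult_distrib field_simps)
    have "real n * real (K n) / real (P n) = y n / real (K n)" using K1 by (simp add: y_def x_def power2_eq_square)
    also have "\<dots> \<le> 4 * ((real (K n))\<^sup>2 / c\<^sup>2) / real (K n)" using elim(1) LK K1 by (intro divide_right_mono) auto
    also have "\<dots> = 4 / c\<^sup>2 * real (K n)" using K1 by (simp add: power2_eq_square)
    finally show ?case by (intro mult_right_mono mult_left_mono) auto
  qed
  then show ?thesis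
    by (intro tendsto_sandwich[OF always_eventually _ tendsto_const filterlim_compose[OF lim K_at_top]]) auto
qed

lemma large_parts_tendsto:
  "(\<lambda>n. 4 ^ n * y n ^ k * exp (- (7 / 16 * exp (- 32) * real (K n) * (real n / 2 - real k)))) \<longlonglongrightarrow> 0"
proof -
  have lim: "((\<lambda>z. (4 * z) ^ k * exp (- (2 * z))) \<longlongrightarrow> (0::real)) at_top" by (rule power_mult_exp_tendsto_0) simp
  \<comment> \<open>This makes the rate in front of n / 2 - k, which is at least n / 4, no smaller
    than 16; the resulting exp (- 4 * n) beats the at most exp (2 * n) pairs of sets.\<close>
  have K16: "\<forall>\<^sub>F n in sequentially. 16 / (7 / 16 * exp (- 32)) \<le> real (K n)"
    using K_at_top by (simp add: filterlim_at_top)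
  have four: "(4::real) \<le> exp 2"
  proof -
    have "(2::real) \<le> exp 1" using exp_ge_add_one_self[of 1] by simp
    then have "(2::real) * 2 \<le> exp 1 * exp 1" by (intro mult_mono) auto
    then show ?thesis by (simp flip: exp_add)
  qed
  have "\<forall>\<^sub>F n in sequentially. 4 ^ n * y n ^ k * exp (- (7 / 16 * exp (- 32) * real (K n) * (real n / 2 - real k))) \<le>
      (4 * real n) ^ k * exp (- (2 * real n))"
    using y_le K16 eventually_ge_at_top[of "4 * k + 1"]
  proof eventually_elim
    case (elim n)
    have n1: "1 \<le> real n" using elim(3) by simp
    have nk: "real n / 4 \<le> real n / 2 - real k" using elim(3) by simp
    have "16 \<le> 7 / 16 * exp (- 32) * real (K n)" using elim(2) by (simp add: field_simps)
    then have "16 * (real n / 4) \<le> 7 / 16 * exp (- 32) * real (K n) * (real n / 2 - real k)"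
      using nk n1 by (intro mult_mono) auto
    then have e: "exp (- (7 / 16 * exp (- 32) * real (K n) * (real n / 2 - real k))) \<le> exp (- (4 * real n))" by simp
    have "ln (real n) \<le> real n" using n1 ln_le_minus_one[of "real n"] by simp
    then have yk: "y n ^ k \<le> (4 * real n) ^ k" using elim(1) y_nonneg by (intro power_mono) auto
    have f: "(4::real) ^ n \<le> exp (2 * real n)"
      using power_mono[OF four, of n] by (simp add: exp_of_nat_mult[symmetric] mult.commute)
    have "4 ^ n * y n ^ k * exp (- (7 / 16 * exp (- 32) * real (K n) * (real n / 2 - real k))) \<le>
        exp (2 * real n) * (4 * real n) ^ k * exp (- (4 * real n))"
      using e yk f y_nonneg by (intro mult_mono) auto
    also have "\<dots> = (4 * real n) ^ k * (exp (2 * real n) * exp (- (4 * real n)))" by (simp only: mult_ac)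
    also have "exp (2 * real n) * exp (- (4 * real n)) = exp (- (2 * real n))" by (simp flip: exp_add)
    finally show ?case .
  qed
  moreover have "\<forall>n. 0 \<le> 4 ^ n * y n ^ k * exp (- (7 / 16 * exp (- 32) * real (K n) * (real n / 2 - real k)))"
    using y_nonneg by simp
  ultimately show ?thesis
    by (intro tendsto_sandwich[OF always_eventually _ tendsto_const filterlim_compose[OF lim filterlim_real_sequentially]])
qed

lemma connectivity_gap_tendsto:
  assumes y95: "\<forall>\<^sub>F n in sequentially. 95 / 100 * ln (real n) \<le> y n"
  shows "(\<lambda>n. measure_pmf.prob (unif_model n (P n) (K n)) {S. low_degree n k S = {} \<and> \<not> k_connected k (intersection_graph n S)}) \<longlonglongrightarrow> 0"
proof -
  define b where "b n = exp 33 * (real n * real (K n) / real (P n)) * exp (- 3 * real (K n))" for n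
  have b: "b \<longlonglongrightarrow> 0" unfolding b_def by (rule expansion_bound_tendsto)
  have b12: "\<forall>\<^sub>F n in sequentially. b n < 1 / 2" using b by (rule order_tendstoD) simp
  have K8: "\<forall>\<^sub>F n in sequentially. 8 \<le> real (K n)" using K_at_top unfolding filterlim_at_top by blast
  have xs: "\<forall>\<^sub>F n in sequentially. x n < exp (- 32) / 2" using x_tendsto by (rule order_tendstoD) simp
  have hi: "\<forall>\<^sub>F n in sequentially. measure_pmf.prob (unif_model n (P n) (K n)) {S. low_degree n k S = {} \<and> \<not> k_connected k (intersection_graph n S)} \<le>
     2 * (b n)\<^sup>2 + (\<Sum>t\<in>{2..n div 2}. small_part_term n k (y n) t) +
     4 ^ n * y n ^ k * exp (- (7 / 16 * exp (- 32) * real (K n) * (real n / 2 - real k)))"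
    using b12 K8 xs KP y_pos eventually_gt_at_top[of "2 * k"]
  proof eventually_elim
    case (elim n)
    have K0: "0 < real (K n)" and P0: "0 < real (P n)" using elim(4) by auto
    \<comment> \<open>The largest part size, before rounding, for which the expansion bound applies.
      As it exceeds 2, rounding down loses at most half of it.\<close>
    define z where "z = exp (- 32) * real (P n) / real (K n)"
    define t0 where "t0 = nat \<lfloor>z\<rfloor>"
    have "real (K n) / real (P n) \<le> x n"
      unfolding x_def using elim(4) P0 by (intro divide_right_mono) (auto simp: power2_eq_square)
    then have "real (K n) / real (P n) < exp (- 32) / 2" using elim(3) by linarith
    then have z2: "2 < z" using K0 P0 by (simp add: z_def field_simps)
    then have "2 \<le> t0" unfolding t0_def by (simp add: le_nat_iff le_floor_iff)
    moreover have t0z: "real t0 \<le> z" unfolding t0_def using z2 by (intro of_nat_floor) simp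
    then have "real t0 * real (K n) \<le> exp (- 32) * real (P n)" using K0 by (simp add: z_def field_simps)
    moreover have "z < real t0 + 1" unfolding t0_def using z2 by linarith
    then have "z \<le> 2 * real t0" using \<open>2 \<le> t0\<close> by simp
    then have "exp (- 32) * real (P n) \<le> 2 * real t0 * real (K n)" using K0 by (simp add: z_def field_simps)
    ultimately show ?case
      unfolding b_def y_def x_def
      using elim by (intro prob_not_connected_min_degree_le[of k n "K n" "P n" t0]) (auto simp: b_def y_def x_def)
  qed
  have "(\<lambda>n. 2 * (b n)\<^sup>2 + (\<Sum>t\<in>{2..n div 2}. small_part_term n k (y n) t) +
     4 ^ n * y n ^ k * exp (- (7 / 16 * exp (- 32) * real (K n) * (real n / 2 - real k)))) \<longlonglongrightarrow> 2 * 0\<^sup>2 + 0 + 0"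
    by (intro tendsto_intros b small_parts_tendsto[OF y95] large_parts_tendsto)
  then have lim: "(\<lambda>n. 2 * (b n)\<^sup>2 + (\<Sum>t\<in>{2..n div 2}. small_part_term n k (y n) t) +
     4 ^ n * y n ^ k * exp (- (7 / 16 * exp (- 32) * real (K n) * (real n / 2 - real k)))) \<longlonglongrightarrow> 0" by simp
  show ?thesis by (rule tendsto_sandwich[OF _ hi tendsto_const lim]) simp
qed

definition pk :: "nat \<Rightarrow> real" where
  "pk n = measure_pmf.prob (unif_model n (P n) (K n)) {S. k_connected k (intersection_graph n S)}"

text \<open>k-connectivity implies the degree condition, and the converse fails only with vanishing
  probability, so the two limits coincide.\<close>

lemma pk_tendsto:
  assumes y95: "\<forall>\<^sub>F n in sequentially. 95 / 100 * ln (real n) \<le> y n" and p0: "p0 \<longlonglongrightarrow> a"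
  shows "pk \<longlonglongrightarrow> a"
proof -
  define gap where "gap n = measure_pmf.prob (unif_model n (P n) (K n)) {S. low_degree n k S = {} \<and> \<not> k_connected k (intersection_graph n S)}" for n
  have gap: "gap \<longlonglongrightarrow> 0" unfolding gap_def by (rule connectivity_gap_tendsto[OF y95])
  have lo: "\<forall>\<^sub>F n in sequentially. p0 n - gap n \<le> pk n"
  proof (intro always_eventually allI)
    fix n
    have "p0 n \<le> measure_pmf.prob (unif_model n (P n) (K n))
       ({S. k_connected k (intersection_graph n S)} \<union> {S. low_degree n k S = {} \<and> \<not> k_connected k (intersection_graph n S)})"
      unfolding p0_def by (intro measure_pmf.finite_measure_mono) auto
    also have "\<dots> \<le> pk n + gap n" unfolding pk_def gap_def by (intro measure_Un_le) auto
    finally show "p0 n - gap n \<le> pk n" by simp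
  qed
  have hi: "\<forall>\<^sub>F n in sequentially. pk n \<le> p0 n"
    using eventually_ge_at_top[of 2]
    by eventually_elim (auto simp: pk_def p0_def intro!: measure_pmf.finite_measure_mono low_degree_empty_if_k_connected)
  have "(\<lambda>n. p0 n - gap n) \<longlonglongrightarrow> a - 0" by (intro tendsto_intros p0 gap)
  then have lim: "(\<lambda>n. p0 n - gap n) \<longlonglongrightarrow> a" by simp
  show ?thesis by (rule tendsto_sandwich[OF lo hi lim p0])
qed

end

subsection \<open>Reduction to sets of equal size\<close>

definition threshold :: "nat \<Rightarrow> nat \<Rightarrow> real" where
  "threshold k n = ln (real n) + (real k - 1) * ln (ln (real n))"

lemma ln_ln_bounds: "\<forall>\<^sub>F n in sequentially. 1 \<le> ln (real n) \<and> 0 \<le> ln (ln (real n)) \<and> ln (ln (real n)) \<le> ln (real n)"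
proof -
  have "\<forall>\<^sub>F n in sequentially. 1 \<le> ln (real n)" using filterlim_ln_nat by (simp add: filterlim_at_top)
  then show ?thesis
  proof eventually_elim
    case (elim n)
    then show ?case using ln_le_minus_one[of "ln (real n)"] by simp
  qed
qed

lemma threshold_ratio: "(\<lambda>n. threshold k n / ln (real n)) \<longlonglongrightarrow> 1"
proof -
  have "(\<lambda>n. 1 + (real k - 1) * (ln (ln (real n)) / ln (real n))) \<longlonglongrightarrow> 1 + (real k - 1) * 0"
    by (intro tendsto_intros) real_asymp
  moreover have "\<forall>\<^sub>F n in sequentially. 1 + (real k - 1) * (ln (ln (real n)) / ln (real n)) = threshold k n / ln (real n)"
    using ln_ln_bounds by eventually_elim (simp add: threshold_def add_divide_distrib)
  ultimately show ?thesis by (simp add: tendsto_cong)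
qed

lemma threshold_ge: "1 \<le> k \<Longrightarrow> \<forall>\<^sub>F n in sequentially. ln (real n) \<le> threshold k n"
  using ln_ln_bounds by eventually_elim (simp add: threshold_def)

lemma threshold_le: "\<forall>\<^sub>F n in sequentially. threshold k n \<le> 3 / 2 * ln (real n)"
proof -
  have "\<forall>\<^sub>F n in sequentially. threshold k n / ln (real n) < 3 / 2" using threshold_ratio by (rule order_tendstoD) simp
  then show ?thesis using ln_ln_bounds by eventually_elim (simp add: divide_simps split: if_splits)
qed

text \<open>The ln ln term of the threshold puts L^(k - 1) into the denominator of n * exp (- y),
  with L = ln n. This offsets the power y^(k - 1) of the Poisson weight, and exp (- \<alpha>)
  decides.\<close>

lemma (in critical) \<mu>_eq:
  assumes "1 \<le> ln (real n)" and y: "y n = threshold k n + \<alpha>"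
  shows "\<mu> n = (y n / ln (real n)) ^ (k - 1) * exp (- \<alpha>) / fact (k - 1)"
proof -
  define L where "L = ln (real n)"
  have n0: "0 < real n" using assms(1) by (cases "n = 0") auto
  have L: "0 < L" "real n = exp L" using assms(1) n0 unfolding L_def by (linarith, simp)
  have "exp (- y n) = exp (- L) * exp (- (real (k - 1) * ln L)) * exp (- \<alpha>)"
    unfolding y threshold_def L_def[symmetric] using k by (simp add: exp_add[symmetric] of_nat_diff algebra_simps)
  also have "exp (- (real (k - 1) * ln L)) = 1 / L ^ (k - 1)"
    using L(1) by (simp add: exp_minus exp_of_nat_mult inverse_eq_divide)
  finally have nexp: "real n * exp (- y n) = exp (- \<alpha>) / L ^ (k - 1)"
    unfolding L(2) by (simp add: exp_minus field_simps)
  have "\<mu> n = y n ^ (k - 1) / fact (k - 1) * (real n * exp (- y n))"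
    by (simp add: \<mu>_def \<psi>_def)
  then have "\<mu> n = y n ^ (k - 1) / fact (k - 1) * (exp (- \<alpha>) / L ^ (k - 1))" unfolding nexp .
  then show ?thesis by (simp add: L_def power_divide)
qed

section \<open>Limits for equal set sizes\<close>

locale uniform_sequence =
  fixes K P :: "nat \<Rightarrow> nat" and k :: nat and c :: real and \<alpha> :: "nat \<Rightarrow> real"
  assumes k: "1 \<le> k" and c: "0 < c"
    and KP: "\<forall>\<^sub>F n in sequentially. 1 \<le> K n \<and> K n \<le> P n"
    and K_ge: "\<forall>\<^sub>F n in sequentially. c * sqrt (ln (real n)) \<le> real (K n)"
    and alpha: "\<forall>\<^sub>F n in sequentially. real n * ((real (K n))\<^sup>2 / real (P n)) = threshold k n + \<alpha> n"
begin

abbreviation prob_deg :: "nat \<Rightarrow> real" where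
  "prob_deg n \<equiv> measure_pmf.prob (unif_model n (P n) (K n)) {S. low_degree n k S = {}}"

abbreviation prob_conn :: "nat \<Rightarrow> real" where
  "prob_conn n \<equiv> measure_pmf.prob (unif_model n (P n) (K n)) {S. k_connected k (intersection_graph n S)}"

lemma limit_finite:
  assumes "\<alpha> \<longlonglongrightarrow> a"
  shows "prob_deg \<longlonglongrightarrow> exp (- (exp (- a) / fact (k - 1)))" "prob_conn \<longlonglongrightarrow> exp (- (exp (- a) / fact (k - 1)))"
proof -
  have "(\<lambda>n. \<alpha> n * inverse (ln (real n))) \<longlonglongrightarrow> a * 0"
    by (intro tendsto_intros assms tendsto_inverse_0_at_top filterlim_ln_nat)
  then have "(\<lambda>n. threshold k n / ln (real n) + \<alpha> n * inverse (ln (real n))) \<longlonglongrightarrow> 1 + 0"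
    by (intro tendsto_intros threshold_ratio) simp
  moreover have "\<forall>\<^sub>F n in sequentially. threshold k n / ln (real n) + \<alpha> n * inverse (ln (real n)) =
      real n * ((real (K n))\<^sup>2 / real (P n)) / ln (real n)"
    using alpha
  proof eventually_elim
    case (elim n)
    show ?case unfolding elim by (simp add: divide_inverse distrib_right)
  qed
  ultimately have ratio: "(\<lambda>n. real n * ((real (K n))\<^sup>2 / real (P n)) / ln (real n)) \<longlonglongrightarrow> 1"
    by (simp add: tendsto_cong)
  have lo: "\<forall>\<^sub>F n in sequentially. 95 / 100 < real n * ((real (K n))\<^sup>2 / real (P n)) / ln (real n)"
    using ratio by (rule order_tendstoD) simp
  have hi: "\<forall>\<^sub>F n in sequentially. real n * ((real (K n))\<^sup>2 / real (P n)) / ln (real n) < 4"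
    using ratio by (rule order_tendstoD) simp
  have lo': "\<forall>\<^sub>F n in sequentially. 95 / 100 * ln (real n) \<le> real n * ((real (K n))\<^sup>2 / real (P n))"
    using lo ln_ln_bounds
  proof eventually_elim
    case (elim n)
    then have "0 < ln (real n)" by linarith
    from elim(1)[unfolded pos_less_divide_eq[OF this]] show ?case by (rule less_imp_le)
  qed
  have hi': "\<forall>\<^sub>F n in sequentially. real n * ((real (K n))\<^sup>2 / real (P n)) \<le> 4 * ln (real n)"
    using hi ln_ln_bounds
  proof eventually_elim
    case (elim n)
    then have "0 < ln (real n)" by linarith
    from elim(1)[unfolded pos_divide_less_eq[OF this]] show ?case by (rule less_imp_le)
  qed
  interpret critical K P k c
  proof
    show "\<forall>\<^sub>F n in sequentially. ln (real n) / 8 \<le> real n * ((real (K n))\<^sup>2 / real (P n))"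
      using lo' ln_ln_bounds by eventually_elim linarith
  qed (use k c KP K_ge hi' in auto)
  have y_eq: "y n = real n * ((real (K n))\<^sup>2 / real (P n))" for n by (simp add: y_def x_def)
  have "(\<lambda>n. (y n / ln (real n)) ^ (k - 1) * exp (- \<alpha> n) / fact (k - 1)) \<longlonglongrightarrow> 1 ^ (k - 1) * exp (- a) / fact (k - 1)"
    unfolding y_eq by (intro tendsto_intros ratio assms) simp
  moreover have "\<forall>\<^sub>F n in sequentially. (y n / ln (real n)) ^ (k - 1) * exp (- \<alpha> n) / fact (k - 1) = \<mu> n"
    using alpha ln_ln_bounds
  proof eventually_elim
    case (elim n)
    show ?case by (rule \<mu>_eq[symmetric]) (use elim in \<open>simp_all only: y_eq\<close>)
  qed
  ultimately have "\<mu> \<longlonglongrightarrow> exp (- a) / fact (k - 1)" by (simp add: tendsto_cong)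
  then have p0: "p0 \<longlonglongrightarrow> exp (- (exp (- a) / fact (k - 1)))" by (rule p0_tendsto_exp)
  then show "prob_deg \<longlonglongrightarrow> exp (- (exp (- a) / fact (k - 1)))" by (simp add: p0_def[abs_def])
  have "pk \<longlonglongrightarrow> exp (- (exp (- a) / fact (k - 1)))"
    by (rule pk_tendsto[OF _ p0]) (use lo' in \<open>simp add: y_eq\<close>)
  then show "prob_conn \<longlonglongrightarrow> exp (- (exp (- a) / fact (k - 1)))" by (simp add: pk_def[abs_def])
qed

text \<open>With \<open>y\<close> at most 4 * ln n, the factor (y / ln n)^(k - 1) of the mean stays
  bounded, so the mean vanishes together with exp (- \<alpha>) and the Poisson limit applies with
  mean 0.\<close>

lemma limit_top_bounded:
  assumes top: "filterlim \<alpha> at_top sequentially"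
    and hi: "\<forall>\<^sub>F n in sequentially. real n * ((real (K n))\<^sup>2 / real (P n)) \<le> 4 * ln (real n)"
  shows "prob_deg \<longlonglongrightarrow> 1" "prob_conn \<longlonglongrightarrow> 1"
proof -
  have \<alpha>0: "\<forall>\<^sub>F n in sequentially. 0 \<le> \<alpha> n" using top unfolding filterlim_at_top by blast
  have lo: "\<forall>\<^sub>F n in sequentially. ln (real n) \<le> real n * ((real (K n))\<^sup>2 / real (P n))"
    using alpha \<alpha>0 threshold_ge[OF k] by eventually_elim simp
  interpret critical K P k c
  proof
    show "\<forall>\<^sub>F n in sequentially. ln (real n) / 8 \<le> real n * ((real (K n))\<^sup>2 / real (P n))"
      using lo ln_ln_bounds by eventually_elim linarith
  qed (use k c KP K_ge hi in auto)
  have y_eq: "y n = real n * ((real (K n))\<^sup>2 / real (P n))" for n by (simp add: y_def x_def)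
  have "((\<lambda>z. 4 ^ (k - 1) * exp (- z) / fact (k - 1)) \<longlongrightarrow> (0::real)) at_top" by real_asymp
  from filterlim_compose[OF this top]
  have up: "(\<lambda>n. 4 ^ (k - 1) * exp (- \<alpha> n) / fact (k - 1)) \<longlonglongrightarrow> 0" .
  have "\<forall>\<^sub>F n in sequentially. \<mu> n \<le> 4 ^ (k - 1) * exp (- \<alpha> n) / fact (k - 1)"
    using alpha ln_ln_bounds hi
  proof eventually_elim
    case (elim n)
    have "\<mu> n = (y n / ln (real n)) ^ (k - 1) * exp (- \<alpha> n) / fact (k - 1)"
      using elim by (intro \<mu>_eq) (auto simp: y_eq)
    also have "\<dots> \<le> 4 ^ (k - 1) * exp (- \<alpha> n) / fact (k - 1)"
    proof (intro divide_right_mono mult_right_mono power_mono)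
      show "y n / ln (real n) \<le> 4" using elim by (simp add: y_eq pos_divide_le_eq)
      show "0 \<le> y n / ln (real n)" using elim y_nonneg by simp
    qed auto
    finally show ?case .
  qed
  moreover have "\<forall>\<^sub>F n in sequentially. 0 \<le> \<mu> n" using \<mu>_pos by eventually_elim simp
  ultimately have "\<mu> \<longlonglongrightarrow> 0" by (rule tendsto_sandwich[rotated, OF _ tendsto_const up])
  then have "p0 \<longlonglongrightarrow> exp (- 0)" by (rule p0_tendsto_exp)
  then have p0: "p0 \<longlonglongrightarrow> 1" by simp
  then show "prob_deg \<longlonglongrightarrow> 1" by (simp add: p0_def[abs_def])
  have "\<forall>\<^sub>F n in sequentially. 95 / 100 * ln (real n) \<le> y n"
    unfolding y_eq using lo ln_ln_bounds by eventually_elim linarith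
  then have "pk \<longlonglongrightarrow> 1" using p0 by (rule pk_tendsto)
  then show "prob_conn \<longlonglongrightarrow> 1" by (simp add: pk_def[abs_def])
qed

text \<open>Here (y / ln n)^(k - 1) is bounded away from 0, so the mean grows at least like exp (-
  \<alpha>); the second moment method replaces the Poisson limit.\<close>

lemma limit_bot_bounded:
  assumes bot: "filterlim \<alpha> at_bot sequentially"
    and lo: "\<forall>\<^sub>F n in sequentially. ln (real n) / 8 \<le> real n * ((real (K n))\<^sup>2 / real (P n))"
  shows "prob_deg \<longlonglongrightarrow> 0"
proof -
  have \<alpha>0: "\<forall>\<^sub>F n in sequentially. \<alpha> n \<le> 0" using bot unfolding filterlim_at_bot by blast
  interpret critical K P k c
  proof
    show "\<forall>\<^sub>F n in sequentially. real n * ((real (K n))\<^sup>2 / real (P n)) \<le> 4 * ln (real n)"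
      using alpha \<alpha>0 threshold_le[of k] ln_ln_bounds by eventually_elim linarith
  qed (use k c KP K_ge lo in auto)
  have y_eq: "y n = real n * ((real (K n))\<^sup>2 / real (P n))" for n by (simp add: y_def x_def)
  have "filterlim (\<lambda>n. - \<alpha> n) at_top sequentially" using bot by (simp add: filterlim_uminus_at_top)
  moreover have "filterlim (\<lambda>z. (1 / 8) ^ (k - 1) * exp z / fact (k - 1) :: real) at_top at_top" by real_asymp
  ultimately have "filterlim (\<lambda>n. (1 / 8) ^ (k - 1) * exp (- \<alpha> n) / fact (k - 1)) at_top sequentially"
    by (rule filterlim_compose[rotated])
  moreover have "\<forall>\<^sub>F n in sequentially. (1 / 8) ^ (k - 1) * exp (- \<alpha> n) / fact (k - 1) \<le> \<mu> n"
    using alpha ln_ln_bounds lo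
  proof eventually_elim
    case (elim n)
    have "(1 / 8) ^ (k - 1) * exp (- \<alpha> n) / fact (k - 1) \<le> (y n / ln (real n)) ^ (k - 1) * exp (- \<alpha> n) / fact (k - 1)"
      using elim by (intro divide_right_mono mult_right_mono power_mono) (auto simp: y_eq pos_le_divide_eq)
    also have "\<dots> = \<mu> n" using elim by (intro \<mu>_eq[symmetric]) (auto simp: y_eq)
    finally show ?case .
  qed
  ultimately have "filterlim \<mu> at_top sequentially" by (rule filterlim_at_top_mono)
  then have "p0 \<longlonglongrightarrow> 0" by (rule p0_tendsto_0)
  then show ?thesis by (simp add: p0_def[abs_def])
qed

lemma limit_top:
  assumes top: "filterlim \<alpha> at_top sequentially"
  shows "prob_deg \<longlonglongrightarrow> 1" "prob_conn \<longlonglongrightarrow> 1"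
proof -
  define y where "y n = real n * ((real (K n))\<^sup>2 / real (P n))" for n
  \<comment> \<open>Multiplying the pool by \<open>m\<close> brings a too large \<open>y\<close>
    down to between 2 * ln n and 4 * ln n. As the threshold is at most 3 / 2 * ln n, the new
    \<alpha> still tends to infinity, and a larger pool only makes both properties less
    likely.\<close>
  define m where "m n = (if y n \<le> 4 * ln (real n) then 1 else nat \<lfloor>y n / (2 * ln (real n))\<rfloor>)" for n
  define P' where "P' n = m n * P n" for n
  define \<alpha>' where "\<alpha>' n = real n * ((real (K n))\<^sup>2 / real (P' n)) - threshold k n" for n
  have main: "\<forall>\<^sub>F n in sequentially. 1 \<le> m n \<and> y n / real (m n) \<le> 4 * ln (real n) \<and>
      (m n = 1 \<or> 2 * ln (real n) \<le> y n / real (m n))"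
    using ln_ln_bounds
  proof eventually_elim
    case (elim n)
    show ?case
    proof (cases "y n \<le> 4 * ln (real n)")
      case False
      define z where "z = y n / (2 * ln (real n))"
      have L: "0 < ln (real n)" using elim by linarith
      have z2: "2 < z" using False L by (simp add: z_def field_simps)
      have mz: "m n = nat \<lfloor>z\<rfloor>" using False by (simp add: m_def z_def)
      have "real (m n) \<le> z" unfolding mz using z2 by (intro of_nat_floor) simp
      moreover have "z < real (m n) + 1" unfolding mz using z2 by linarith
      moreover have "2 \<le> m n" unfolding mz using z2 by (simp add: le_nat_iff le_floor_iff)
      ultimately show ?thesis using L z2 by (auto simp: z_def field_simps)
    qed (simp add: m_def)
  qed
  have y': "real n * ((real (K n))\<^sup>2 / real (P' n)) = y n / real (m n)" for n by (simp add: P'_def y_def)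
  have up: "uniform_sequence K P' k c \<alpha>'"
  proof
    show "\<forall>\<^sub>F n in sequentially. 1 \<le> K n \<and> K n \<le> P' n"
      using KP main
    proof eventually_elim
      case (elim n)
      then have "1 * P n \<le> m n * P n" by (intro mult_le_mono1) simp
      then show ?case using elim unfolding P'_def by linarith
    qed
    show "\<forall>\<^sub>F n in sequentially. real n * ((real (K n))\<^sup>2 / real (P' n)) = threshold k n + \<alpha>' n"
      by (simp add: \<alpha>'_def)
  qed (use k c K_ge in auto)
  have top': "filterlim \<alpha>' at_top sequentially"
    unfolding filterlim_at_top
  proof
    fix Z :: real
    have "\<forall>\<^sub>F n in sequentially. 2 * Z \<le> ln (real n)" using filterlim_ln_nat unfolding filterlim_at_top by blast
    moreover have "\<forall>\<^sub>F n in sequentially. Z \<le> \<alpha> n" using top unfolding filterlim_at_top by blast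
    ultimately show "\<forall>\<^sub>F n in sequentially. Z \<le> \<alpha>' n"
      using main alpha threshold_le[of k]
    proof eventually_elim
      case (elim n)
      show ?case
      proof (cases "m n = 1")
        case True
        then have "\<alpha>' n = \<alpha> n" unfolding \<alpha>'_def y' using elim(4) by (simp add: y_def)
        then show ?thesis using elim by simp
      next
        case False
        then have "2 * ln (real n) \<le> y n / real (m n)" using elim(3) by simp
        then show ?thesis unfolding \<alpha>'_def y' using elim(1,5) by linarith
      qed
    qed
  qed
  interpret U: uniform_sequence K P' k c \<alpha>' by (rule up)
  have hi: "\<forall>\<^sub>F n in sequentially. real n * ((real (K n))\<^sup>2 / real (P' n)) \<le> 4 * ln (real n)"
    unfolding y' using main by eventually_elim simp
  have mono: "\<forall>\<^sub>F n in sequentially. measure_pmf.prob (unif_model n (P' n) (K n)) {S. \<Phi> n S} \<le>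
      measure_pmf.prob (unif_model n (P n) (K n)) {S. \<Phi> n S}" if "\<And>n. increasing n (\<Phi> n)" for \<Phi>
    using KP main
    by eventually_elim (auto simp: P'_def intro!: prob_unif_model_mono_pool that)
  have one: "\<forall>\<^sub>F n in sequentially. measure_pmf.prob (unif_model n (P n) (K n)) {S. \<Phi> n S} \<le> 1" for \<Phi> by simp
  show "prob_deg \<longlonglongrightarrow> 1"
    by (rule tendsto_sandwich[OF mono[OF increasing_low_degree_empty] one U.limit_top_bounded(1)[OF top' hi] tendsto_const])
  show "prob_conn \<longlonglongrightarrow> 1"
    by (rule tendsto_sandwich[OF mono[OF increasing_k_connected] one U.limit_top_bounded(2)[OF top' hi] tendsto_const])
qed

lemma limit_bot:
  assumes bot: "filterlim \<alpha> at_bot sequentially"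
  shows "prob_deg \<longlonglongrightarrow> 0"
proof -
  define y where "y n = real n * ((real (K n))\<^sup>2 / real (P n))" for n
  \<comment> \<open>The sizes are multiplied by \<open>m\<close>, which acts quadratically on
    \<open>y\<close>; hence the square root. The target ln n / 2 is safely below the threshold.
    Larger sets make small degrees rarer, so a vanishing probability carries over to the original
    sizes.\<close>
  define m where "m n = (if ln (real n) / 8 \<le> y n then 1 else nat \<lfloor>sqrt (ln (real n) / (2 * y n))\<rfloor>)" for n
  define K' where "K' n = m n * K n" for n
  define \<alpha>' where "\<alpha>' n = real n * ((real (K' n))\<^sup>2 / real (P n)) - threshold k n" for n
  have main: "\<forall>\<^sub>F n in sequentially. 1 \<le> m n \<and> ln (real n) / 8 \<le> (real (m n))\<^sup>2 * y n \<and>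
      (m n = 1 \<or> (real (m n))\<^sup>2 * y n \<le> ln (real n) / 2)"
    using ln_ln_bounds KP eventually_gt_at_top[of 0]
  proof eventually_elim
    case (elim n)
    show ?case
    proof (cases "ln (real n) / 8 \<le> y n")
      case False
      have y0: "0 < y n" using elim by (simp add: y_def)
      define z where "z = sqrt (ln (real n) / (2 * y n))"
      have L: "0 < ln (real n)" using elim by linarith
      have zz: "z\<^sup>2 = ln (real n) / (2 * y n)" using L y0 by (simp add: z_def)
      have "2\<^sup>2 < z\<^sup>2" unfolding zz using False y0 by (simp add: field_simps)
      then have z2: "2 < z" by (rule power_less_imp_less_base) (use L y0 in \<open>simp add: z_def\<close>)
      have mz: "m n = nat \<lfloor>z\<rfloor>" using False by (simp add: m_def z_def)
      have m1: "real (m n) \<le> z" unfolding mz using z2 by (intro of_nat_floor) simp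
      have m2: "z < real (m n) + 1" unfolding mz using z2 by linarith
      have m3: "2 \<le> m n" unfolding mz using z2 by (simp add: le_nat_iff le_floor_iff)
      have m4: "z / 2 \<le> real (m n)" using m2 z2 by linarith
      have "(real (m n))\<^sup>2 \<le> z\<^sup>2" using m1 by (intro power_mono) auto
      then have "(real (m n))\<^sup>2 * y n \<le> z\<^sup>2 * y n" using y0 by (intro mult_right_mono) auto
      moreover have "z\<^sup>2 * y n = ln (real n) / 2" using y0 by (simp add: zz)
      moreover have "(z / 2)\<^sup>2 \<le> (real (m n))\<^sup>2" using m4 z2 by (intro power_mono) auto
      then have "(z / 2)\<^sup>2 * y n \<le> (real (m n))\<^sup>2 * y n" using y0 by (intro mult_right_mono) auto
      moreover have "(z / 2)\<^sup>2 * y n = ln (real n) / 8" using y0 by (simp add: power_divide zz)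
      ultimately show ?thesis using m3 by simp
    qed (simp add: m_def)
  qed
  have y': "real n * ((real (K' n))\<^sup>2 / real (P n)) = (real (m n))\<^sup>2 * y n" for n
    by (simp add: K'_def y_def power_mult_distrib)
  have KP': "\<forall>\<^sub>F n in sequentially. 1 \<le> K' n \<and> K' n \<le> P n"
    using KP main ln_ln_bounds eventually_gt_at_top[of 0]
  proof eventually_elim
    case (elim n)
    show ?case
    proof (cases "m n = 1")
      case False
      \<comment> \<open>A \<open>y\<close> of at most ln n / 2 forces the squared size below the
        pool size, so the enlarged sets still fit into the pool.\<close>
      then have "real n * ((real (K' n))\<^sup>2 / real (P n)) \<le> ln (real n) / 2" unfolding y' using elim by simp
      also have "\<dots> \<le> real n" using ln_le_minus_one[of "real n"] elim(4) by simp
      finally have "(real (K' n))\<^sup>2 / real (P n) \<le> 1"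
        using elim(4) by (metis mult_le_cancel_left_pos mult.right_neutral of_nat_0_less_iff)
      then have "(real (K' n))\<^sup>2 \<le> real (P n)" using elim(1) by (simp add: divide_simps split: if_splits)
      also have "\<dots> \<le> (real (P n))\<^sup>2" using elim(1) by (simp add: power2_eq_square)
      finally have "real (K' n) \<le> real (P n)" by (rule power2_le_imp_le) simp
      then have "K' n \<le> P n" by (simp only: of_nat_le_iff)
      moreover have "1 \<le> K' n" using elim by (simp add: K'_def Suc_le_eq)
      ultimately show ?thesis by simp
    qed (use elim in \<open>simp add: K'_def\<close>)
  qed
  have up: "uniform_sequence K' P k c \<alpha>'"
  proof
    show "\<forall>\<^sub>F n in sequentially. c * sqrt (ln (real n)) \<le> real (K' n)"
      using K_ge main
    proof eventually_elim
      case (elim n)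
      have "1 * real (K n) \<le> real (m n) * real (K n)" using elim by (intro mult_right_mono) auto
      then show ?case using elim by (simp add: K'_def)
    qed
    show "\<forall>\<^sub>F n in sequentially. real n * ((real (K' n))\<^sup>2 / real (P n)) = threshold k n + \<alpha>' n"
      by (simp add: \<alpha>'_def)
  qed (use k c KP' in auto)
  have bot': "filterlim \<alpha>' at_bot sequentially"
    unfolding filterlim_at_bot
  proof
    fix Z :: real
    have "\<forall>\<^sub>F n in sequentially. - (2 * Z) \<le> ln (real n)" using filterlim_ln_nat unfolding filterlim_at_top by blast
    moreover have "\<forall>\<^sub>F n in sequentially. \<alpha> n \<le> Z" using bot unfolding filterlim_at_bot by blast
    ultimately show "\<forall>\<^sub>F n in sequentially. \<alpha>' n \<le> Z"
      using main alpha threshold_ge[OF k]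
    proof eventually_elim
      case (elim n)
      show ?case
      proof (cases "m n = 1")
        case True
        then have "\<alpha>' n = \<alpha> n" unfolding \<alpha>'_def y' using elim(4) by (simp add: y_def)
        then show ?thesis using elim by simp
      next
        case False
        then have "(real (m n))\<^sup>2 * y n \<le> ln (real n) / 2" using elim(3) by simp
        then show ?thesis unfolding \<alpha>'_def y' using elim(1,5) by linarith
      qed
    qed
  qed
  interpret U: uniform_sequence K' P k c \<alpha>' by (rule up)
  have lo: "\<forall>\<^sub>F n in sequentially. ln (real n) / 8 \<le> real n * ((real (K' n))\<^sup>2 / real (P n))"
    unfolding y' using main by eventually_elim simp
  have mono: "\<forall>\<^sub>F n in sequentially. prob_deg n \<le> U.prob_deg n"
    using KP KP' main
  proof eventually_elim
    case (elim n)
    have "1 * K n \<le> m n * K n" using elim by (intro mult_le_mono1) simp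
    then show ?case
      using elim by (intro prob_unif_model_mono_size increasing_low_degree_empty) (auto simp: K'_def)
  qed
  show ?thesis
    by (rule tendsto_sandwich[OF _ mono tendsto_const U.limit_bot_bounded[OF bot' lo]]) simp
qed

end

section \<open>Random set sizes\<close>

locale general_sequence =
  fixes k :: nat and P :: "nat \<Rightarrow> nat" and D :: "nat \<Rightarrow> nat pmf" and \<alpha> :: "nat \<Rightarrow> real"
  assumes k: "1 \<le> k"
    and P_pos: "\<And>n. n \<ge> 1 \<Longrightarrow> P n \<ge> 1"
    and D_supp: "\<And>n. n \<ge> 1 \<Longrightarrow> set_pmf (D n) \<subseteq> {1..P n}"
    and alpha: "\<And>n. n \<ge> 2 \<Longrightarrow>
      (measure_pmf.expectation (D n) real)\<^sup>2 / real (P n)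
        = (ln (real n) + (real k - 1) * ln (ln (real n)) + \<alpha> n) / real n"
    and expectation_growth:
      "(\<lambda>n. measure_pmf.expectation (D n) real) \<in> \<Omega>(\<lambda>n. sqrt (ln (real n)))"
    and variance_small:
      "(\<lambda>n. measure_pmf.variance (D n) real)
        \<in> o(\<lambda>n. (measure_pmf.expectation (D n) real)\<^sup>2 / (real n * (ln (real n))\<^sup>2))"
begin

definition E :: "nat \<Rightarrow> real" where "E n = measure_pmf.expectation (D n) real"
definition V :: "nat \<Rightarrow> real" where "V n = measure_pmf.variance (D n) real"

definition pr :: "nat \<Rightarrow> ((nat \<Rightarrow> nat set) \<Rightarrow> bool) \<Rightarrow> real" where
  "pr n \<Phi> = measure_pmf.prob (Pi_pmf {1..n} {} (\<lambda>_. object_set_pmf (P n) (D n))) {S. \<Phi> S}"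

lemma integrable_D: "n \<ge> 1 \<Longrightarrow> integrable (measure_pmf (D n)) (f :: nat \<Rightarrow> real)"
  using D_supp[of n] finite_subset by (intro integrable_measure_pmf_finite) blast

lemma E_ge_1: "1 \<le> E n" if "n \<ge> 1"
proof -
  have "measure_pmf.expectation (D n) (\<lambda>_. 1) \<le> measure_pmf.expectation (D n) real"
    using D_supp[OF that] by (intro integral_mono_AE integrable_D that) (auto simp: AE_measure_pmf_iff)
  then show ?thesis by (simp add: E_def)
qed

lemma V_nonneg: "0 \<le> V n"
  by (simp add: V_def integral_nonneg)

lemma sandwich_by_uniform:
  "\<exists>\<delta> \<eta> sm sp. (\<lambda>n. \<delta> n * ln (real n)) \<longlonglongrightarrow> 0 \<and> \<eta> \<longlonglongrightarrow> 0 \<and>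
    (\<forall>\<^sub>F n in sequentially. 0 \<le> \<delta> n \<and>
      sm n \<in> {1..P n} \<and> \<bar>real (sm n) - E n\<bar> \<le> \<delta> n * E n \<and> sp n \<in> {1..P n} \<and> \<bar>real (sp n) - E n\<bar> \<le> \<delta> n * E n \<and>
      (\<forall>\<Phi>. increasing n \<Phi> \<longrightarrow> pr n \<Phi> \<le> measure_pmf.prob (unif_model n (P n) (sp n)) {S. \<Phi> S} + \<eta> n \<and>
          measure_pmf.prob (unif_model n (P n) (sm n)) {S. \<Phi> S} \<le> pr n \<Phi> + \<eta> n))"
proof -
  define \<epsilon> where "\<epsilon> n = V n / ((E n)\<^sup>2 / (real n * (ln (real n))\<^sup>2))" for n
  \<comment> \<open>The summand 1 / n keeps the window open when the variance vanishes.\<close>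
  define \<epsilon>' where "\<epsilon>' n = \<epsilon> n + inverse (real n)" for n
  \<comment> \<open>The fourth root balances two demands: \<open>\<delta> n * ln n\<close> must
    vanish, and Chebyshev's bound, which divides by the square of \<open>\<delta> n\<close>, must
    still leave at most \<open>sqrt (\<epsilon>' n) / n\<close> for the failure at one node.\<close>
  define \<delta> where "\<delta> n = sqrt (sqrt (\<epsilon>' n)) / ln (real n)" for n
  define I where "I n = {s. \<bar>real s - E n\<bar> < \<delta> n * E n}" for n
  \<comment> \<open>Extreme values that are actually taken within the window, so both are admissible
    set sizes. They exist because the window has positive probability.\<close>
  define sm where "sm n = Min (set_pmf (D n) \<inter> I n)" for n
  define sp where "sp n = Max (set_pmf (D n) \<inter> I n)" for n
  have "\<epsilon> \<longlonglongrightarrow> 0"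
    using smalloD_tendsto[OF variance_small] by (simp add: \<epsilon>_def[abs_def] V_def E_def)
  then have "\<epsilon>' \<longlonglongrightarrow> 0 + 0" unfolding \<epsilon>'_def by (intro tendsto_intros lim_inverse_n)
  then have \<epsilon>': "\<epsilon>' \<longlonglongrightarrow> 0" by simp
  have "(\<lambda>n. sqrt (\<epsilon>' n)) \<longlonglongrightarrow> sqrt 0" by (intro tendsto_intros \<epsilon>')
  then have \<eta>: "(\<lambda>n. sqrt (\<epsilon>' n)) \<longlonglongrightarrow> 0" by simp
  have "(\<lambda>n. sqrt (sqrt (\<epsilon>' n))) \<longlonglongrightarrow> sqrt 0" by (intro tendsto_intros \<eta>)
  moreover have "\<forall>\<^sub>F n in sequentially. sqrt (sqrt (\<epsilon>' n)) = \<delta> n * ln (real n)"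
    using ln_ln_bounds by eventually_elim (auto simp: \<delta>_def)
  ultimately have \<delta>L: "(\<lambda>n. \<delta> n * ln (real n)) \<longlonglongrightarrow> 0" by (simp add: tendsto_cong)
  have \<eta>1: "\<forall>\<^sub>F n in sequentially. sqrt (\<epsilon>' n) < 1" using \<eta> by (rule order_tendstoD) simp
  have "\<forall>\<^sub>F n in sequentially. 0 \<le> \<delta> n \<and>
      sm n \<in> {1..P n} \<and> \<bar>real (sm n) - E n\<bar> \<le> \<delta> n * E n \<and> sp n \<in> {1..P n} \<and> \<bar>real (sp n) - E n\<bar> \<le> \<delta> n * E n \<and>
      (\<forall>\<Phi>. increasing n \<Phi> \<longrightarrow> pr n \<Phi> \<le> measure_pmf.prob (unif_model n (P n) (sp n)) {S. \<Phi> S} + sqrt (\<epsilon>' n) \<and>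
          measure_pmf.prob (unif_model n (P n) (sm n)) {S. \<Phi> S} \<le> pr n \<Phi> + sqrt (\<epsilon>' n))"
    using \<eta>1 ln_ln_bounds eventually_ge_at_top[of 1]
  proof eventually_elim
    case (elim n)
    have n1: "1 \<le> n" and n0: "0 < real n" using elim(3) by auto
    have L: "1 \<le> ln (real n)" using elim(2) by simp
    have E1: "1 \<le> E n" by (rule E_ge_1[OF n1])
    have \<epsilon>0: "0 \<le> \<epsilon> n" using V_nonneg by (simp add: \<epsilon>_def)
    have \<epsilon>'0: "0 < \<epsilon>' n" "\<epsilon> n \<le> \<epsilon>' n" using \<epsilon>0 n0 by (auto simp: \<epsilon>'_def add_nonneg_pos)
    have \<delta>0: "0 < \<delta> n" unfolding \<delta>_def using \<epsilon>'0 L by (intro divide_pos_pos) auto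
    have a0: "0 < \<delta> n * E n" using \<delta>0 E1 by simp
    have "measure_pmf.prob (D n) (- I n) \<le> V n / (\<delta> n * E n)\<^sup>2"
    proof -
      have "{x \<in> space (measure_pmf (D n)). \<delta> n * E n \<le> \<bar>real x - measure_pmf.expectation (D n) real\<bar>} = - I n"
        by (auto simp: I_def E_def)
      moreover have "measure_pmf.prob (D n) {x \<in> space (measure_pmf (D n)). \<delta> n * E n \<le> \<bar>real x - measure_pmf.expectation (D n) real\<bar>}
          \<le> measure_pmf.variance (D n) real / (\<delta> n * E n)\<^sup>2"
        by (rule measure_pmf.Chebyshev_inequality[OF _ integrable_D[OF n1] a0]) simp
      ultimately show ?thesis by (simp add: V_def)
    qed
    also have "\<dots> = \<epsilon> n / (sqrt (\<epsilon>' n) * real n)"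
    proof -
      define l where "l = ln (real n)"
      have l: "0 < l" using L unfolding l_def by linarith
      have d2: "(\<delta> n)\<^sup>2 = sqrt (\<epsilon>' n) / l\<^sup>2" using \<epsilon>'0 by (simp add: \<delta>_def power_divide l_def)
      have v: "V n = \<epsilon> n * ((E n)\<^sup>2 / (real n * l\<^sup>2))" using E1 l n0 by (simp add: \<epsilon>_def l_def[symmetric])
      show ?thesis unfolding power_mult_distrib d2 v using E1 l n0 \<epsilon>'0 by (simp add: field_simps)
    qed
    also have "\<dots> \<le> \<epsilon>' n / (sqrt (\<epsilon>' n) * real n)" using \<epsilon>'0 n0 by (intro divide_right_mono) auto
    also have "\<dots> = sqrt (\<epsilon>' n) / real n"
    proof -
      have "\<epsilon>' n = sqrt (\<epsilon>' n) * sqrt (\<epsilon>' n)" using \<epsilon>'0 by simp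
      then show ?thesis using \<epsilon>'0 n0 by (simp add: field_simps)
    qed
    finally have bad: "measure_pmf.prob (D n) (- I n) \<le> sqrt (\<epsilon>' n) / real n" .
    then have nbad: "real n * measure_pmf.prob (D n) (- I n) \<le> sqrt (\<epsilon>' n)" using n0 by (simp add: field_simps)
    have "sqrt (\<epsilon>' n) / real n \<le> sqrt (\<epsilon>' n)" using \<epsilon>'0 n1 by (simp add: divide_le_eq mult_le_cancel_left1)
    then have lt1: "measure_pmf.prob (D n) (- I n) < 1" using bad elim(1) by linarith
    have ne: "set_pmf (D n) \<inter> I n \<noteq> {}"
    proof
      assume "set_pmf (D n) \<inter> I n = {}"
      then have "set_pmf (D n) \<subseteq> - I n" by auto
      then have "measure_pmf.prob (D n) (- I n) = 1"
        by (subst measure_pmf.prob_eq_1) (auto simp: AE_measure_pmf_iff)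
      then show False using lt1 by simp
    qed
    have fin: "finite (set_pmf (D n) \<inter> I n)" using D_supp[OF n1] finite_subset by blast
    have smI: "sm n \<in> set_pmf (D n) \<inter> I n" unfolding sm_def by (rule Min_in[OF fin ne])
    have spI: "sp n \<in> set_pmf (D n) \<inter> I n" unfolding sp_def by (rule Max_in[OF fin ne])
    have smP: "sm n \<in> {1..P n}" and spP: "sp n \<in> {1..P n}" using smI spI D_supp[OF n1] by blast+
    have "pr n \<Phi> \<le> measure_pmf.prob (unif_model n (P n) (sp n)) {S. \<Phi> S} + sqrt (\<epsilon>' n) \<and>
          measure_pmf.prob (unif_model n (P n) (sm n)) {S. \<Phi> S} \<le> pr n \<Phi> + sqrt (\<epsilon>' n)" if inc: "increasing n \<Phi>" for \<Phi>
    proof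
      have "pr n \<Phi> \<le> measure_pmf.prob (unif_model n (P n) (sp n)) {S. \<Phi> S} + real n * measure_pmf.prob (D n) (- I n)"
        unfolding pr_def
        by (rule prob_general_le_unif[OF inc D_supp[OF n1] P_pos[OF n1]]) (use spP fin in \<open>auto simp: sp_def\<close>)
      then show "pr n \<Phi> \<le> measure_pmf.prob (unif_model n (P n) (sp n)) {S. \<Phi> S} + sqrt (\<epsilon>' n)" using nbad by linarith
      have "measure_pmf.prob (unif_model n (P n) (sm n)) {S. \<Phi> S} \<le> pr n \<Phi> + real n * measure_pmf.prob (D n) (- I n)"
        unfolding pr_def
        by (rule prob_unif_le_general[OF inc D_supp[OF n1] P_pos[OF n1]]) (use smP fin in \<open>auto simp: sm_def\<close>)
      then show "measure_pmf.prob (unif_model n (P n) (sm n)) {S. \<Phi> S} \<le> pr n \<Phi> + sqrt (\<epsilon>' n)" using nbad by linarith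
    qed
    then show ?case using \<delta>0 smP spP smI spI by (auto simp: I_def)
  qed
  with \<delta>L \<eta> show ?thesis by blast
qed

definition shifted :: "(nat \<Rightarrow> nat) \<Rightarrow> nat \<Rightarrow> real" where
  "shifted s n = real n * ((real (s n))\<^sup>2 / real (P n)) - threshold k n"

context
  fixes \<delta> :: "nat \<Rightarrow> real" and s :: "nat \<Rightarrow> nat"
  assumes \<delta>L: "(\<lambda>n. \<delta> n * ln (real n)) \<longlonglongrightarrow> 0"
    and s: "\<forall>\<^sub>F n in sequentially. 0 \<le> \<delta> n \<and> s n \<in> {1..P n} \<and> \<bar>real (s n) - E n\<bar> \<le> \<delta> n * E n"
begin

lemma \<delta>_threshold: "(\<lambda>n. \<delta> n * threshold k n) \<longlonglongrightarrow> 0"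
proof -
  have "(\<lambda>n. (\<delta> n * ln (real n)) * (threshold k n / ln (real n))) \<longlonglongrightarrow> 0 * 1"
    by (intro tendsto_intros \<delta>L threshold_ratio)
  moreover have "\<forall>\<^sub>F n in sequentially. (\<delta> n * ln (real n)) * (threshold k n / ln (real n)) = \<delta> n * threshold k n"
    using ln_ln_bounds by eventually_elim auto
  ultimately show ?thesis by (simp add: tendsto_cong)
qed

lemma \<delta>_tendsto: "\<delta> \<longlonglongrightarrow> 0"
proof -
  have "(\<lambda>n. \<delta> n * ln (real n) * inverse (ln (real n))) \<longlonglongrightarrow> 0 * 0"
    by (intro tendsto_intros \<delta>L tendsto_inverse_0_at_top filterlim_ln_nat)
  moreover have "\<forall>\<^sub>F n in sequentially. \<delta> n * ln (real n) * inverse (ln (real n)) = \<delta> n"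
    using ln_ln_bounds by eventually_elim auto
  ultimately show ?thesis by (simp add: tendsto_cong)
qed

text \<open>A relative error \<open>\<delta> n\<close> in the size triples at most when squared, and
  it acts on n * E^2 / P, which is the threshold plus \<alpha>. So the error is relative to \<alpha>
  as well, which matters when \<alpha> is unbounded.\<close>

lemma shifted_close:
  "\<forall>\<^sub>F n in sequentially. \<bar>shifted s n - \<alpha> n\<bar> \<le> 3 * \<delta> n * (threshold k n + \<alpha> n) \<and> 0 \<le> threshold k n + \<alpha> n"
proof -
  have "\<forall>\<^sub>F n in sequentially. \<delta> n < 1" using \<delta>_tendsto by (rule order_tendstoD) simp
  then show ?thesis
    using s eventually_ge_at_top[of 2]
  proof eventually_elim
    case (elim n)
    have n0: "0 < real n" and n1: "1 \<le> n" using elim by auto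
    have E1: "1 \<le> E n" by (rule E_ge_1[OF n1])
    have w: "real n * ((E n)\<^sup>2 / real (P n)) = threshold k n + \<alpha> n"
      using alpha[of n] elim(3) n0 by (simp add: E_def threshold_def)
    have "\<bar>(real (s n))\<^sup>2 - (E n)\<^sup>2\<bar> = \<bar>real (s n) - E n\<bar> * (real (s n) + E n)"
      using E1 by (simp add: power2_eq_square abs_mult square_diff_square_factored)
    also have "\<dots> \<le> (\<delta> n * E n) * (3 * E n)"
    proof (rule mult_mono)
      have "\<delta> n * E n \<le> 1 * E n" using elim(1) E1 by (intro mult_right_mono) auto
      then show "real (s n) + E n \<le> 3 * E n" using elim(2) by linarith
    qed (use elim E1 in auto)
    finally have diff: "\<bar>(real (s n))\<^sup>2 - (E n)\<^sup>2\<bar> \<le> 3 * \<delta> n * (E n)\<^sup>2" by (simp add: power2_eq_square mult_ac)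
    have "shifted s n - \<alpha> n = real n / real (P n) * ((real (s n))\<^sup>2 - (E n)\<^sup>2)"
      unfolding shifted_def using w by (simp add: algebra_simps)
    then have "\<bar>shifted s n - \<alpha> n\<bar> = real n / real (P n) * \<bar>(real (s n))\<^sup>2 - (E n)\<^sup>2\<bar>" by (simp add: abs_mult)
    also have "\<dots> \<le> real n / real (P n) * (3 * \<delta> n * (E n)\<^sup>2)" using diff by (intro mult_left_mono) auto
    also have "\<dots> = 3 * \<delta> n * (real n * ((E n)\<^sup>2 / real (P n)))" by simp
    finally have "\<bar>shifted s n - \<alpha> n\<bar> \<le> 3 * \<delta> n * (threshold k n + \<alpha> n)" unfolding w .
    moreover have "0 \<le> threshold k n + \<alpha> n" unfolding w[symmetric] by simp
    ultimately show ?case by simp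
  qed
qed

lemma uniform_shifted: "\<exists>c. uniform_sequence s P k c (shifted s)"
proof -
  obtain c where c: "0 < c" "\<forall>\<^sub>F n in sequentially. c * norm (sqrt (ln (real n))) \<le> norm (E n)"
    using landau_omega.bigE[OF expectation_growth] unfolding E_def by blast
  have \<delta>half: "\<forall>\<^sub>F n in sequentially. \<delta> n < 1 / 2" using \<delta>_tendsto by (rule order_tendstoD) simp
  have "uniform_sequence s P k (c / 2) (shifted s)"
  proof
    show "\<forall>\<^sub>F n in sequentially. c / 2 * sqrt (ln (real n)) \<le> real (s n)"
      using c(2) s \<delta>half ln_ln_bounds eventually_ge_at_top[of 1]
    proof eventually_elim
      case (elim n)
      have "1 \<le> E n" by (rule E_ge_1[OF elim(5)])
      then have "c * sqrt (ln (real n)) \<le> E n" "\<delta> n * E n \<le> 1 / 2 * E n"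
        using elim by (auto intro!: mult_right_mono)
      then show ?case using elim(2) by linarith
    qed
    show "\<forall>\<^sub>F n in sequentially. 1 \<le> s n \<and> s n \<le> P n" using s by eventually_elim simp
    show "\<forall>\<^sub>F n in sequentially. real n * ((real (s n))\<^sup>2 / real (P n)) = threshold k n + shifted s n"
      by (simp add: shifted_def)
  qed (use k c(1) in auto)
  then show ?thesis by blast
qed

lemma shifted_tendsto:
  assumes "\<alpha> \<longlonglongrightarrow> a"
  shows "shifted s \<longlonglongrightarrow> a"
proof -
  have "(\<lambda>n. 3 * (\<delta> n * threshold k n) + 3 * (\<delta> n * \<alpha> n)) \<longlonglongrightarrow> 3 * 0 + 3 * (0 * a)"
    by (intro tendsto_intros \<delta>_threshold \<delta>_tendsto assms)
  then have "(\<lambda>n. 3 * \<delta> n * (threshold k n + \<alpha> n)) \<longlonglongrightarrow> 0" by (simp add: algebra_simps)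
  then have "(\<lambda>n. shifted s n - \<alpha> n) \<longlonglongrightarrow> 0"
    by (rule Lim_null_comparison[rotated]) (use shifted_close in \<open>eventually_elim, simp\<close>)
  from tendsto_add[OF this assms] show ?thesis by simp
qed

lemma shifted_at_top:
  assumes "filterlim \<alpha> at_top sequentially"
  shows "filterlim (shifted s) at_top sequentially"
  unfolding filterlim_at_top
proof
  fix Z :: real
  have "\<forall>\<^sub>F n in sequentially. max 0 (2 * Z + 2) \<le> \<alpha> n" using assms unfolding filterlim_at_top by blast
  moreover have "\<forall>\<^sub>F n in sequentially. \<delta> n < 1 / 6" using \<delta>_tendsto by (rule order_tendstoD) simp
  moreover have "\<forall>\<^sub>F n in sequentially. \<delta> n * threshold k n < 1 / 3" using \<delta>_threshold by (rule order_tendstoD) simp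
  ultimately show "\<forall>\<^sub>F n in sequentially. Z \<le> shifted s n"
    using shifted_close
  proof eventually_elim
    case (elim n)
    \<comment> \<open>Three times a sixth: at least half of \<alpha> survives the error that is
      proportional to \<alpha> itself.\<close>
    have "\<delta> n * \<alpha> n \<le> 1 / 6 * \<alpha> n" using elim(1,2) by (intro mult_right_mono) auto
    moreover have "3 * \<delta> n * (threshold k n + \<alpha> n) = 3 * (\<delta> n * threshold k n) + 3 * (\<delta> n * \<alpha> n)" by (simp add: algebra_simps)
    ultimately show ?case using elim by linarith
  qed
qed

lemma shifted_at_bot:
  assumes "filterlim \<alpha> at_bot sequentially"
  shows "filterlim (shifted s) at_bot sequentially"
  unfolding filterlim_at_bot
proof
  fix Z :: real
  have "\<forall>\<^sub>F n in sequentially. \<alpha> n \<le> min 0 (Z - 1)" using assms unfolding filterlim_at_bot by blast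
  moreover have "\<forall>\<^sub>F n in sequentially. \<delta> n * threshold k n < 1 / 3" using \<delta>_threshold by (rule order_tendstoD) simp
  ultimately show "\<forall>\<^sub>F n in sequentially. shifted s n \<le> Z"
    using shifted_close s
  proof eventually_elim
    case (elim n)
    \<comment> \<open>For negative \<alpha> the proportional part of the error bound is nonpositive
      and only the threshold part counts.\<close>
    have "\<delta> n * \<alpha> n \<le> 0" using elim(1,4) by (intro mult_nonneg_nonpos) auto
    moreover have "3 * \<delta> n * (threshold k n + \<alpha> n) = 3 * (\<delta> n * threshold k n) + 3 * (\<delta> n * \<alpha> n)" by (simp add: algebra_simps)
    ultimately show ?case using elim by linarith
  qed
qed

end

lemma limits:
  shows "\<alpha> \<longlonglongrightarrow> a \<Longrightarrow> (\<lambda>n. pr n (\<lambda>S. low_degree n k S = {})) \<longlonglongrightarrow> exp (- (exp (- a) / fact (k - 1)))"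
    and "\<alpha> \<longlonglongrightarrow> a \<Longrightarrow> (\<lambda>n. pr n (\<lambda>S. k_connected k (intersection_graph n S))) \<longlonglongrightarrow> exp (- (exp (- a) / fact (k - 1)))"
    and "filterlim \<alpha> at_top sequentially \<Longrightarrow> (\<lambda>n. pr n (\<lambda>S. low_degree n k S = {})) \<longlonglongrightarrow> 1"
    and "filterlim \<alpha> at_top sequentially \<Longrightarrow> (\<lambda>n. pr n (\<lambda>S. k_connected k (intersection_graph n S))) \<longlonglongrightarrow> 1"
    and "filterlim \<alpha> at_bot sequentially \<Longrightarrow> (\<lambda>n. pr n (\<lambda>S. low_degree n k S = {})) \<longlonglongrightarrow> 0"
proof -
  obtain \<delta> \<eta> sm sp where \<delta>L: "(\<lambda>n. \<delta> n * ln (real n)) \<longlonglongrightarrow> 0" and \<eta>: "\<eta> \<longlonglongrightarrow> 0"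
    and ev: "\<forall>\<^sub>F n in sequentially. 0 \<le> \<delta> n \<and>
      sm n \<in> {1..P n} \<and> \<bar>real (sm n) - E n\<bar> \<le> \<delta> n * E n \<and> sp n \<in> {1..P n} \<and> \<bar>real (sp n) - E n\<bar> \<le> \<delta> n * E n \<and>
      (\<forall>\<Phi>. increasing n \<Phi> \<longrightarrow> pr n \<Phi> \<le> measure_pmf.prob (unif_model n (P n) (sp n)) {S. \<Phi> S} + \<eta> n \<and>
          measure_pmf.prob (unif_model n (P n) (sm n)) {S. \<Phi> S} \<le> pr n \<Phi> + \<eta> n)"
    using sandwich_by_uniform by blast
  have sm: "\<forall>\<^sub>F n in sequentially. 0 \<le> \<delta> n \<and> sm n \<in> {1..P n} \<and> \<bar>real (sm n) - E n\<bar> \<le> \<delta> n * E n"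
    using ev by eventually_elim simp
  have sp: "\<forall>\<^sub>F n in sequentially. 0 \<le> \<delta> n \<and> sp n \<in> {1..P n} \<and> \<bar>real (sp n) - E n\<bar> \<le> \<delta> n * E n"
    using ev by eventually_elim simp
  obtain c1 where "uniform_sequence sm P k c1 (shifted sm)" using uniform_shifted[OF \<delta>L sm] by blast
  then interpret M: uniform_sequence sm P k c1 "shifted sm" .
  obtain c2 where "uniform_sequence sp P k c2 (shifted sp)" using uniform_shifted[OF \<delta>L sp] by blast
  then interpret N: uniform_sequence sp P k c2 "shifted sp" .
  have up: "\<forall>\<^sub>F n in sequentially. pr n (\<Phi> n) \<le> measure_pmf.prob (unif_model n (P n) (sp n)) {S. \<Phi> n S} + \<eta> n"
    if "\<And>n. increasing n (\<Phi> n)" for \<Phi> using ev by eventually_elim (use that in blast)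
  have low: "\<forall>\<^sub>F n in sequentially. measure_pmf.prob (unif_model n (P n) (sm n)) {S. \<Phi> n S} - \<eta> n \<le> pr n (\<Phi> n)"
    if "\<And>n. increasing n (\<Phi> n)" for \<Phi> using ev
  proof eventually_elim
    case (elim n)
    then have "measure_pmf.prob (unif_model n (P n) (sm n)) {S. \<Phi> n S} \<le> pr n (\<Phi> n) + \<eta> n" using that by blast
    then show ?case by simp
  qed
  have add: "(\<lambda>n. f n + \<eta> n) \<longlonglongrightarrow> b" if "f \<longlonglongrightarrow> b" for f b using tendsto_add[OF that \<eta>] by simp
  have sub: "(\<lambda>n. f n - \<eta> n) \<longlonglongrightarrow> b" if "f \<longlonglongrightarrow> b" for f b using tendsto_diff[OF that \<eta>] by simp
  have one: "\<forall>\<^sub>F n in sequentially. pr n (\<Phi> n) \<le> 1" for \<Phi> by (simp add: pr_def)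
  have zero: "\<forall>\<^sub>F n in sequentially. 0 \<le> pr n (\<Phi> n)" for \<Phi> by (simp add: pr_def)
  note inc = increasing_low_degree_empty[of _ k] increasing_k_connected[of _ k]
  {
    assume "\<alpha> \<longlonglongrightarrow> a"
    note M = M.limit_finite[OF shifted_tendsto[OF \<delta>L sm this]] and N = N.limit_finite[OF shifted_tendsto[OF \<delta>L sp this]]
    show "(\<lambda>n. pr n (\<lambda>S. low_degree n k S = {})) \<longlonglongrightarrow> exp (- (exp (- a) / fact (k - 1)))"
      by (rule tendsto_sandwich[OF low[OF inc(1)] up[OF inc(1)] sub[OF M(1)] add[OF N(1)]])
    show "(\<lambda>n. pr n (\<lambda>S. k_connected k (intersection_graph n S))) \<longlonglongrightarrow> exp (- (exp (- a) / fact (k - 1)))"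
      by (rule tendsto_sandwich[OF low[OF inc(2)] up[OF inc(2)] sub[OF M(2)] add[OF N(2)]])
  next
    assume "filterlim \<alpha> at_top sequentially"
    note M = M.limit_top[OF shifted_at_top[OF \<delta>L sm this]]
    show "(\<lambda>n. pr n (\<lambda>S. low_degree n k S = {})) \<longlonglongrightarrow> 1"
      by (rule tendsto_sandwich[OF low[OF inc(1)] one sub[OF M(1)] tendsto_const])
    show "(\<lambda>n. pr n (\<lambda>S. k_connected k (intersection_graph n S))) \<longlonglongrightarrow> 1"
      by (rule tendsto_sandwich[OF low[OF inc(2)] one sub[OF M(2)] tendsto_const])
  next
    assume "filterlim \<alpha> at_bot sequentially"
    note N = N.limit_bot[OF shifted_at_bot[OF \<delta>L sp this]]
    show "(\<lambda>n. pr n (\<lambda>S. low_degree n k S = {})) \<longlonglongrightarrow> 0"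
      by (rule tendsto_sandwich[OF zero up[OF inc(1)] tendsto_const add[OF N]])
  }
qed

lemma prob_k_connected_eq:
  "measure_pmf.prob (random_intersection_graph n (P n) (D n)) {G. k_connected k G} =
    pr n (\<lambda>S. k_connected k (intersection_graph n S))"
  by (simp add: random_intersection_graph_def pr_def vimage_def)

lemma prob_min_degree_eq:
  "n \<ge> 1 \<Longrightarrow> measure_pmf.prob (random_intersection_graph n (P n) (D n)) {G. min_degree G \<ge> k} =
    pr n (\<lambda>S. low_degree n k S = {})"
  by (simp add: random_intersection_graph_def pr_def vimage_def min_degree_intersection_graph_ge_iff)

text \<open>For \<open>n = 0\<close> the minimum ranges over an empty node set, so the probabilities
  are known to agree only from \<open>n = 1\<close> on.\<close>

lemma prob_min_degree_tendsto_iff: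
  "(\<lambda>n. measure_pmf.prob (random_intersection_graph n (P n) (D n)) {G. min_degree G \<ge> k}) \<longlonglongrightarrow> b \<longleftrightarrow>
    (\<lambda>n. pr n (\<lambda>S. low_degree n k S = {})) \<longlonglongrightarrow> b"
  using prob_min_degree_eq by (intro tendsto_cong) (auto simp: eventually_sequentially)

lemma prob_k_connected_at_bot:
  assumes "filterlim \<alpha> at_bot sequentially"
  shows "(\<lambda>n. pr n (\<lambda>S. k_connected k (intersection_graph n S))) \<longlonglongrightarrow> 0"
proof (rule tendsto_sandwich[OF _ _ tendsto_const limits(5)[OF assms]])
  show "\<forall>\<^sub>F n in sequentially. pr n (\<lambda>S. k_connected k (intersection_graph n S)) \<le> pr n (\<lambda>S. low_degree n k S = {})"
    using eventually_ge_at_top[of 2]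
    by eventually_elim (auto simp: pr_def intro!: measure_pmf.finite_measure_mono low_degree_empty_if_k_connected)
qed (simp add: pr_def)

end

theorem theorem3:
  fixes k :: nat and P :: "nat \<Rightarrow> nat" and D :: "nat \<Rightarrow> nat pmf" and \<alpha> :: "nat \<Rightarrow> real"
  assumes k_pos: "k \<ge> 1"
    and P_pos: "\<And>n. n \<ge> 1 \<Longrightarrow> P n \<ge> 1"
    and D_supp: "\<And>n. n \<ge> 1 \<Longrightarrow> set_pmf (D n) \<subseteq> {1..P n}"
    and alpha: "\<And>n. n \<ge> 2 \<Longrightarrow>
      (measure_pmf.expectation (D n) real)\<^sup>2 / real (P n)
        = (ln (real n) + (real k - 1) * ln (ln (real n)) + \<alpha> n) / real n"
    and expectation_growth:
      "(\<lambda>n. measure_pmf.expectation (D n) real) \<in> \<Omega>(\<lambda>n. sqrt (ln (real n)))"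
    and variance_small:
      "(\<lambda>n. measure_pmf.variance (D n) real)
        \<in> o(\<lambda>n. (measure_pmf.expectation (D n) real)\<^sup>2 / (real n * (ln (real n))\<^sup>2))"
  shows
    "(filterlim \<alpha> at_bot sequentially \<longrightarrow>
        (\<lambda>n. measure_pmf.prob (random_intersection_graph n (P n) (D n)) {G. k_connected k G})
          \<longlonglongrightarrow> 0) \<and>
     (filterlim \<alpha> at_top sequentially \<longrightarrow>
        (\<lambda>n. measure_pmf.prob (random_intersection_graph n (P n) (D n)) {G. k_connected k G})
          \<longlonglongrightarrow> 1) \<and>
     (\<forall>a::real. \<alpha> \<longlonglongrightarrow> a \<longrightarrow>
        (\<lambda>n. measure_pmf.prob (random_intersection_graph n (P n) (D n)) {G. k_connected k G})
          \<longlonglongrightarrow> exp (- (exp (- a) / fact (k - 1)))) \<and>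
     (filterlim \<alpha> at_bot sequentially \<longrightarrow>
        (\<lambda>n. measure_pmf.prob (random_intersection_graph n (P n) (D n)) {G. min_degree G \<ge> k})
          \<longlonglongrightarrow> 0) \<and>
     (filterlim \<alpha> at_top sequentially \<longrightarrow>
        (\<lambda>n. measure_pmf.prob (random_intersection_graph n (P n) (D n)) {G. min_degree G \<ge> k})
          \<longlonglongrightarrow> 1) \<and>
     (\<forall>a::real. \<alpha> \<longlonglongrightarrow> a \<longrightarrow>
        (\<lambda>n. measure_pmf.prob (random_intersection_graph n (P n) (D n)) {G. min_degree G \<ge> k})
          \<longlonglongrightarrow> exp (- (exp (- a) / fact (k - 1))))"
proof -
  interpret general_sequence k P D \<alpha>
    by unfold_locales (fact k_pos P_pos D_supp alpha expectation_growth variance_small)+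
  show ?thesis
    unfolding prob_k_connected_eq prob_min_degree_tendsto_iff
    by (intro conjI allI impI limits prob_k_connected_at_bot)
qed

end
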